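(* Let $P$ be a finite poset and let $k$ be a field. Let $\tau\in\mathcal{T}_f^P$ be a $P$-persistent finite topological space, with $X_a:=\tau(a)$ for $a\in P$ and $\tau_{ab}:=\tau(a\le b):X_a\to X_b$ for $a\le b$, and suppose that $\tau_{ab}$ is injective for all $a,b\in P$ with $a\le b$. Then there exists a $P$-weighted graph $(G,\omega)$ such that for every $i\ge 0$ there is an isomorphism of functors $P\to\mathrm{Vect}_k$ $$\mathrm{H}^{\mathrm S}_i\circ\tau\;\cong\;\mathrm{H}_i(G,\omega).$$
   Context: A poset $P$ is regarded as a category with one morphism $u\to v$ exactly when $u\le v$. For a category $\mathcal A$, $\mathcal A^P$ is the category of functors $P\to\mathcal A$ ($P$-persistent objects in $\mathcal A$) and natural transformations. $\mathcal T_f$ is the category of finite topological spaces and continuous maps. $\mathrm{Vect}_k$ is the category of $k$-vector spaces. $\mathrm H^{\mathrm S}_i:\mathcal T_f\to\mathrm{Vect}_k$ is singular homology with coefficients in $k$, and $\mathrm H_i$ of a simplicial complex is simplicial homology with coefficients in $k$. A (reflexive) graph is a finite simple graph with a self-loop at each vertex, equivalently a finite abstract simplicial complex of dimension at most $1$ (self-loops are identified with vertices); the null graph is allowed. The faces of $G$ are its vertices and edges, i.e. the nonempty simplices; the set of faces is ordered by inclusion $\subseteq$. A $P$-weighted graph is a pair $(G,\omega)$ where $G$ is a graph and $\omega:(G,\subseteq)\to P$ is an order-preserving function on the set of faces of $G$. For $v\in P$ put $G_v=\{x\in G\mid\omega(x)\le v\}$, a subgraph of $G$; for $u\le v$ we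 have $G_u\subseteq G_v$. The clique complex $\mathrm{Cl}(G)$ of a graph $G$ is the simplicial complex in which $[v_0,\dots,v_n]$ is a face if and only if the $v_i$ are vertices of $G$ that are pairwise joined by edges. The $P$-persistent homology $\mathrm H_i(G,\omega)$ of a $P$-weighted graph is the functor $P\to\mathrm{Vect}_k$ given by $v\mapsto\mathrm H_i(\mathrm{Cl}(G_v))$, with maps induced by the inclusions $G_u\subseteq G_v$ for $u\le v$. *)

theory Defs
  imports "HOL-Homology.Homology"
begin

section \<open>Vector spaces and persistent vector spaces\<close>

text \<open>
  Vector spaces over a field are modules in the sense of HOL-Algebra. The scalars are given by a
  type of class field, regarded as a ring record.
\<close>

definition scalars :: "'k::field ring" where
  "scalars = \<lparr>carrier = UNIV, mult = (*), one = 1, zero = 0, add = (+)\<rparr>"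

definition linear_maps ::
    "('k::field, 'm) module \<Rightarrow> ('k, 'n) module \<Rightarrow> ('m \<Rightarrow> 'n) set" where
  "linear_maps M N =
     {f. f \<in> carrier M \<rightarrow> carrier N \<and>
         (\<forall>x\<in>carrier M. \<forall>y\<in>carrier M. f (x \<oplus>\<^bsub>M\<^esub> y) = f x \<oplus>\<^bsub>N\<^esub> f y) \<and>
         (\<forall>a. \<forall>x\<in>carrier M. f (a \<odot>\<^bsub>M\<^esub> x) = a \<odot>\<^bsub>N\<^esub> f x)}"

text \<open>
  A functor from the poset \<open>P\<close> (a set of elements of a partially ordered type) to vector spaces is
  given by its objects \<open>V a\<close> and its maps \<open>f a b\<close> for \<open>a \<le> b\<close>. A map is only considered on the
  carrier of its domain.
\<close>

definition persistent_vector_space ::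
    "'p::order set \<Rightarrow> ('p \<Rightarrow> ('k::field, 'm) module) \<Rightarrow> ('p \<Rightarrow> 'p \<Rightarrow> 'm \<Rightarrow> 'm) \<Rightarrow> bool" where
  "persistent_vector_space P V f \<longleftrightarrow>
     (\<forall>a\<in>P. Module.module scalars (V a)) \<and>
     (\<forall>a\<in>P. \<forall>b\<in>P. a \<le> b \<longrightarrow> f a b \<in> linear_maps (V a) (V b)) \<and>
     (\<forall>a\<in>P. \<forall>x\<in>carrier (V a). f a a x = x) \<and>
     (\<forall>a\<in>P. \<forall>b\<in>P. \<forall>c\<in>P. a \<le> b \<longrightarrow> b \<le> c \<longrightarrow>
        (\<forall>x\<in>carrier (V a). f b c (f a b x) = f a c x))"

definition persistent_isomorphic ::
    "'p::order set \<Rightarrow> ('p \<Rightarrow> ('k::field, 'm) module) \<Rightarrow> ('p \<Rightarrow> 'p \<Rightarrow> 'm \<Rightarrow> 'm) \<Rightarrow>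
       ('p \<Rightarrow> ('k, 'n) module) \<Rightarrow> ('p \<Rightarrow> 'p \<Rightarrow> 'n \<Rightarrow> 'n) \<Rightarrow> bool" where
  "persistent_isomorphic P V f W g \<longleftrightarrow>
     (\<exists>\<phi>. (\<forall>a\<in>P. \<phi> a \<in> linear_maps (V a) (W a) \<and>
                   bij_betw (\<phi> a) (carrier (V a)) (carrier (W a))) \<and>
           (\<forall>a\<in>P. \<forall>b\<in>P. a \<le> b \<longrightarrow>
              (\<forall>x\<in>carrier (V a). \<phi> b (f a b x) = g a b (\<phi> a x))))"


section \<open>Homology with coefficients in a field\<close>

text \<open>
  Singular and simplicial homology are both the homology of the chain complex spanned by a graded
  set \<open>S\<close> of simplices with face operators: \<open>S n\<close> is the set of simplices of dimension \<open>n\<close>, and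
  \<open>d n j s\<close> is the \<open>j\<close>-th face (\<open>j \<le> n\<close>) of \<open>s \<in> S n\<close>. Chains are finitely supported functions
  from simplices to the field.
\<close>

abbreviation chain_smult :: "'k::field \<Rightarrow> ('s \<Rightarrow>\<^sub>0 'k) \<Rightarrow> ('s \<Rightarrow>\<^sub>0 'k)" where
  "chain_smult a \<equiv> Poly_Mapping.map ((*) a)"

definition linear_extend ::
    "('s \<Rightarrow> ('t \<Rightarrow>\<^sub>0 'k::field)) \<Rightarrow> ('s \<Rightarrow>\<^sub>0 'k) \<Rightarrow> ('t \<Rightarrow>\<^sub>0 'k)" where
  "linear_extend f c =
     (\<Sum>s\<in>Poly_Mapping.keys c. chain_smult (Poly_Mapping.lookup c s) (f s))"

definition chain_space :: "(nat \<Rightarrow> 's set) \<Rightarrow> nat \<Rightarrow> ('s \<Rightarrow>\<^sub>0 'k::field) set" where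
  "chain_space S n = {c. Poly_Mapping.keys c \<subseteq> S n}"

definition boundary ::
    "(nat \<Rightarrow> nat \<Rightarrow> 's \<Rightarrow> 's) \<Rightarrow> nat \<Rightarrow> ('s \<Rightarrow>\<^sub>0 'k::field) \<Rightarrow> ('s \<Rightarrow>\<^sub>0 'k)" where
  "boundary d n c =
     (if n = 0 then 0
      else linear_extend (\<lambda>s. \<Sum>j\<le>n. Poly_Mapping.single (d n j s) ((-1) ^ j)) c)"

definition cycles ::
    "(nat \<Rightarrow> nat \<Rightarrow> 's \<Rightarrow> 's) \<Rightarrow> (nat \<Rightarrow> 's set) \<Rightarrow> nat \<Rightarrow> ('s \<Rightarrow>\<^sub>0 'k::field) set" where
  "cycles d S n = {c \<in> chain_space S n. boundary d n c = 0}"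

definition boundaries ::
    "(nat \<Rightarrow> nat \<Rightarrow> 's \<Rightarrow> 's) \<Rightarrow> (nat \<Rightarrow> 's set) \<Rightarrow> nat \<Rightarrow> ('s \<Rightarrow>\<^sub>0 'k::field) set" where
  "boundaries d S n = boundary d (Suc n) ` chain_space S (Suc n)"

text \<open>
  The homology space is the quotient of the cycles by the boundaries, with cosets \<open>z + B\<close> as
  elements. Adding \<open>B\<close> in the scalar multiplication makes the product by \<open>0\<close> the coset \<open>B\<close>.
  The ring multiplication and its unit, which are part of the record type of modules, are
  irrelevant.
\<close>

definition homology ::
    "(nat \<Rightarrow> nat \<Rightarrow> 's \<Rightarrow> 's) \<Rightarrow> (nat \<Rightarrow> 's set) \<Rightarrow> nat \<Rightarrow> ('k::field, ('s \<Rightarrow>\<^sub>0 'k) set) module"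
  where
  "homology d S n =
     \<lparr>carrier = (\<lambda>z. (+) z ` boundaries d S n) ` cycles d S n,
      mult = undefined, one = undefined,
      zero = boundaries d S n,
      add = (\<lambda>C D. {c + e |c e. c \<in> C \<and> e \<in> D}),
      smult = (\<lambda>a C. {chain_smult a c + b |c b. c \<in> C \<and> b \<in> boundaries d S n})\<rparr>"

text \<open>
  The map induced by a chain map \<open>F\<close> sends the coset of a cycle \<open>z\<close> to the coset of \<open>F z\<close> in the
  target, here described without choosing \<open>z\<close>; the arguments \<open>d\<close>, \<open>S\<close> refer to the target.
\<close>

definition homology_map ::
    "(nat \<Rightarrow> nat \<Rightarrow> 't \<Rightarrow> 't) \<Rightarrow> (nat \<Rightarrow> 't set) \<Rightarrow> nat \<Rightarrow>
       (('s \<Rightarrow>\<^sub>0 'k::field) \<Rightarrow> ('t \<Rightarrow>\<^sub>0 'k)) \<Rightarrow> ('s \<Rightarrow>\<^sub>0 'k) set \<Rightarrow> ('t \<Rightarrow>\<^sub>0 'k) set" where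
  "homology_map d S n F C = {F c + b |c b. c \<in> C \<and> b \<in> boundaries d S n}"


section \<open>Singular homology\<close>

definition singular_homology ::
    "nat \<Rightarrow> 'a topology \<Rightarrow> ('k::field, (((nat \<Rightarrow> real) \<Rightarrow> 'a) \<Rightarrow>\<^sub>0 'k) set) module" where
  "singular_homology i X = homology singular_face (\<lambda>n. singular_simplex_set n X) i"

definition singular_homology_map ::
    "nat \<Rightarrow> 'b topology \<Rightarrow> ('a \<Rightarrow> 'b) \<Rightarrow>
       (((nat \<Rightarrow> real) \<Rightarrow> 'a) \<Rightarrow>\<^sub>0 'k::field) set \<Rightarrow> (((nat \<Rightarrow> real) \<Rightarrow> 'b) \<Rightarrow>\<^sub>0 'k) set" where
  "singular_homology_map i Y f =
     homology_map singular_face (\<lambda>n. singular_simplex_set n Y) i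
       (linear_extend (\<lambda>s. Poly_Mapping.single (simplex_map i f s) 1))"


section \<open>Simplicial homology\<close>

text \<open>
  A simplicial complex is the set of its nonempty faces. Orientations are fixed by a linear order of
  the vertices: the \<open>j\<close>-th face of a simplex is obtained by removing its \<open>j\<close>-th vertex in that order.
\<close>

definition abstract_simplicial_complex :: "'v set set \<Rightarrow> bool" where
  "abstract_simplicial_complex K \<longleftrightarrow>
     (\<forall>\<sigma>\<in>K. finite \<sigma> \<and> \<sigma> \<noteq> {} \<and> (\<forall>\<rho>. \<rho> \<subseteq> \<sigma> \<and> \<rho> \<noteq> {} \<longrightarrow> \<rho> \<in> K))"

definition n_simplices :: "'v set set \<Rightarrow> nat \<Rightarrow> 'v set set" where
  "n_simplices K n = {\<sigma> \<in> K. card \<sigma> = Suc n}"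

definition simplex_face :: "nat \<Rightarrow> nat \<Rightarrow> 'v::linorder set \<Rightarrow> 'v set" where
  "simplex_face n j \<sigma> = \<sigma> - {sorted_list_of_set \<sigma> ! j}"

definition simplicial_homology ::
    "nat \<Rightarrow> 'v::linorder set set \<Rightarrow> ('k::field, ('v set \<Rightarrow>\<^sub>0 'k) set) module" where
  "simplicial_homology i K = homology simplex_face (n_simplices K) i"

text \<open>
  The map to the homology of \<open>L\<close> induced by the inclusion of a subcomplex of \<open>L\<close>. On chains the
  inclusion is the identity.
\<close>

definition simplicial_homology_inclusion ::
    "nat \<Rightarrow> 'v::linorder set set \<Rightarrow> ('v set \<Rightarrow>\<^sub>0 'k::field) set \<Rightarrow> ('v set \<Rightarrow>\<^sub>0 'k) set" where
  "simplicial_homology_inclusion i L = homology_map simplex_face (n_simplices L) i (\<lambda>c. c)"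


section \<open>Weighted graphs\<close>

definition finite_graph :: "'v set set \<Rightarrow> bool" where
  "finite_graph G \<longleftrightarrow> finite G \<and> abstract_simplicial_complex G \<and> (\<forall>x\<in>G. card x \<le> 2)"

definition weighted_graph :: "'p::order set \<Rightarrow> 'v set set \<Rightarrow> ('v set \<Rightarrow> 'p) \<Rightarrow> bool" where
  "weighted_graph P G \<omega> \<longleftrightarrow>
     finite_graph G \<and> \<omega> \<in> G \<rightarrow> P \<and> (\<forall>x\<in>G. \<forall>y\<in>G. x \<subseteq> y \<longrightarrow> \<omega> x \<le> \<omega> y)"

definition sublevel_graph :: "'v set set \<Rightarrow> ('v set \<Rightarrow> 'p::order) \<Rightarrow> 'p \<Rightarrow> 'v set set" where
  "sublevel_graph G \<omega> v = {x \<in> G. \<omega> x \<le> v}"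

text \<open>For \<open>u = v\<close> the condition \<open>{u, v} \<in> G\<close> says that \<open>u\<close> is a vertex of \<open>G\<close>.\<close>

definition clique_complex :: "'v set set \<Rightarrow> 'v set set" where
  "clique_complex G = {\<sigma>. finite \<sigma> \<and> \<sigma> \<noteq> {} \<and> (\<forall>u\<in>\<sigma>. \<forall>v\<in>\<sigma>. {u, v} \<in> G)}"

definition graph_homology ::
    "nat \<Rightarrow> 'v::linorder set set \<Rightarrow> ('v set \<Rightarrow> 'p::order) \<Rightarrow> 'p \<Rightarrow>
       ('k::field, ('v set \<Rightarrow>\<^sub>0 'k) set) module" where
  "graph_homology i G \<omega> v = simplicial_homology i (clique_complex (sublevel_graph G \<omega> v))"

definition graph_homology_map ::
    "nat \<Rightarrow> 'v::linorder set set \<Rightarrow> ('v set \<Rightarrow> 'p::order) \<Rightarrow> 'p \<Rightarrow> 'p \<Rightarrow>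
       ('v set \<Rightarrow>\<^sub>0 'k::field) set \<Rightarrow> ('v set \<Rightarrow>\<^sub>0 'k) set" where
  "graph_homology_map i G \<omega> u v =
     simplicial_homology_inclusion i (clique_complex (sublevel_graph G \<omega> v))"


section \<open>Persistent finite topological spaces\<close>

definition persistent_finite_space ::
    "'p::order set \<Rightarrow> ('p \<Rightarrow> 'a topology) \<Rightarrow> ('p \<Rightarrow> 'p \<Rightarrow> 'a \<Rightarrow> 'a) \<Rightarrow> bool" where
  "persistent_finite_space P X \<tau> \<longleftrightarrow>
     (\<forall>a\<in>P. finite (topspace (X a))) \<and>
     (\<forall>a\<in>P. \<forall>b\<in>P. a \<le> b \<longrightarrow> continuous_map (X a) (X b) (\<tau> a b)) \<and>
     (\<forall>a\<in>P. \<forall>x\<in>topspace (X a). \<tau> a a x = x) \<and>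
     (\<forall>a\<in>P. \<forall>b\<in>P. \<forall>c\<in>P. a \<le> b \<longrightarrow> b \<le> c \<longrightarrow>
        (\<forall>x\<in>topspace (X a). \<tau> b c (\<tau> a b x) = \<tau> a c x))"


section \<open>The constructions are well defined\<close>

text \<open>
  In both theories boundaries are cycles, and singular homology of a persistent space as well as
  the homology of a weighted graph are persistent vector spaces.
\<close>

lemma lookup_chain_smult [simp]:
  "Poly_Mapping.lookup (chain_smult a c) s = a * Poly_Mapping.lookup c s"
  by (simp add: Poly_Mapping.map.rep_eq "when_def")

interpretation chain: vector_space "chain_smult :: 'k::field \<Rightarrow> ('s \<Rightarrow>\<^sub>0 'k) \<Rightarrow> ('s \<Rightarrow>\<^sub>0 'k)"
  by unfold_locales (auto intro!: poly_mapping_eqI simp: lookup_add algebra_simps)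

interpretation chain_pair:
  vector_space_pair "chain_smult :: 'k::field \<Rightarrow> ('s \<Rightarrow>\<^sub>0 'k) \<Rightarrow> ('s \<Rightarrow>\<^sub>0 'k)"
    "chain_smult :: 'k \<Rightarrow> ('t \<Rightarrow>\<^sub>0 'k) \<Rightarrow> ('t \<Rightarrow>\<^sub>0 'k)"
  by unfold_locales

abbreviation chain_linear :: "(('s \<Rightarrow>\<^sub>0 'k::field) \<Rightarrow> ('t \<Rightarrow>\<^sub>0 'k)) \<Rightarrow> bool" where
  "chain_linear \<equiv> Vector_Spaces.linear chain_smult chain_smult"

lemma chain_linearI:
  assumes "\<And>x y. F (x + y) = F x + F y" "\<And>a x. F (chain_smult a x) = chain_smult a (F x)"
  shows "chain_linear F"
  using assms by unfold_locales auto

lemma linear_extend_superset: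
  assumes "finite A" "Poly_Mapping.keys c \<subseteq> A"
  shows "linear_extend f c = (\<Sum>s\<in>A. chain_smult (Poly_Mapping.lookup c s) (f s))"
  unfolding linear_extend_def
  by (rule sum.mono_neutral_left) (use assms in \<open>auto simp: in_keys_iff\<close>)

lemma linear_linear_extend:
  "chain_linear (linear_extend (f :: 's \<Rightarrow> ('t \<Rightarrow>\<^sub>0 'k::field)))"
proof (rule chain_linearI)
  fix x y :: "'s \<Rightarrow>\<^sub>0 'k"
  let ?A = "Poly_Mapping.keys x \<union> Poly_Mapping.keys y"
  show "linear_extend f (x + y) = linear_extend f x + linear_extend f y"
    using keys_add[of x y]
    by (simp add: linear_extend_superset[of ?A] lookup_add chain.scale_left_distrib sum.distrib)
next
  fix a and x :: "'s \<Rightarrow>\<^sub>0 'k"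
  have "Poly_Mapping.keys (chain_smult a x) \<subseteq> Poly_Mapping.keys x"
    by (auto simp: in_keys_iff)
  then show "linear_extend f (chain_smult a x) = chain_smult a (linear_extend f x)"
    by (simp add: linear_extend_superset[of "Poly_Mapping.keys x"] chain.scale_sum_right)
qed

lemma linear_extend_single [simp]:
  "linear_extend f (Poly_Mapping.single s a) = chain_smult a (f s)"
  by (simp add: linear_extend_superset[of "{s}"])

lemma linear_extend_unique:
  assumes "chain_linear F" "\<And>s. s \<in> Poly_Mapping.keys c \<Longrightarrow> F (Poly_Mapping.single s 1) = f s"
  shows "F c = linear_extend f c"
proof -
  interpret F: Vector_Spaces.linear chain_smult chain_smult F by fact
  have "c = (\<Sum>s\<in>Poly_Mapping.keys c. chain_smult (Poly_Mapping.lookup c s) (Poly_Mapping.single s 1))"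
    by (rule poly_mapping_eqI) (simp add: lookup_sum lookup_single "when_def" in_keys_iff)
  then have "F c = F (\<Sum>s\<in>Poly_Mapping.keys c. chain_smult (Poly_Mapping.lookup c s) (Poly_Mapping.single s 1))"
    by simp
  also have "\<dots> = linear_extend f c"
    by (simp only: F.sum F.scale assms(2) linear_extend_def cong: sum.cong)
  finally show ?thesis .
qed

lemma chain_linear_eq:
  assumes "chain_linear F" "chain_linear G"
    and "\<And>s. s \<in> Poly_Mapping.keys c \<Longrightarrow> F (Poly_Mapping.single s 1) = G (Poly_Mapping.single s 1)"
  shows "F c = G c"
  using linear_extend_unique[OF assms(1), of c "\<lambda>s. G (Poly_Mapping.single s 1)"]
    linear_extend_unique[OF assms(2), of c "\<lambda>s. G (Poly_Mapping.single s 1)"] assms(3) by simp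

lemma linear_extend_in_chain_space:
  assumes "c \<in> chain_space S n" "\<And>s. s \<in> S n \<Longrightarrow> f s \<in> chain_space T m"
  shows "linear_extend f c \<in> chain_space T m"
proof -
  have "Poly_Mapping.keys (chain_smult (Poly_Mapping.lookup c s) (f s)) \<subseteq> T m"
    if "s \<in> Poly_Mapping.keys c" for s
    using that assms by (fastforce simp: chain_space_def in_keys_iff)
  then show ?thesis
    unfolding chain_space_def linear_extend_def
    using keys_sum[of "\<lambda>s. chain_smult (Poly_Mapping.lookup c s) (f s)" "Poly_Mapping.keys c"] by blast
qed

lemma subspace_chain_space: "chain.subspace (chain_space S n :: ('s \<Rightarrow>\<^sub>0 'k::field) set)"
proof -
  have "Poly_Mapping.keys (chain_smult a c) \<subseteq> Poly_Mapping.keys c" for a and c :: "'s \<Rightarrow>\<^sub>0 'k"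
    by (auto simp: in_keys_iff)
  then show ?thesis
    using order_trans[OF keys_add Un_least]
    unfolding chain.subspace_def chain_space_def mem_Collect_eq keys_zero by blast
qed

lemma linear_boundary:
  "chain_linear (boundary d n :: ('s \<Rightarrow>\<^sub>0 'k::field) \<Rightarrow> _)"
proof (cases "n = 0")
  case True
  then show ?thesis by (auto intro!: chain_linearI simp: boundary_def)
next
  case False
  then have "(boundary d n :: ('s \<Rightarrow>\<^sub>0 'k) \<Rightarrow> _) = linear_extend (\<lambda>s. \<Sum>j\<le>n. Poly_Mapping.single (d n j s) ((-1) ^ j))"
    by (simp add: fun_eq_iff boundary_def)
  then show ?thesis by (simp only: linear_linear_extend)
qed

lemma boundary_single:
  "n \<noteq> 0 \<Longrightarrow> boundary d n (Poly_Mapping.single s a) =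
     chain_smult a (\<Sum>j\<le>n. Poly_Mapping.single (d n j s) ((-1) ^ j))"
  by (simp add: boundary_def)

lemma subspace_cycles: "chain.subspace (cycles d S n :: ('s \<Rightarrow>\<^sub>0 'k::field) set)"
proof -
  interpret b: Vector_Spaces.linear chain_smult chain_smult
    "boundary d n :: ('s \<Rightarrow>\<^sub>0 'k) \<Rightarrow> _" by (rule linear_boundary)
  show ?thesis
    using subspace_chain_space[of S n] by (auto simp: chain.subspace_def cycles_def b.add b.scale)
qed

lemma subspace_boundaries: "chain.subspace (boundaries d S n :: ('s \<Rightarrow>\<^sub>0 'k::field) set)"
  unfolding boundaries_def
  by (rule chain_pair.linear_subspace_image[OF linear_boundary subspace_chain_space])

lemma boundary_boundary:
  fixes c :: "'s \<Rightarrow>\<^sub>0 'k::field"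
  assumes c: "c \<in> chain_space S (Suc n)"
    and faces: "\<And>i j s. s \<in> S (Suc n) \<Longrightarrow> i \<le> j \<Longrightarrow> j \<le> n \<Longrightarrow> n \<noteq> 0 \<Longrightarrow>
                  d n i (d (Suc n) (Suc j) s) = d n j (d (Suc n) i s)"
  shows "boundary d n (boundary d (Suc n) c) = 0"
proof (cases "n = 0")
  case True then show ?thesis by (simp add: boundary_def)
next
  case False
  interpret b: Vector_Spaces.linear chain_smult chain_smult
    "boundary d n :: ('s \<Rightarrow>\<^sub>0 'k) \<Rightarrow> _" by (rule linear_boundary)
  have lin: "chain_linear (\<lambda>c::'s \<Rightarrow>\<^sub>0 'k. boundary d n (boundary d (Suc n) c))"
    using Vector_Spaces.linear_compose[OF linear_boundary linear_boundary] by (simp add: o_def)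
  have "boundary d n (boundary d (Suc n) (Poly_Mapping.single s (1::'k))) = 0" if s: "s \<in> S (Suc n)" for s
  proof -
    let ?f = "\<lambda>(k, i). Poly_Mapping.single (d n i (d (Suc n) k s)) ((-1::'k) ^ (k + i))"
    let ?A = "{..Suc n} \<times> {..n}"
    let ?L = "{(k, i). i < k \<and> k \<le> Suc n}" and ?R = "{(i, j). i \<le> j \<and> j \<le> n}"
    have split: "?A = ?L \<union> ?R" "?L \<inter> ?R = {}" by auto
    have fin: "finite ?L" "finite ?R"
      by (rule finite_subset[of _ ?A]; auto)+
    have L: "?L = (\<lambda>(i, j). (Suc j, i)) ` ?R"
    proof safe
      fix k i assume "i < k" "k \<le> Suc n"
      then show "(k, i) \<in> (\<lambda>(i, j). (Suc j, i)) ` ?R"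
        by (intro image_eqI[of _ _ "(i, k - 1)"]) auto
    qed auto
    have "boundary d n (boundary d (Suc n) (Poly_Mapping.single s (1::'k))) =
      (\<Sum>k\<le>Suc n. \<Sum>i\<le>n. ?f (k, i))"
    proof -
      have *: "chain_smult a (Poly_Mapping.single t e) = Poly_Mapping.single t (a * e)" for a e :: 'k and t :: 's
        by (rule poly_mapping_eqI) (simp add: lookup_single "when_def")
      show ?thesis
        using False
        by (simp add: boundary_single b.sum chain.scale_sum_right * power_add del: sum.atMost_Suc)
    qed
    also have "\<dots> = sum ?f ?A" by (simp add: sum.cartesian_product del: sum.atMost_Suc)
    also have "\<dots> = sum ?f ?L + sum ?f ?R"
      using split fin by (simp add: sum.union_disjoint)
    also have "sum ?f ?L = (\<Sum>(i, j)\<in>?R. - ?f (i, j))"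
      unfolding L
      by (subst sum.reindex) (auto simp: inj_on_def faces s False add.commute single_uminus intro!: sum.cong)
    also have "\<dots> + sum ?f ?R = 0"
      by (simp add: sum_negf case_prod_beta)
    finally show ?thesis .
  qed
  then show ?thesis
    using c chain_linear_eq[OF lin chain_pair.linear_zero, of c] by (auto simp: chain_space_def)
qed

lemma boundary_in_chain_space:
  fixes c :: "'s \<Rightarrow>\<^sub>0 'k::field"
  assumes "\<And>j s. s \<in> S (Suc n) \<Longrightarrow> j \<le> Suc n \<Longrightarrow> d (Suc n) j s \<in> S n"
    and "c \<in> chain_space S (Suc n)"
  shows "boundary d (Suc n) c \<in> chain_space S n"
proof -
  have "Poly_Mapping.single (d (Suc n) j s) ((-1::'k) ^ j) \<in> chain_space S n"
    if "s \<in> S (Suc n)" "j \<le> Suc n" for j s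
    using assms(1)[OF that] by (simp add: chain_space_def)
  then have "(\<Sum>j\<le>Suc n. Poly_Mapping.single (d (Suc n) j s) ((-1::'k) ^ j)) \<in> chain_space S n"
    if "s \<in> S (Suc n)" for s
    using that by (intro chain.subspace_sum subspace_chain_space) auto
  then show ?thesis
    unfolding boundary_def using assms(2)
    by (auto simp del: sum.atMost_Suc intro: linear_extend_in_chain_space)
qed

lemma boundaries_subset_cycles:
  fixes d :: "nat \<Rightarrow> nat \<Rightarrow> 's \<Rightarrow> 's"
  assumes "\<And>j s. s \<in> S (Suc n) \<Longrightarrow> j \<le> Suc n \<Longrightarrow> d (Suc n) j s \<in> S n"
    and "\<And>i j s. s \<in> S (Suc n) \<Longrightarrow> i \<le> j \<Longrightarrow> j \<le> n \<Longrightarrow> n \<noteq> 0 \<Longrightarrow>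
                  d n i (d (Suc n) (Suc j) s) = d n j (d (Suc n) i s)"
  shows "boundaries d S n \<subseteq> (cycles d S n :: ('s \<Rightarrow>\<^sub>0 'k::field) set)"
proof
  fix z :: "'s \<Rightarrow>\<^sub>0 'k" assume "z \<in> boundaries d S n"
  then obtain c where c: "c \<in> chain_space S (Suc n)" "z = boundary d (Suc n) c"
    by (auto simp: boundaries_def)
  have "boundary d n (boundary d (Suc n) c) = 0"
    using c(1) assms(2) by (rule boundary_boundary)
  moreover have "boundary d (Suc n) c \<in> chain_space S n"
    using assms(1) c(1) by (rule boundary_in_chain_space)
  ultimately show "z \<in> cycles d S n"
    by (simp add: cycles_def c(2))
qed

lemma add_cosets:
  fixes B :: "('s \<Rightarrow>\<^sub>0 'k::field) set"
  assumes "chain.subspace B"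
  shows "{c + e |c e. c \<in> (+) z ` B \<and> e \<in> (+) w ` B} = (+) (z + w) ` B"
proof safe
  fix x y assume "x \<in> B" "y \<in> B"
  then show "z + x + (w + y) \<in> (+) (z + w) ` B"
    using assms by (intro image_eqI[of _ _ "x + y"]) (auto simp: chain.subspace_add)
next
  fix x assume "x \<in> B"
  then show "\<exists>c e. z + w + x = c + e \<and> c \<in> (+) z ` B \<and> e \<in> (+) w ` B"
    using chain.subspace_0[OF assms]
    by (intro exI[of _ "z + 0"] exI[of _ "w + x"] conjI imageI) (auto simp: add.assoc)
qed

lemma coset_map:
  fixes B :: "('s \<Rightarrow>\<^sub>0 'k::field) set" and B' :: "('t \<Rightarrow>\<^sub>0 'k) set"
  assumes "chain.subspace B" "chain.subspace B'" "chain_linear F" "F ` B \<subseteq> B'"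
  shows "{F c + b |c b. c \<in> (+) z ` B \<and> b \<in> B'} = (+) (F z) ` B'"
proof -
  interpret F: Vector_Spaces.linear chain_smult chain_smult F by fact
  show ?thesis
  proof safe
    fix x b assume "x \<in> B" "b \<in> B'"
    then show "F (z + x) + b \<in> (+) (F z) ` B'"
      using assms by (intro image_eqI[of _ _ "F x + b"]) (auto simp: chain.subspace_add F.add add.assoc)
  next
    fix b assume "b \<in> B'"
    then show "\<exists>c b'. F z + b = F c + b' \<and> c \<in> (+) z ` B \<and> b' \<in> B'"
      using chain.subspace_0[OF assms(1)]
      by (intro exI[of _ "z + 0"] exI[of _ b] conjI imageI) auto
  qed
qed

lemma homology_add_coset:
  "(+) z ` boundaries d S n \<oplus>\<^bsub>homology d S n\<^esub> (+) w ` boundaries d S n =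
     (+) (z + w) ` (boundaries d S n :: ('s \<Rightarrow>\<^sub>0 'k::field) set)"
  by (simp add: homology_def add_cosets[OF subspace_boundaries])

lemma homology_smult_coset:
  "a \<odot>\<^bsub>homology d S n\<^esub> (+) z ` boundaries d S n =
     (+) (chain_smult a z) ` (boundaries d S n :: ('s \<Rightarrow>\<^sub>0 'k::field) set)"
proof -
  have "chain_linear (chain_smult a :: ('s \<Rightarrow>\<^sub>0 'k) \<Rightarrow> _)"
    by (rule chain_linearI) (simp_all add: chain.scale_right_distrib mult.commute)
  moreover have "chain_smult a ` boundaries d S n \<subseteq> (boundaries d S n :: ('s \<Rightarrow>\<^sub>0 'k) set)"
    using chain.subspace_scale[OF subspace_boundaries] by blast
  ultimately show ?thesis
    by (simp add: homology_def coset_map[OF subspace_boundaries subspace_boundaries])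
qed

lemma module_homology:
  "Module.module scalars (homology d S n :: ('k::field, ('s \<Rightarrow>\<^sub>0 'k) set) module)"
proof -
  let ?B = "boundaries d S n :: ('s \<Rightarrow>\<^sub>0 'k) set" and ?Z = "cycles d S n :: ('s \<Rightarrow>\<^sub>0 'k) set"
  have B: "chain.subspace ?B" and Z: "chain.subspace ?Z"
    by (rule subspace_boundaries subspace_cycles)+
  note hadd = homology_add_coset[where d = d and S = S and n = n] and hsmult = homology_smult_coset[where d = d and S = S and n = n]
  have car: "carrier (homology d S n :: ('k, ('s \<Rightarrow>\<^sub>0 'k) set) module) = (\<lambda>z. (+) z ` ?B) ` ?Z"
    and zero: "\<zero>\<^bsub>homology d S n\<^esub> = (+) 0 ` ?B"
    by (simp_all add: homology_def)
  have fld: "cring (scalars :: 'k ring)"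
  proof (rule cringI)
    show "abelian_group (scalars :: 'k ring)"
      by (rule abelian_groupI) (auto simp: scalars_def add_ac intro: exI[of _ "- x" for x] add.right_inverse)
    show "comm_monoid (scalars :: 'k ring)"
      by (rule comm_monoidI) (auto simp: scalars_def mult_ac)
  qed (simp add: scalars_def algebra_simps)
  have grp: "abelian_group (homology d S n :: ('k, ('s \<Rightarrow>\<^sub>0 'k) set) module)"
  proof (rule abelian_groupI)
    fix x assume "x \<in> carrier (homology d S n :: ('k, ('s \<Rightarrow>\<^sub>0 'k) set) module)"
    then obtain z where z: "z \<in> ?Z" "x = (+) z ` ?B" by (auto simp: homology_def)
    then have "(+) (- z) ` ?B \<in> carrier (homology d S n)"
      using imageI[OF chain.subspace_neg[OF Z z(1)], of "\<lambda>z. (+) z ` ?B"] by (simp only: car)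
    moreover have "(+) (- z) ` ?B \<oplus>\<^bsub>homology d S n\<^esub> x = \<zero>\<^bsub>homology d S n\<^esub>"
      unfolding z hadd zero by (simp only: add.left_inverse)
    ultimately show "\<exists>y\<in>carrier (homology d S n). y \<oplus>\<^bsub>homology d S n\<^esub> x = \<zero>\<^bsub>homology d S n\<^esub>"
      by blast
  next
    show "\<zero>\<^bsub>homology d S n\<^esub> \<in> carrier (homology d S n :: ('k, ('s \<Rightarrow>\<^sub>0 'k) set) module)"
      using imageI[OF chain.subspace_0[OF Z], of "\<lambda>z. (+) z ` ?B"] by (simp add: homology_def)
  next
    fix x assume "x \<in> carrier (homology d S n :: ('k, ('s \<Rightarrow>\<^sub>0 'k) set) module)"
    then obtain z where z: "x = (+) z ` ?B" by (auto simp: homology_def)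
    show "\<zero>\<^bsub>homology d S n\<^esub> \<oplus>\<^bsub>homology d S n\<^esub> x = x"
      unfolding z hadd zero by (simp only: add_0)
  next
    fix x y assume "x \<in> carrier (homology d S n :: ('k, ('s \<Rightarrow>\<^sub>0 'k) set) module)" "y \<in> carrier (homology d S n :: ('k, ('s \<Rightarrow>\<^sub>0 'k) set) module)"
    then obtain z w where z: "z \<in> ?Z" "x = (+) z ` ?B" and w: "w \<in> ?Z" "y = (+) w ` ?B"
      by (auto simp: homology_def)
    show "x \<oplus>\<^bsub>homology d S n\<^esub> y \<in> carrier (homology d S n)"
      unfolding z w using imageI[OF chain.subspace_add[OF Z z(1) w(1)], of "\<lambda>z. (+) z ` ?B"]
      by (simp only: hadd car)
    show "x \<oplus>\<^bsub>homology d S n\<^esub> y = y \<oplus>\<^bsub>homology d S n\<^esub> x"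
      unfolding z w hadd by (simp only: add.commute)
    fix u assume "u \<in> carrier (homology d S n :: ('k, ('s \<Rightarrow>\<^sub>0 'k) set) module)"
    then obtain v where v: "u = (+) v ` ?B" by (auto simp: homology_def)
    show "x \<oplus>\<^bsub>homology d S n\<^esub> y \<oplus>\<^bsub>homology d S n\<^esub> u = x \<oplus>\<^bsub>homology d S n\<^esub> (y \<oplus>\<^bsub>homology d S n\<^esub> u)"
      unfolding z w v hadd by (simp only: add.assoc)
  qed
  show ?thesis
  proof (rule moduleI[OF fld grp])
    fix a b :: 'k and x y assume "x \<in> carrier (homology d S n :: ('k, ('s \<Rightarrow>\<^sub>0 'k) set) module)" "y \<in> carrier (homology d S n :: ('k, ('s \<Rightarrow>\<^sub>0 'k) set) module)"
    then obtain z w where z: "z \<in> ?Z" "x = (+) z ` ?B" and w: "w \<in> ?Z" "y = (+) w ` ?B"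
      by (auto simp: homology_def)
    show "a \<odot>\<^bsub>homology d S n\<^esub> x \<in> carrier (homology d S n)"
      unfolding z using imageI[OF chain.subspace_scale[OF Z z(1)], of "\<lambda>z. (+) z ` ?B"]
      by (simp only: hsmult car)
    show "\<one>\<^bsub>scalars\<^esub> \<odot>\<^bsub>homology d S n\<^esub> x = x"
      unfolding z hsmult by (simp add: scalars_def)
    show "(a \<oplus>\<^bsub>scalars\<^esub> b) \<odot>\<^bsub>homology d S n\<^esub> x =
        a \<odot>\<^bsub>homology d S n\<^esub> x \<oplus>\<^bsub>homology d S n\<^esub> b \<odot>\<^bsub>homology d S n\<^esub> x"
      unfolding z hsmult hadd by (simp add: scalars_def chain.scale_left_distrib)
    show "a \<odot>\<^bsub>homology d S n\<^esub> (x \<oplus>\<^bsub>homology d S n\<^esub> y) =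
        a \<odot>\<^bsub>homology d S n\<^esub> x \<oplus>\<^bsub>homology d S n\<^esub> a \<odot>\<^bsub>homology d S n\<^esub> y"
      unfolding z w hsmult hadd by (simp add: chain.scale_right_distrib)
    show "(a \<otimes>\<^bsub>scalars\<^esub> b) \<odot>\<^bsub>homology d S n\<^esub> x =
        a \<odot>\<^bsub>homology d S n\<^esub> (b \<odot>\<^bsub>homology d S n\<^esub> x)"
      unfolding z hsmult by (simp add: scalars_def)
  qed
qed

lemma homology_map_coset:
  fixes F :: "('s \<Rightarrow>\<^sub>0 'k::field) \<Rightarrow> ('t \<Rightarrow>\<^sub>0 'k)"
  assumes "chain_linear F" "F ` boundaries d S n \<subseteq> boundaries d' S' n"
  shows "homology_map d' S' n F ((+) z ` boundaries d S n) = (+) (F z) ` boundaries d' S' n"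
  unfolding homology_map_def
  by (rule coset_map[OF subspace_boundaries subspace_boundaries assms])

lemma homology_map_linear:
  fixes F :: "('s \<Rightarrow>\<^sub>0 'k::field) \<Rightarrow> ('t \<Rightarrow>\<^sub>0 'k)"
  assumes F: "chain_linear F" and B: "F ` boundaries d S n \<subseteq> boundaries d' S' n"
    and Z: "F ` cycles d S n \<subseteq> cycles d' S' n"
  shows "homology_map d' S' n F \<in> linear_maps (homology d S n) (homology d' S' n)"
proof -
  interpret F: Vector_Spaces.linear chain_smult chain_smult F by fact
  have *: "carrier (homology d S n) = (\<lambda>z. (+) z ` boundaries d S n) ` cycles d S n"
    "carrier (homology d' S' n) = (\<lambda>z. (+) z ` boundaries d' S' n) ` cycles d' S' n"
    for d :: "nat \<Rightarrow> nat \<Rightarrow> 's \<Rightarrow> 's" and S and d' :: "nat \<Rightarrow> nat \<Rightarrow> 't \<Rightarrow> 't" and S'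
    by (simp_all add: homology_def)
  show ?thesis
    using Z
    by (auto simp: linear_maps_def * homology_map_coset[OF F B] homology_add_coset
        homology_smult_coset F.add F.scale)
qed

lemma chain_map_cycles_boundaries:
  fixes F :: "nat \<Rightarrow> ('s \<Rightarrow>\<^sub>0 'k::field) \<Rightarrow> ('t \<Rightarrow>\<^sub>0 'k)"
  assumes F: "\<And>n. chain_linear (F n)"
    and C: "\<And>n. F n ` chain_space S n \<subseteq> chain_space S' n"
    and d: "\<And>n c. c \<in> chain_space S (Suc n) \<Longrightarrow>
               boundary d' (Suc n) (F (Suc n) c) = F n (boundary d (Suc n) c)"
  shows "F n ` cycles d S n \<subseteq> cycles d' S' n" "F n ` boundaries d S n \<subseteq> boundaries d' S' n"
proof -
  have F0: "F n 0 = 0" for n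
  proof -
    interpret F: Vector_Spaces.linear chain_smult chain_smult "F n" by (rule F)
    show ?thesis by (rule F.zero)
  qed
  show "F n ` cycles d S n \<subseteq> cycles d' S' n"
  proof (cases n)
    case 0
    then show ?thesis using C[of 0] by (auto simp: cycles_def boundary_def)
  next
    case (Suc m)
    then show ?thesis using C[of n] d[of _ m] F0 by (auto simp: cycles_def)
  qed
  show "F n ` boundaries d S n \<subseteq> boundaries d' S' n"
  proof -
    have "F n (boundary d (Suc n) c) \<in> boundaries d' S' n" if "c \<in> chain_space S (Suc n)" for c
      unfolding boundaries_def d[OF that, symmetric] using that C[of "Suc n"] by blast
    then show ?thesis by (auto simp: boundaries_def[of d S])
  qed
qed

lemma persistent_vector_space_homology:
  fixes S :: "'p::order \<Rightarrow> nat \<Rightarrow> 's set" and F :: "'p \<Rightarrow> 'p \<Rightarrow> nat \<Rightarrow> ('s \<Rightarrow>\<^sub>0 'k::field) \<Rightarrow> ('s \<Rightarrow>\<^sub>0 'k)"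
  assumes F: "\<And>a b n. chain_linear (F a b n)"
    and C: "\<And>a b n. a \<in> P \<Longrightarrow> b \<in> P \<Longrightarrow> a \<le> b \<Longrightarrow> F a b n ` chain_space (S a) n \<subseteq> chain_space (S b) n"
    and d: "\<And>a b n c. a \<in> P \<Longrightarrow> b \<in> P \<Longrightarrow> a \<le> b \<Longrightarrow> c \<in> chain_space (S a) (Suc n) \<Longrightarrow>
               boundary d (Suc n) (F a b (Suc n) c) = F a b n (boundary d (Suc n) c)"
    and id: "\<And>a n c. a \<in> P \<Longrightarrow> c \<in> chain_space (S a) n \<Longrightarrow> F a a n c = c"
    and comp: "\<And>a b c n x. a \<in> P \<Longrightarrow> b \<in> P \<Longrightarrow> c \<in> P \<Longrightarrow> a \<le> b \<Longrightarrow> b \<le> c \<Longrightarrow>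
                 x \<in> chain_space (S a) n \<Longrightarrow> F b c n (F a b n x) = F a c n x"
  shows "persistent_vector_space P (\<lambda>a. homology d (S a) n) (\<lambda>a b. homology_map d (S b) n (F a b n))"
proof -
  have Z: "F a b n ` cycles d (S a) n \<subseteq> cycles d (S b) n" 
    and B: "F a b n ` boundaries d (S a) n \<subseteq> boundaries d (S b) n"
    if "a \<in> P" "b \<in> P" "a \<le> b" for a b
    using chain_map_cycles_boundaries[of "F a b" "S a" "S b" d d n, OF F C[OF that] d[OF that]] by auto
  have car: "carrier (homology d S n) = (\<lambda>z. (+) z ` boundaries d S n) ` (cycles d S n :: ('s \<Rightarrow>\<^sub>0 'k) set)" for S
    by (simp add: homology_def)
  have cyc: "z \<in> chain_space S n" if "z \<in> cycles d S n" for S and z :: "'s \<Rightarrow>\<^sub>0 'k"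
    using that by (simp add: cycles_def)
  note map = homology_map_coset[OF F B]
  show ?thesis
    unfolding persistent_vector_space_def
  proof (intro conjI ballI impI)
    fix a b c x assume a: "a \<in> P" "b \<in> P" "c \<in> P" "a \<le> b" "b \<le> c"
      and "x \<in> carrier (homology d (S a) n :: ('k, ('s \<Rightarrow>\<^sub>0 'k) set) module)"
    then obtain z where z: "z \<in> cycles d (S a) n" "x = (+) z ` boundaries d (S a) n"
      by (auto simp: car)
    have "a \<le> c" using a by order
    then show "homology_map d (S c) n (F b c n) (homology_map d (S b) n (F a b n) x) =
        homology_map d (S c) n (F a c n) x"
      using a cyc[OF z(1)] by (simp add: z(2) map comp)
  next
    fix a x assume a: "a \<in> P" and "x \<in> carrier (homology d (S a) n :: ('k, ('s \<Rightarrow>\<^sub>0 'k) set) module)"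
    then obtain z where z: "z \<in> cycles d (S a) n" "x = (+) z ` boundaries d (S a) n"
      by (auto simp: car)
    then show "homology_map d (S a) n (F a a n) x = x"
      using a cyc[OF z(1)] by (simp add: z(2) map id)
    next
    fix a b assume "a \<in> P" "b \<in> P" "a \<le> b"
    then show "homology_map d (S b) n (F a b n) \<in> linear_maps (homology d (S a) n) (homology d (S b) n)"
      by (intro homology_map_linear F B Z)
  qed (rule module_homology)
qed

lemma singular_face_face:
  assumes "n \<noteq> 0" "i \<le> j" "j \<le> n"
  shows "singular_face n i (singular_face (Suc n) (Suc j) s) =
         singular_face n j (singular_face (Suc n) i s)"
proof
  fix t
  show "singular_face n i (singular_face (Suc n) (Suc j) s) t =
         singular_face n j (singular_face (Suc n) i s) t"
  proof (cases "t \<in> standard_simplex (n - 1)")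
    case True
    have "simplical_face i t \<in> standard_simplex n" "simplical_face j t \<in> standard_simplex n"
      using simplical_face_in_standard_simplex[of n _ t] True assms by auto
    moreover have "simplical_face (Suc j) (simplical_face i t) = simplical_face i (simplical_face j t)"
      using assms by (auto simp: simplical_face_def fun_eq_iff)
    ultimately show ?thesis by (simp add: singular_face_def)
  qed (simp add: singular_face_def)
qed

lemma singular_boundaries_subset_cycles:
  "boundaries singular_face (\<lambda>n. singular_simplex_set n X) i
     \<subseteq> (cycles singular_face (\<lambda>n. singular_simplex_set n X) i :: (_ \<Rightarrow>\<^sub>0 'k::field) set)"
proof (rule boundaries_subset_cycles)
  show "singular_face (Suc i) j s \<in> singular_simplex_set i X"
    if "s \<in> singular_simplex_set (Suc i) X" "j \<le> Suc i" for j s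
    using singular_simplex_singular_face[of "Suc i" X s j] that by simp
qed (rule singular_face_face)

lemma persistent_vector_space_singular_homology:
  assumes "persistent_finite_space P X \<tau>"
  shows "persistent_vector_space P
           (\<lambda>a. singular_homology i (X a) ::
                  ('k::field, (((nat \<Rightarrow> real) \<Rightarrow> 'a) \<Rightarrow>\<^sub>0 'k) set) module)
           (\<lambda>a b. singular_homology_map i (X b) (\<tau> a b))"
  unfolding singular_homology_def singular_homology_map_def
proof (rule persistent_vector_space_homology)
  let ?S = "\<lambda>a n. singular_simplex_set n (X a)"
  let ?F = "\<lambda>a b n. linear_extend (\<lambda>s. Poly_Mapping.single (simplex_map n (\<tau> a b) s) (1::'k))"
  show lin: "chain_linear (?F a b n)" for a b n
    by (rule linear_linear_extend)
  have cont: "continuous_map (X a) (X b) (\<tau> a b)" if "a \<in> P" "b \<in> P" "a \<le> b" for a b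
    using assms that by (auto simp: persistent_finite_space_def)
  show "?F a b n ` chain_space (?S a) n \<subseteq> chain_space (?S b) n" if "a \<in> P" "b \<in> P" "a \<le> b" for a b n
    using singular_simplex_simplex_map[OF _ cont[OF that]]
    by (auto intro!: linear_extend_in_chain_space[where S = "\<lambda>n. singular_simplex_set n (X a)"])
       (auto simp: chain_space_def)
  show "boundary singular_face (Suc n) (?F a b (Suc n) c) = ?F a b n (boundary singular_face (Suc n) c)"
    if "a \<in> P" "b \<in> P" "a \<le> b" "c \<in> chain_space (?S a) (Suc n)" for a b n c
  proof -
    interpret F: Vector_Spaces.linear chain_smult chain_smult "?F a b n" by (rule lin)
    have face: "singular_face (Suc n) j (simplex_map (Suc n) (\<tau> a b) s) =
        simplex_map n (\<tau> a b) (singular_face (Suc n) j s)" if "j \<le> Suc n" for j s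
      using that singular_face_simplex_map[of "Suc n" j "\<tau> a b" s]
      by (auto simp: singular_face_def simplex_map_def fun_eq_iff)
    show ?thesis
      by (rule chain_linear_eq[OF Vector_Spaces.linear_compose[OF lin linear_boundary, unfolded o_def]
              Vector_Spaces.linear_compose[OF linear_boundary lin, unfolded o_def]])
        (simp add: boundary_single F.sum face del: sum.atMost_Suc)
  qed
  have idl: "chain_linear (\<lambda>x::((nat \<Rightarrow> real) \<Rightarrow> 'a) \<Rightarrow>\<^sub>0 'k. x)"
    by (rule chain_linearI) auto
  show "?F a a n c = c" if "a \<in> P" "c \<in> chain_space (?S a) n" for a n c
  proof (rule chain_linear_eq[OF lin idl])
    fix s assume "s \<in> Poly_Mapping.keys c"
    then have "singular_simplex n (X a) s" using that by (auto simp: chain_space_def)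
    then have "simplex_map n (\<tau> a a) s = s"
      by (rule simplex_map_id_gen) (use assms that in \<open>auto simp: persistent_finite_space_def\<close>)
    then show "?F a a n (Poly_Mapping.single s 1) = Poly_Mapping.single s 1" by simp
  qed
  show "?F b c n (?F a b n x) = ?F a c n x"
    if "a \<in> P" "b \<in> P" "c \<in> P" "a \<le> b" "b \<le> c" "x \<in> chain_space (?S a) n" for a b c n x
  proof (rule chain_linear_eq[OF Vector_Spaces.linear_compose[OF lin lin, unfolded o_def] lin])
    fix s assume "s \<in> Poly_Mapping.keys x"
    then have "singular_simplex n (X a) s" using that by (auto simp: chain_space_def)
    moreover have "\<tau> b c (\<tau> a b y) = \<tau> a c y" if "y \<in> topspace (X a)" for y
      using assms that \<open>a \<in> P\<close> \<open>b \<in> P\<close> \<open>c \<in> P\<close> \<open>a \<le> b\<close> \<open>b \<le> c\<close>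
      unfolding persistent_finite_space_def by blast
    ultimately have "simplex_map n (\<tau> b c \<circ> \<tau> a b) s = simplex_map n (\<tau> a c) s"
      by (intro simplex_map_eq) auto
    then show "?F b c n (?F a b n (Poly_Mapping.single s 1)) = ?F a c n (Poly_Mapping.single s 1)"
      by (simp add: simplex_map_compose)
  qed
qed

lemma simplex_face_eq_image:
  assumes "finite \<sigma>" "card \<sigma> = Suc n" "j \<le> n"
  shows "sorted_list_of_set (simplex_face n j \<sigma>) =
           take j (sorted_list_of_set \<sigma>) @ drop (Suc j) (sorted_list_of_set \<sigma>)"
proof -
  let ?l = "sorted_list_of_set \<sigma>"
  have l: "?l = take j ?l @ ?l ! j # drop (Suc j) ?l"
    using assms by (intro id_take_nth_drop) simp
  have "sorted_list_of_set (simplex_face n j \<sigma>) = remove1 (?l ! j) ?l"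
    using assms by (simp add: simplex_face_def sorted_list_of_set_remove)
  also have "\<dots> = remove1 (?l ! j) (take j ?l @ ?l ! j # drop (Suc j) ?l)"
    using l by simp
  also have "?l ! j \<notin> set (take j ?l)"
    using distinct_sorted_list_of_set[of \<sigma>] by (subst (asm) l) auto
  then have "remove1 (?l ! j) (take j ?l @ ?l ! j # drop (Suc j) ?l) = take j ?l @ drop (Suc j) ?l"
    by (simp add: remove1_append)
  finally show ?thesis .
qed

lemma simplex_face_face:
  assumes "finite \<sigma>" "card \<sigma> = Suc (Suc n)" "i \<le> j" "j \<le> n"
  shows "simplex_face n i (simplex_face (Suc n) (Suc j) \<sigma>) =
         simplex_face n j (simplex_face (Suc n) i \<sigma>)"
proof -
  have "sorted_list_of_set (simplex_face (Suc n) (Suc j) \<sigma>) ! i = sorted_list_of_set \<sigma> ! i"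
    "sorted_list_of_set (simplex_face (Suc n) i \<sigma>) ! j = sorted_list_of_set \<sigma> ! Suc j"
    using assms by (simp_all add: simplex_face_eq_image nth_append)
  then show ?thesis
    by (auto simp: simplex_face_def)
qed

lemma abstract_simplicial_complexD:
  assumes "abstract_simplicial_complex K" "\<sigma> \<in> K"
  shows "finite \<sigma>" "\<sigma> \<noteq> {}" "\<rho> \<subseteq> \<sigma> \<Longrightarrow> \<rho> \<noteq> {} \<Longrightarrow> \<rho> \<in> K"
  using assms unfolding abstract_simplicial_complex_def by (metis, metis, metis)

lemma simplex_face_in_n_simplices:
  assumes "abstract_simplicial_complex K" "\<sigma> \<in> n_simplices K (Suc n)" "j \<le> Suc n"
  shows "simplex_face (Suc n) j \<sigma> \<in> n_simplices K n"
proof -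
  have \<sigma>: "finite \<sigma>" "\<sigma> \<in> K" "card \<sigma> = Suc (Suc n)"
    using assms by (auto simp: n_simplices_def dest: abstract_simplicial_complexD)
  then have "sorted_list_of_set \<sigma> ! j \<in> \<sigma>"
    using assms(3) nth_mem[of j "sorted_list_of_set \<sigma>"] by simp
  then have card: "card (simplex_face (Suc n) j \<sigma>) = Suc n"
    using \<sigma> by (simp add: simplex_face_def)
  then have "simplex_face (Suc n) j \<sigma> \<noteq> {}" by auto
  moreover have "simplex_face (Suc n) j \<sigma> \<subseteq> \<sigma>"
    by (simp add: simplex_face_def Diff_subset)
  ultimately have "simplex_face (Suc n) j \<sigma> \<in> K"
    by (intro abstract_simplicial_complexD(3)[OF assms(1) \<sigma>(2)])
  with card show ?thesis by (simp add: n_simplices_def)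
qed

lemma simplicial_boundaries_subset_cycles:
  assumes "abstract_simplicial_complex K"
  shows "boundaries simplex_face (n_simplices K) i
           \<subseteq> (cycles simplex_face (n_simplices K) i :: (_ \<Rightarrow>\<^sub>0 'k::field) set)"
  using assms
  by (intro boundaries_subset_cycles simplex_face_in_n_simplices simplex_face_face)
     (auto simp: n_simplices_def dest: abstract_simplicial_complexD)

lemma abstract_simplicial_complex_clique_complex: "abstract_simplicial_complex (clique_complex G)"
  by (auto simp: abstract_simplicial_complex_def clique_complex_def intro: finite_subset)

lemma finite_graph_sublevel_graph:
  assumes "weighted_graph P G \<omega>"
  shows "finite_graph (sublevel_graph G \<omega> v)"
proof -
  have G: "abstract_simplicial_complex G" "finite G" "\<And>x. x \<in> G \<Longrightarrow> card x \<le> 2"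
    and \<omega>: "\<And>x y. x \<in> G \<Longrightarrow> y \<in> G \<Longrightarrow> x \<subseteq> y \<Longrightarrow> \<omega> x \<le> \<omega> y"
    using assms by (simp_all add: weighted_graph_def finite_graph_def)
  have "abstract_simplicial_complex (sublevel_graph G \<omega> v)"
    unfolding abstract_simplicial_complex_def
  proof (intro ballI conjI allI impI)
    fix \<sigma> assume "\<sigma> \<in> sublevel_graph G \<omega> v"
    then have \<sigma>: "\<sigma> \<in> G" "\<omega> \<sigma> \<le> v" by (auto simp: sublevel_graph_def)
    show "finite \<sigma>" "\<sigma> \<noteq> {}" using abstract_simplicial_complexD[OF G(1) \<sigma>(1)] by auto
    fix \<rho> assume \<rho>: "\<rho> \<subseteq> \<sigma> \<and> \<rho> \<noteq> {}"
    then have "\<rho> \<in> G" using abstract_simplicial_complexD(3)[OF G(1) \<sigma>(1)] by simp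
    moreover have "\<omega> \<rho> \<le> v" using \<omega>[OF calculation \<sigma>(1)] \<rho> \<sigma>(2) by (auto intro: order_trans)
    ultimately show "\<rho> \<in> sublevel_graph G \<omega> v" by (simp add: sublevel_graph_def)
  qed
  then show ?thesis
    using G by (simp add: finite_graph_def sublevel_graph_def)
qed

lemma persistent_vector_space_graph_homology:
  fixes P :: "'p::order set" and G :: "'v::linorder set set" and \<omega> :: "'v set \<Rightarrow> 'p"
  shows "persistent_vector_space P
     (graph_homology i G \<omega> :: _ \<Rightarrow> ('k::field, ('v set \<Rightarrow>\<^sub>0 'k) set) module)
     (graph_homology_map i G \<omega>)"
proof -
  have "persistent_vector_space P
     (\<lambda>a. homology simplex_face (n_simplices (clique_complex (sublevel_graph G \<omega> a))) i ::
         ('k, ('v set \<Rightarrow>\<^sub>0 'k) set) module)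
     (\<lambda>a b. homology_map simplex_face (n_simplices (clique_complex (sublevel_graph G \<omega> b))) i (\<lambda>c. c))"
  proof (rule persistent_vector_space_homology[where F = "\<lambda>a b n c. c"])
    fix a b :: 'p and n assume "a \<le> b"
    then have "n_simplices (clique_complex (sublevel_graph G \<omega> a)) n
      \<subseteq> n_simplices (clique_complex (sublevel_graph G \<omega> b)) n"
      by (auto simp: n_simplices_def clique_complex_def sublevel_graph_def intro: order_trans)
    then show "(\<lambda>c. c) ` chain_space (\<lambda>n. n_simplices (clique_complex (sublevel_graph G \<omega> a)) n) n
      \<subseteq> (chain_space (\<lambda>n. n_simplices (clique_complex (sublevel_graph G \<omega> b)) n) n :: ('v set \<Rightarrow>\<^sub>0 'k) set)"
      by (auto simp: chain_space_def)
  qed (auto intro: chain_linearI)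
  then show ?thesis
    by (simp add: graph_homology_def[abs_def] graph_homology_map_def[abs_def]
        simplicial_homology_def simplicial_homology_inclusion_def[abs_def])
qed

end

theory Submission
  imports Defs
begin

text \<open>
  In a finite space \<open>X\<close> every point \<open>m\<close> has a smallest open neighbourhood \<open>U\<^sub>m\<close>, and the relation
  \<open>x \<in> U\<^sub>m\<close> is a preorder, the specialization preorder, which continuous maps preserve. By a theorem
  of McCord the singular homology of \<open>X\<close> is that of the clique complex of the comparability graph of
  this preorder. The graph built here glues these comparability graphs over \<open>P\<close> like a mapping
  telescope. Its vertices are the pairs \<open>(a, x)\<close> with \<open>x \<in> X\<^sub>a\<close>, born at \<open>a\<close>. Two vertices \<open>(a, x)\<close> and
  \<open>(b, y)\<close> with \<open>a \<le> b\<close> are joined by an edge born at \<open>b\<close> when the image of \<open>x\<close> in \<open>X\<^sub>b\<close> is comparable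
  with \<open>y\<close>. No edge joins vertices with incomparable births, so every edge has one well-defined birth,
  even if \<open>P\<close> has no joins.

  At stage \<open>c\<close> each vertex \<open>(a, x)\<close> has a position \<open>\<tau> a c x\<close> in \<open>X\<^sub>c\<close>, and the vertices of a clique have
  pairwise comparable positions. Hence a clique \<open>\<sigma>\<close> has a vertex whose position \<open>p \<sigma>\<close> is above all
  others, and \<open>\<sigma>\<close> can be sent to a singular chain in the set \<open>U\<close> of \<open>p \<sigma>\<close>. That set is a cone with
  apex \<open>p \<sigma>\<close>: a singular simplex in it can be coned off to the apex, because the apex has no other
  neighbourhood. So a chain map \<open>realize\<close> is given by recursion on the dimension: realize the boundary
  of \<open>\<sigma>\<close>, and take the cone over the result. No orientations have to be compared. The vertex with the
  highest position is chosen at the stage at which all vertices of \<open>\<sigma>\<close> have just been born; it stays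
  highest at later stages, and therefore \<open>realize\<close> commutes with the structure maps already on
  chains (\<open>realize_chain_natural\<close>).

  It remains to see that \<open>realize\<close> induces isomorphisms in homology at a fixed stage, that is, that its
  mapping cone is acyclic. This is shown for the part over each open set \<open>W\<close> of \<open>X\<^sub>c\<close>, by induction on
  the number of points of \<open>W\<close> (\<open>acyclic_realization_cone\<close>). If \<open>W\<close> is some \<open>U\<^sub>m\<close>, both sides are cones:
  the singular one with apex \<open>m\<close>, the simplicial one with the vertex \<open>(c, m)\<close> as apex. Otherwise a
  maximal point \<open>m\<close> of \<open>W\<close> gives \<open>W = V \<union> U\<^sub>m\<close>, where \<open>V\<close> consists of the points that are not above
  \<open>m\<close>, and the sets \<open>V\<close>, \<open>U\<^sub>m\<close> and \<open>V \<inter> U\<^sub>m\<close> have fewer points; this is a Mayer-Vietoris argument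
  (\<open>acyclic_complex_sum\<close>). A clique over \<open>W\<close> lies over \<open>V\<close> or over \<open>U\<^sub>m\<close>, according to where its
  highest position is, while singular chains of \<open>W\<close> have to be subdivided to become sums of chains of
  \<open>V\<close> and of \<open>U\<^sub>m\<close> (\<open>chain_homologous_to_small_chain\<close>).
\<close>

section \<open>Chains and mapping cones\<close>

lemma
  assumes "chain_linear F"
  shows chain_linear_add: "F (x + y) = F x + F y"
    and chain_linear_diff: "F (x - y) = F x - F y"
    and chain_linear_minus: "F (- x) = - F x"
    and chain_linear_zero: "F 0 = 0"
    and chain_linear_sum: "F (sum f A) = (\<Sum>a\<in>A. F (f a))"
    and chain_linear_scale: "F (chain_smult a x) = chain_smult a (F x)"
proof -
  interpret Vector_Spaces.linear chain_smult chain_smult F by fact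
  show "F (x + y) = F x + F y" "F (x - y) = F x - F y" "F (- x) = - F x" "F 0 = 0"
    "F (sum f A) = (\<Sum>a\<in>A. F (f a))" "F (chain_smult a x) = chain_smult a (F x)"
    by (fact add diff neg zero sum scale)+
qed

lemmas boundary_linear_simps = chain_linear_add[OF linear_boundary] chain_linear_diff[OF linear_boundary]
  chain_linear_minus[OF linear_boundary] chain_linear_zero[OF linear_boundary]

lemma
  fixes x y :: "'s \<Rightarrow>\<^sub>0 'k::field"
  shows chain_space_add: "x \<in> chain_space S n \<Longrightarrow> y \<in> chain_space S n \<Longrightarrow> x + y \<in> chain_space S n"
  and chain_space_diff: "x \<in> chain_space S n \<Longrightarrow> y \<in> chain_space S n \<Longrightarrow> x - y \<in> chain_space S n"
  and chain_space_minus: "x \<in> chain_space S n \<Longrightarrow> - x \<in> chain_space S n"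
  and chain_space_zero: "(0 :: 's \<Rightarrow>\<^sub>0 'k) \<in> chain_space S n"
  by (simp_all add: chain.subspace_add chain.subspace_diff chain.subspace_neg chain.subspace_0
      subspace_chain_space)

lemma chain_space_single [simp]:
  "Poly_Mapping.single s (1::'k::field) \<in> chain_space S n \<longleftrightarrow> s \<in> S n"
  by (simp add: chain_space_def)

lemma chain_smult_single: "chain_smult a (Poly_Mapping.single s b) = Poly_Mapping.single s (a * b)"
  by (rule poly_mapping_eqI) (simp add: lookup_single "when_def")

lemma coset_eq_iff:
  fixes z w :: "'s \<Rightarrow>\<^sub>0 'k::field"
  shows "(+) z ` boundaries d S n = (+) w ` boundaries d S n \<longleftrightarrow> z - w \<in> boundaries d S n"
proof
  assume "(+) z ` boundaries d S n = (+) w ` boundaries d S n"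
  moreover have "z + 0 \<in> (+) z ` boundaries d S n"
    by (rule imageI) (rule chain.subspace_0[OF subspace_boundaries])
  ultimately show "z - w \<in> boundaries d S n" by auto
next
  assume *: "z - w \<in> boundaries d S n"
  show "(+) z ` boundaries d S n = (+) w ` boundaries d S n"
  proof safe
    fix x :: "'s \<Rightarrow>\<^sub>0 'k" assume "x \<in> boundaries d S n"
    then show "z + x \<in> (+) w ` boundaries d S n"
      using chain.subspace_add[OF subspace_boundaries *]
      by (intro image_eqI[of _ _ "(z - w) + x"]) auto
  next
    fix x :: "'s \<Rightarrow>\<^sub>0 'k" assume "x \<in> boundaries d S n"
    then show "w + x \<in> (+) z ` boundaries d S n"
      using chain.subspace_diff[OF subspace_boundaries _ *]
      by (intro image_eqI[of _ _ "x - (z - w)"]) auto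
  qed
qed

text \<open>
  A value of \<open>homology_map\<close> contains the image of a representative, so it is the coset of that image
  as soon as it is a coset at all. This evaluates an induced map that is known to be well defined
  without checking once more that its chain map preserves boundaries.
\<close>
lemma homology_map_coset_eq:
  fixes F :: "('s \<Rightarrow>\<^sub>0 'k::field) \<Rightarrow> ('t \<Rightarrow>\<^sub>0 'k)"
  assumes "homology_map e T n F ((+) z ` boundaries d S n) \<in> carrier (homology e T n)"
  shows "homology_map e T n F ((+) z ` boundaries d S n) = (+) (F z) ` boundaries e T n"
proof -
  obtain y where y: "homology_map e T n F ((+) z ` boundaries d S n) = (+) y ` boundaries e T n"
    using assms by (auto simp: homology_def)
  have "F (z + 0) + 0 \<in> homology_map e T n F ((+) z ` boundaries d S n)"
    unfolding homology_map_def
    by (intro CollectI exI[of _ "z + 0"] exI[of _ 0] conjI imageI refl chain.subspace_0[OF subspace_boundaries])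
  then have "F z - y \<in> boundaries e T n" by (auto simp: y)
  then show ?thesis unfolding y coset_eq_iff[symmetric] by (rule sym)
qed

text \<open>
  With \<open>D 0 = 0\<close> the condition includes that homology vanishes in degree \<open>0\<close>, without augmentation.
\<close>
definition acyclic_complex :: "(nat \<Rightarrow> 'g::ab_group_add \<Rightarrow> 'g) \<Rightarrow> (nat \<Rightarrow> 'g set) \<Rightarrow> bool" where
  "acyclic_complex D A \<longleftrightarrow> (\<forall>n. \<forall>z\<in>A n. D n z = 0 \<longrightarrow> (\<exists>w\<in>A (Suc n). D (Suc n) w = z))"

text \<open>
  The Mayer-Vietoris argument, in the form in which no connecting map appears. If \<open>a + b\<close> is a cycle,
  then \<open>D a = - D b\<close> is a cycle of the intersection, hence equal to \<open>D e\<close> with \<open>e\<close> in the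
  intersection, and \<open>a - e\<close> and \<open>b + e\<close> are cycles of the two summands.
\<close>
lemma acyclic_complex_sum:
  fixes D :: "nat \<Rightarrow> 'g::ab_group_add \<Rightarrow> 'g"
  assumes add: "\<And>n x y. D n (x + y) = D n x + D n y"
    and D0: "\<And>x. D 0 x = 0"
    and DD: "\<And>n x. x \<in> A (Suc n) \<Longrightarrow> D n (D (Suc n) x) = 0"
    and A: "\<And>n x y. x \<in> A n \<Longrightarrow> y \<in> A n \<Longrightarrow> x - y \<in> A n"
    and B: "\<And>n x y. x \<in> B n \<Longrightarrow> y \<in> B n \<Longrightarrow> x - y \<in> B n"
    and DA: "\<And>n x. x \<in> A (Suc n) \<Longrightarrow> D (Suc n) x \<in> A n"
    and DB: "\<And>n x. x \<in> B (Suc n) \<Longrightarrow> D (Suc n) x \<in> B n"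
    and acyclic: "acyclic_complex D A" "acyclic_complex D B" "acyclic_complex D (\<lambda>n. A n \<inter> B n)"
  shows "acyclic_complex D (\<lambda>n. {a + b |a b. a \<in> A n \<and> b \<in> B n})"
  unfolding acyclic_complex_def
proof (intro allI ballI impI)
  fix n z assume "z \<in> {a + b |a b. a \<in> A n \<and> b \<in> B n}" and Dz: "D n z = 0"
  then obtain a b where ab: "z = a + b" "a \<in> A n" "b \<in> B n" by auto
  have "\<exists>e. e \<in> A n \<and> e \<in> B n \<and> D n e = D n a"
  proof (cases n)
    case 0
    have "a - a \<in> A n" "b - b \<in> B n" using A B ab by blast+
    then show ?thesis by (intro exI[of _ 0]) (simp add: D0 0)
  next
    case (Suc m)
    have "D n a = (D n b - D n b) - D n b"
      using Dz by (simp add: ab add add_eq_0_iff)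
    moreover have "D n b \<in> B m" using DB ab by (simp add: Suc)
    ultimately have "D n a \<in> B m" using B by metis
    then have "D n a \<in> A m \<inter> B m" "D m (D n a) = 0"
      using DA DD ab by (simp_all add: Suc)
    then show ?thesis
      using acyclic(3) unfolding acyclic_complex_def by (metis Int_iff Suc)
  qed
  then obtain e where e: "e \<in> A n" "e \<in> B n" "D n e = D n a" by blast
  have diff: "D n (x - y) = D n x - D n y" for x y
    using add[of n "x - y" y] by (simp add: eq_diff_eq)
  have "b - ((e - e) - e) \<in> B n" using e ab B by blast
  then have "a - e \<in> A n" "b + e \<in> B n" "D n (a - e) = 0" "D n (b + e) = 0"
    using e ab A Dz by (simp_all add: diff add add.commute)
  then obtain a' b' where "a' \<in> A (Suc n)" "D (Suc n) a' = a - e" "b' \<in> B (Suc n)" "D (Suc n) b' = b + e"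
    using acyclic(1,2) unfolding acyclic_complex_def by metis
  then show "\<exists>w\<in>{a + b |a b. a \<in> A (Suc n) \<and> b \<in> B (Suc n)}. D (Suc n) w = z"
    by (intro bexI[of _ "a' + b'"]) (auto simp: add ab)
qed

text \<open>
  The mapping cone of a chain map from \<open>S\<close>-chains to \<open>T\<close>-chains: in degree \<open>n\<close> it pairs chains of
  degree \<open>n\<close> of the target with chains of degree \<open>n - 1\<close> of the source.
\<close>
definition mapping_cone :: "(nat \<Rightarrow> 't set) \<Rightarrow> (nat \<Rightarrow> 's set) \<Rightarrow> nat \<Rightarrow>
    (('t \<Rightarrow>\<^sub>0 'k::field) \<times> ('s \<Rightarrow>\<^sub>0 'k)) set" where
  "mapping_cone T S n = chain_space T n \<times> (case n of 0 \<Rightarrow> {0} | Suc m \<Rightarrow> chain_space S m)"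

definition cone_boundary :: "(nat \<Rightarrow> nat \<Rightarrow> 't \<Rightarrow> 't) \<Rightarrow> (nat \<Rightarrow> nat \<Rightarrow> 's \<Rightarrow> 's) \<Rightarrow>
    (nat \<Rightarrow> ('s \<Rightarrow>\<^sub>0 'k::field) \<Rightarrow> ('t \<Rightarrow>\<^sub>0 'k)) \<Rightarrow> nat \<Rightarrow>
    ('t \<Rightarrow>\<^sub>0 'k) \<times> ('s \<Rightarrow>\<^sub>0 'k) \<Rightarrow> ('t \<Rightarrow>\<^sub>0 'k) \<times> ('s \<Rightarrow>\<^sub>0 'k)" where
  "cone_boundary e d F n = (\<lambda>(t, c). case n of 0 \<Rightarrow> 0
     | Suc m \<Rightarrow> (boundary e n t + F m c, - boundary d m c))"

lemma cone_boundary_add: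
  assumes "\<And>n. chain_linear (F n)"
  shows "cone_boundary e d F n (x + y) = cone_boundary e d F n x + cone_boundary e d F n y"
  by (cases x; cases y; cases n)
     (simp_all add: cone_boundary_def boundary_linear_simps chain_linear_add[OF assms] add_ac zero_prod_def)

lemma mapping_cone_add: "x \<in> mapping_cone T S n \<Longrightarrow> y \<in> mapping_cone T S n \<Longrightarrow> x + y \<in> mapping_cone T S n"
  by (auto simp: mapping_cone_def chain_space_add split: nat.splits)

lemma mapping_cone_diff: "x \<in> mapping_cone T S n \<Longrightarrow> y \<in> mapping_cone T S n \<Longrightarrow> x - y \<in> mapping_cone T S n"
  by (auto simp: mapping_cone_def chain_space_diff split: nat.splits)

lemma mapping_cone_mono:
  assumes "\<And>n. T n \<subseteq> T' n" "\<And>n. S n \<subseteq> S' n"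
  shows "mapping_cone T S n \<subseteq> mapping_cone T' S' n"
  using assms by (fastforce simp: mapping_cone_def chain_space_def split: nat.splits)

lemma chain_space_split:
  fixes c :: "'s \<Rightarrow>\<^sub>0 'k::field"
  assumes "c \<in> chain_space (\<lambda>n. S n \<union> T n) n"
  obtains a b where "a \<in> chain_space S n" "b \<in> chain_space T n" "c = a + b"
proof
  let ?a = "linear_extend (\<lambda>s. if s \<in> S n then Poly_Mapping.single s (1::'k) else 0)"
  let ?b = "linear_extend (\<lambda>s. if s \<in> S n then 0 else Poly_Mapping.single s (1::'k))"
  show "?a c \<in> chain_space S n" "?b c \<in> chain_space T n"
    by (rule linear_extend_in_chain_space[OF assms]; auto simp: chain_space_zero)+
  show "c = ?a c + ?b c"
  proof (rule chain_linear_eq[where F = "\<lambda>c. c" and G = "\<lambda>c. ?a c + ?b c"])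
    show "chain_linear (\<lambda>c. ?a c + ?b c)"
      by (rule chain_linearI)
         (simp_all add: chain_linear_add[OF linear_linear_extend] chain_linear_scale[OF linear_linear_extend]
           chain.scale_right_distrib add_ac)
  qed (auto intro: chain_linearI)
qed

text \<open>
  A cycle \<open>(t, c)\<close> of the mapping cone is a cycle \<open>c\<close> of the source together with a chain \<open>t\<close> that
  bounds the image of \<open>- c\<close>. Filling such pairs gives injectivity, filling the pairs \<open>(t, 0)\<close> gives
  surjectivity.
\<close>
lemma homology_map_bij_if_mapping_cone_acyclic:
  fixes F :: "nat \<Rightarrow> ('s \<Rightarrow>\<^sub>0 'k::field) \<Rightarrow> ('t \<Rightarrow>\<^sub>0 'k)"
  assumes F: "\<And>n. chain_linear (F n)"
    and C: "\<And>n. F n ` chain_space S n \<subseteq> chain_space T n"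
    and d: "\<And>n c. c \<in> chain_space S (Suc n) \<Longrightarrow>
               boundary e (Suc n) (F (Suc n) c) = F n (boundary d (Suc n) c)"
    and acyclic: "acyclic_complex (cone_boundary e d F) (mapping_cone T S)"
  shows "bij_betw (homology_map e T n (F n)) (carrier (homology d S n)) (carrier (homology e T n))"
proof -
  note sub = chain_map_cycles_boundaries[of F S T e d n, OF F C d]
  have map: "homology_map e T n (F n) ((+) z ` boundaries d S n) = (+) (F n z) ` boundaries e T n" for z
    by (rule homology_map_coset[OF F sub(2)])
  have car: "carrier (homology d S n) = (\<lambda>z. (+) z ` boundaries d S n) ` (cycles d S n :: ('u \<Rightarrow>\<^sub>0 'k) set)"
    for d :: "nat \<Rightarrow> nat \<Rightarrow> 'u \<Rightarrow> 'u" and S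
    by (simp add: homology_def)
  have inj: "z - w \<in> boundaries d S n"
    if z: "z \<in> cycles d S n" "w \<in> cycles d S n" and eq: "F n z - F n w \<in> boundaries e T n" for z w :: "'s \<Rightarrow>\<^sub>0 'k"
  proof -
    \<comment> \<open>The sign of \<open>w - z\<close> makes \<open>(t, w - z)\<close> a cycle of the mapping cone.\<close>
    let ?c = "w - z"
    have c: "?c \<in> cycles d S n" using z by (intro chain.subspace_diff subspace_cycles)
    obtain t where t: "t \<in> chain_space T (Suc n)" "F n z - F n w = boundary e (Suc n) t"
      using eq by (auto simp: boundaries_def)
    have "(t, ?c) \<in> mapping_cone T S (Suc n)" "cone_boundary e d F (Suc n) (t, ?c) = 0"
      using t(1) c by (simp_all add: mapping_cone_def cone_boundary_def cycles_def
          chain_linear_diff[OF F] zero_prod_def t(2)[symmetric])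
    then obtain x where "x \<in> mapping_cone T S (Suc (Suc n))"
      "cone_boundary e d F (Suc (Suc n)) x = (t, ?c)"
      using acyclic unfolding acyclic_complex_def by metis
    then obtain c' where "c' \<in> chain_space S (Suc n)" "- boundary d (Suc n) c' = ?c"
      by (cases x) (auto simp: mapping_cone_def cone_boundary_def)
    moreover from this(2) have "z - w = boundary d (Suc n) c'"
      by (metis minus_diff_eq minus_minus)
    ultimately show ?thesis by (simp add: boundaries_def)
  qed
  have surj: "\<exists>z\<in>cycles d S n. t - F n z \<in> boundaries e T n" if t: "t \<in> cycles e T n" for t :: "'t \<Rightarrow>\<^sub>0 'k"
  proof -
    have "(t, 0) \<in> mapping_cone T S n" "cone_boundary e d F n (t, 0) = 0"
      using t by (auto simp: mapping_cone_def cone_boundary_def cycles_def chain_space_zero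
          chain_linear_zero[OF F] boundary_linear_simps zero_prod_def split: nat.split)
    then obtain x where "x \<in> mapping_cone T S (Suc n)" "cone_boundary e d F (Suc n) x = (t, 0)"
      using acyclic unfolding acyclic_complex_def by metis
    then obtain t' z where "t' \<in> chain_space T (Suc n)" "z \<in> chain_space S n"
      "boundary e (Suc n) t' + F n z = t" "boundary d n z = 0"
      by (cases x) (auto simp: mapping_cone_def cone_boundary_def)
    then show ?thesis
      by (intro bexI[of _ z]) (auto simp: cycles_def boundaries_def)
  qed
  show ?thesis
    unfolding bij_betw_def
  proof
    show "inj_on (homology_map e T n (F n)) (carrier (homology d S n))"
    proof (rule inj_onI)
      fix x y :: "('s \<Rightarrow>\<^sub>0 'k) set"
      assume "x \<in> carrier (homology d S n)" "y \<in> carrier (homology d S n)"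
        and eq: "homology_map e T n (F n) x = homology_map e T n (F n) y"
      then obtain z w where z: "z \<in> cycles d S n" "x = (+) z ` boundaries d S n"
        and w: "w \<in> cycles d S n" "y = (+) w ` boundaries d S n"
        unfolding car by blast
      have "F n z - F n w \<in> boundaries e T n"
        using eq unfolding z(2) w(2) map coset_eq_iff .
      then show "x = y" unfolding z(2) w(2) coset_eq_iff by (rule inj[OF z(1) w(1)])
    qed
    show "homology_map e T n (F n) ` carrier (homology d S n) = carrier (homology e T n)"
    proof
      show "homology_map e T n (F n) ` carrier (homology d S n) \<subseteq> carrier (homology e T n)"
        using sub(1) by (auto simp: car map)
      show "carrier (homology e T n) \<subseteq> homology_map e T n (F n) ` carrier (homology d S n)"
      proof
        fix y assume "y \<in> carrier (homology e T n :: ('k, ('t \<Rightarrow>\<^sub>0 'k) set) module)"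
        then obtain t where t: "t \<in> cycles e T n" "y = (+) t ` boundaries e T n" by (auto simp: car)
        then obtain z where z: "z \<in> cycles d S n" "t - F n z \<in> boundaries e T n" using surj by blast
        then have "y = homology_map e T n (F n) ((+) z ` boundaries d S n)"
          by (simp only: t(2) map coset_eq_iff)
        then show "y \<in> homology_map e T n (F n) ` carrier (homology d S n)"
          using z(1) by (auto simp: car)
      qed
    qed
  qed
qed

section \<open>Small singular chains with field coefficients\<close>

text \<open>
  Barycentric subdivision is defined for integral singular chains. Changing coefficients along the map
  from the integers to the field carries its properties over to chains over the field.
\<close>
definition of_int_chain :: "('s \<Rightarrow>\<^sub>0 int) \<Rightarrow> ('s \<Rightarrow>\<^sub>0 'k::field)" where
  "of_int_chain = Poly_Mapping.map of_int"

lemma lookup_of_int_chain [simp]: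
  "Poly_Mapping.lookup (of_int_chain z) s = of_int (Poly_Mapping.lookup z s)"
  by (simp add: of_int_chain_def Poly_Mapping.map.rep_eq "when_def")

lemma keys_of_int_chain: "Poly_Mapping.keys (of_int_chain z) \<subseteq> Poly_Mapping.keys z"
  by (auto simp: in_keys_iff)

lemma of_int_chain_zero: "of_int_chain 0 = 0"
  and of_int_chain_add: "of_int_chain (z + w) = of_int_chain z + of_int_chain w"
  and of_int_chain_diff: "of_int_chain (z - w) = of_int_chain z - of_int_chain w"
  and of_int_chain_frag_of: "of_int_chain (frag_of s) = Poly_Mapping.single s 1"
  and of_int_chain_cmul: "of_int_chain (frag_cmul a z) = chain_smult (of_int a) (of_int_chain z)"
  by (rule poly_mapping_eqI; simp add: lookup_add lookup_minus lookup_single "when_def")+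

lemma of_int_chain_sum: "of_int_chain (sum f A) = (\<Sum>a\<in>A. of_int_chain (f a))"
  by (induction A rule: infinite_finite_induct) (simp_all add: of_int_chain_zero of_int_chain_add)

lemma boundary_of_int_chain:
  "boundary singular_face p (of_int_chain z) =
     (of_int_chain (chain_boundary p z) :: (_ \<Rightarrow>\<^sub>0 'k::field))"
proof -
  have "Poly_Mapping.keys z \<subseteq> UNIV" by simp
  then show ?thesis
  proof (induction z rule: frag_induction)
    case zero
    then show ?case by (simp add: of_int_chain_zero boundary_linear_simps)
  next
    case (one s)
    then show ?case
      by (simp add: boundary_def chain_boundary_of chain_boundary_def of_int_chain_zero
          of_int_chain_frag_of of_int_chain_sum of_int_chain_cmul chain_smult_single)
  next
    case (diff a b)
    then show ?case by (simp add: of_int_chain_diff boundary_linear_simps chain_boundary_diff)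
  qed
qed

lemma linear_extend_of_int_chain:
  fixes h :: "('s \<Rightarrow>\<^sub>0 int) \<Rightarrow> ('t \<Rightarrow>\<^sub>0 int)"
  assumes "h 0 = 0" "\<And>z w. h (z - w) = h z - h w"
  shows "linear_extend (\<lambda>s. of_int_chain (h (frag_of s))) (of_int_chain z) =
           (of_int_chain (h z) :: ('t \<Rightarrow>\<^sub>0 'k::field))"
proof -
  have "Poly_Mapping.keys z \<subseteq> UNIV" by simp
  then show ?thesis
    by (induction z rule: frag_induction)
       (simp_all add: assms of_int_chain_zero of_int_chain_diff of_int_chain_frag_of
         chain_linear_zero[OF linear_linear_extend] chain_linear_diff[OF linear_linear_extend])
qed

definition small_simplices :: "'a topology \<Rightarrow> 'a set set \<Rightarrow> nat \<Rightarrow> ((nat \<Rightarrow> real) \<Rightarrow> 'a) set" where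
  "small_simplices X \<C> n = (\<Union>V\<in>\<C>. singular_simplex_set n (subtopology X V))"

text \<open>
  Small chains compute singular homology, relative to boundaries that are small already. The \<open>N\<close>-fold
  subdivision of \<open>c\<close> is small for large \<open>N\<close>, and the chain homotopy \<open>H\<close> from the identity to it maps
  small chains to small chains, because it is natural in the space. So \<open>c + \<partial> H c\<close>, which is the
  subdivision of \<open>c\<close> minus \<open>H (\<partial> c)\<close>, is small if \<open>\<partial> c\<close> is. At \<open>n = 0\<close> the boundary is \<open>0\<close>, so the
  index \<open>n - 1\<close> is harmless.
\<close>
lemma chain_homologous_to_small_chain:
  fixes c :: "((nat \<Rightarrow> real) \<Rightarrow> 'a) \<Rightarrow>\<^sub>0 'k::field"
  assumes \<C>: "\<And>V. V \<in> \<C> \<Longrightarrow> openin X V" "topspace X \<subseteq> \<Union>\<C>"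
    and c: "c \<in> chain_space (\<lambda>n. singular_simplex_set n X) n"
    and bd: "boundary singular_face n c \<in> chain_space (small_simplices X \<C>) (n - 1)"
  obtains e where "e \<in> chain_space (\<lambda>n. singular_simplex_set n X) (Suc n)"
    "c - boundary singular_face (Suc n) e \<in> chain_space (small_simplices X \<C>) n"
proof -
  have "\<exists>N. \<forall>m f. N \<le> m \<longrightarrow> f \<in> Poly_Mapping.keys ((singular_subdivision n ^^ m) (frag_of s)) \<longrightarrow>
          (\<exists>V \<in> \<C>. f \<in> standard_simplex n \<rightarrow> V)" if "s \<in> Poly_Mapping.keys c" for s
  proof -
    have "singular_chain n X (frag_of s)"
      using that c by (auto simp: singular_chain_of chain_space_def)
    from sufficient_iterated_singular_subdivision_exists[OF \<C> this] show ?thesis by metis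
  qed
  then obtain N0 where N0: "\<And>s m f. s \<in> Poly_Mapping.keys c \<Longrightarrow> N0 s \<le> m \<Longrightarrow>
      f \<in> Poly_Mapping.keys ((singular_subdivision n ^^ m) (frag_of s)) \<Longrightarrow>
      \<exists>V \<in> \<C>. f \<in> standard_simplex n \<rightarrow> V"
    by metis
  \<comment> \<open>One \<open>N\<close> for all simplices of \<open>c\<close>; inserting \<open>0\<close> covers the chain \<open>c = 0\<close>.\<close>
  define N where "N = Max (insert 0 (N0 ` Poly_Mapping.keys c))"
  have N: "N0 s \<le> N" if "s \<in> Poly_Mapping.keys c" for s
    using that by (simp add: N_def)
  obtain h where h: "\<And>p. h p 0 = (0 :: 'a Simplices.chain)"
    "\<And>p c1 c2. h p (c1 - c2) = h p c1 - h p c2"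
    "\<And>p X c. singular_chain p X c \<Longrightarrow> singular_chain (Suc p) X (h p c)"
    "\<And>p X c. singular_chain p X c
        \<Longrightarrow> chain_boundary (Suc p) (h p c) + h (p - Suc 0) (chain_boundary p c)
          = (singular_subdivision p ^^ N) c - c"
    using chain_homotopic_iterated_singular_subdivision[of N] by blast
  define H where "H p = linear_extend (\<lambda>s. of_int_chain (h p (frag_of s)) :: (((nat \<Rightarrow> real) \<Rightarrow> 'a) \<Rightarrow>\<^sub>0 'k))" for p
  define D where "D = linear_extend
      (\<lambda>s. of_int_chain ((singular_subdivision n ^^ N) (frag_of s)) :: (((nat \<Rightarrow> real) \<Rightarrow> 'a) \<Rightarrow>\<^sub>0 'k))"
  have linear: "chain_linear (H p)" "chain_linear D" for p
    by (simp_all add: H_def D_def linear_linear_extend)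
  note simps = chain_linear_add[OF linear(1)] chain_linear_add[OF linear(2)]
    chain_linear_scale[OF linear(1)] chain_linear_scale[OF linear(2)]
    chain_linear_scale[OF linear_boundary] boundary_linear_simps
  have H: "H p x \<in> chain_space (\<lambda>n. singular_simplex_set n Y) (Suc p)"
    if "x \<in> chain_space (\<lambda>n. singular_simplex_set n Y) p" for p Y x
    unfolding H_def
  proof (rule linear_extend_in_chain_space[OF that])
    fix s assume "s \<in> singular_simplex_set p Y"
    then have "singular_chain (Suc p) Y (h p (frag_of s))"
      by (intro h(3)) (simp add: singular_chain_of)
    then show "(of_int_chain (h p (frag_of s)) :: (_ \<Rightarrow>\<^sub>0 'k))
        \<in> chain_space (\<lambda>n. singular_simplex_set n Y) (Suc p)"
      by (simp add: chain_space_def singular_chain_def order_trans[OF keys_of_int_chain])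
  qed
  have Hsmall: "H p x \<in> chain_space (small_simplices X \<C>) (Suc p)"
    if "x \<in> chain_space (small_simplices X \<C>) p" for p x
    unfolding H_def
  proof (rule linear_extend_in_chain_space[OF that])
    fix s assume "s \<in> small_simplices X \<C> p"
    then obtain V where V: "V \<in> \<C>" "s \<in> singular_simplex_set p (subtopology X V)"
      by (auto simp: small_simplices_def)
    then have "Poly_Mapping.single s (1::'k) \<in> chain_space (\<lambda>n. singular_simplex_set n (subtopology X V)) p"
      by simp
    from H[OF this] have "Poly_Mapping.keys (of_int_chain (h p (frag_of s)) :: (_ \<Rightarrow>\<^sub>0 'k))
        \<subseteq> singular_simplex_set (Suc p) (subtopology X V)"
      by (simp add: chain_space_def H_def)
    then show "(of_int_chain (h p (frag_of s)) :: (_ \<Rightarrow>\<^sub>0 'k)) \<in> chain_space (small_simplices X \<C>) (Suc p)"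
      using V(1) by (auto simp: chain_space_def small_simplices_def)
  qed
  have "D c \<in> chain_space (small_simplices X \<C>) n"
    unfolding D_def
  proof (rule linear_extend_in_chain_space[where S = "\<lambda>_. Poly_Mapping.keys c"])
    fix s assume s: "s \<in> Poly_Mapping.keys c"
    have "singular_chain n X ((singular_subdivision n ^^ m) (frag_of s))" for m
    proof (induction m)
      case 0
      then show ?case using s c by (auto simp: singular_chain_of chain_space_def)
    qed (simp add: singular_chain_singular_subdivision)
    then have "f \<in> small_simplices X \<C> n"
      if "f \<in> Poly_Mapping.keys ((singular_subdivision n ^^ N) (frag_of s))" for f
      using N0[OF s N[OF s] that] that
      by (auto simp: small_simplices_def singular_simplex_subtopology singular_chain_def image_subset_iff)
    then show "(of_int_chain ((singular_subdivision n ^^ N) (frag_of s)) :: (_ \<Rightarrow>\<^sub>0 'k))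
        \<in> chain_space (small_simplices X \<C>) n"
      unfolding chain_space_def by (auto dest!: subsetD[OF keys_of_int_chain])
  qed (simp add: chain_space_def)
  moreover have "H (n - 1) (boundary singular_face n c) \<in> chain_space (small_simplices X \<C>) n"
  proof (cases n)
    case 0
    then show ?thesis by (simp add: boundary_def chain_linear_zero[OF linear(1)] chain_space_zero)
  next
    case (Suc m)
    then show ?thesis using Hsmall[OF bd] by simp
  qed
  moreover have "c - boundary singular_face (Suc n) (- H n c) = D c - H (n - 1) (boundary singular_face n c)"
  proof -
    have "boundary singular_face (Suc n) (H n c) + H (n - 1) (boundary singular_face n c) + c = D c"
    proof (rule chain_linear_eq[where G = D])
      show "chain_linear (\<lambda>c. boundary singular_face (Suc n) (H n c) + H (n - 1) (boundary singular_face n c) + c)"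
        by (rule chain_linearI) (simp_all add: simps chain.scale_right_distrib add_ac)
      fix s assume "s \<in> Poly_Mapping.keys c"
      then have s: "singular_chain n X (frag_of s)" using c by (auto simp: singular_chain_of chain_space_def)
      have single: "H n (Poly_Mapping.single s 1) = of_int_chain (h n (frag_of s))"
        "D (Poly_Mapping.single s 1) = of_int_chain ((singular_subdivision n ^^ N) (frag_of s))"
        by (simp_all add: H_def D_def)
      have "H (n - 1) (boundary singular_face n (Poly_Mapping.single s 1)) =
          of_int_chain (h (n - 1) (chain_boundary n (frag_of s)))"
        unfolding of_int_chain_frag_of[symmetric] boundary_of_int_chain H_def
        by (rule linear_extend_of_int_chain) (rule h)+
      then show "boundary singular_face (Suc n) (H n (Poly_Mapping.single s 1)) +
          H (n - 1) (boundary singular_face n (Poly_Mapping.single s 1)) + Poly_Mapping.single s 1 =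
          D (Poly_Mapping.single s 1)"
        using arg_cong[OF h(4)[OF s], of "of_int_chain :: _ \<Rightarrow> (((nat \<Rightarrow> real) \<Rightarrow> 'a) \<Rightarrow>\<^sub>0 'k)"]
        by (simp add: single boundary_of_int_chain of_int_chain_add of_int_chain_diff
            of_int_chain_frag_of eq_diff_eq)
    qed (rule linear(2))
    then show ?thesis by (simp add: boundary_linear_simps algebra_simps)
  qed
  moreover have "- H n c \<in> chain_space (\<lambda>n. singular_simplex_set n X) (Suc n)"
    using H[OF c] by (rule chain_space_minus)
  ultimately show ?thesis
    using that by (metis chain_space_diff)
qed

section \<open>Cones over singular simplices\<close>

text \<open>
  Values are chains on a one-element set, rather than scalars, so that the augmentation is itself a
  linear extension.
\<close>
definition augmentation :: "('s \<Rightarrow>\<^sub>0 'k::field) \<Rightarrow> (unit \<Rightarrow>\<^sub>0 'k)" where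
  "augmentation = linear_extend (\<lambda>_. Poly_Mapping.single () 1)"

lemma linear_augmentation: "chain_linear augmentation"
  unfolding augmentation_def by (rule linear_linear_extend)

lemma augmentation_single [simp]: "augmentation (Poly_Mapping.single s a) = Poly_Mapping.single () a"
  unfolding augmentation_def linear_extend_single
  by (rule poly_mapping_eqI) (simp add: lookup_single "when_def")

lemma augmentation_boundary: "augmentation (boundary d (Suc 0) c) = 0"
proof -
  have "chain_linear (\<lambda>c. augmentation (boundary d (Suc 0) c))"
    using Vector_Spaces.linear_compose[OF linear_boundary linear_augmentation] by (simp add: o_def)
  then show ?thesis
    using chain_linear_eq[OF _ chain_pair.linear_zero, of "\<lambda>c. augmentation (boundary d (Suc 0) c)" c]
    by (simp add: boundary_single chain_linear_add[OF linear_augmentation] flip: single_add)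
qed

text \<open>
  A space with a focal point is contractible to it: the homotopy that stays put until time \<open>1\<close> and then
  jumps to \<open>m\<close> is continuous.
\<close>
definition focal_point :: "'a topology \<Rightarrow> 'a \<Rightarrow> bool" where
  "focal_point Y m \<longleftrightarrow> m \<in> topspace Y \<and> (\<forall>W. openin Y W \<longrightarrow> m \<in> W \<longrightarrow> W = topspace Y)"

text \<open>
  The join of the vertex \<open>m\<close> and the simplex \<open>s\<close>, except that nothing moves towards \<open>m\<close>: the map is
  constant on each segment from the opposite face to the first vertex, excluding that vertex, and only that vertex is sent to \<open>m\<close>.
\<close>
definition singular_cone :: "'a \<Rightarrow> nat \<Rightarrow> ((nat \<Rightarrow> real) \<Rightarrow> 'a) \<Rightarrow> ((nat \<Rightarrow> real) \<Rightarrow> 'a)" where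
  "singular_cone m n s = restrict
     (\<lambda>t. if t 0 = 1 then m else s (\<lambda>i. t (Suc i) / (1 - t 0))) (standard_simplex (Suc n))"

definition singular_point :: "'a \<Rightarrow> (nat \<Rightarrow> real) \<Rightarrow> 'a" where
  "singular_point m = restrict (\<lambda>_. m) (standard_simplex 0)"

lemma cone_projection_in_standard_simplex:
  assumes t: "t \<in> standard_simplex (Suc n)" "t 0 \<noteq> 1"
  shows "(\<lambda>i. t (Suc i) / (1 - t 0)) \<in> standard_simplex n"
proof -
  have t': "\<And>i. 0 \<le> t i" "\<And>i. t i \<le> 1" "\<And>i. i > Suc n \<Longrightarrow> t i = 0" "(\<Sum>i\<le>Suc n. t i) = 1"
    using t by (auto simp: standard_simplex_def)
  have pos: "1 - t 0 > 0" using t'(2)[of 0] t(2) by simp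
  have sum: "(\<Sum>i\<le>n. t (Suc i)) = 1 - t 0"
    using t'(4) by (simp add: sum.atMost_Suc_shift del: sum.atMost_Suc)
  have le: "t (Suc i) \<le> 1 - t 0" for i
  proof (cases "i \<le> n")
    case True
    then show ?thesis using member_le_sum[of i "{..n}" "\<lambda>i. t (Suc i)"] t'(1) sum by simp
  next
    case False
    then show ?thesis using t'(3)[of "Suc i"] pos by simp
  qed
  show ?thesis
    using t' pos le sum by (simp add: standard_simplex_def divide_le_eq flip: sum_divide_distrib)
qed

text \<open>
  Away from the first vertex of the simplex the cone is \<open>s\<close> composed with a projection. The first
  vertex does not affect continuity, as an open set that contains its image \<open>m\<close> is the whole space.
\<close>
lemma singular_simplex_singular_cone:
  assumes m: "focal_point Y m" and s: "singular_simplex n Y s"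
  shows "singular_simplex (Suc n) Y (singular_cone m n s)"
proof -
  let ?D = "\<lambda>n. subtopology (powertop_real UNIV) (standard_simplex n)"
  let ?f = "\<lambda>t::nat \<Rightarrow> real. if t 0 = 1 then m else s (\<lambda>i. t (Suc i) / (1 - t 0))"
  let ?\<rho> = "\<lambda>t::nat \<Rightarrow> real. (\<lambda>i. t (Suc i) / (1 - t 0))"
  let ?O = "{t \<in> topspace (?D (Suc n)). t 0 \<in> - {1}}"
  have coord: "continuous_map (powertop_real UNIV) euclideanreal (\<lambda>t. t i)" for i :: nat
    by (rule continuous_map_product_projection) simp
  have O: "openin (?D (Suc n)) ?O"
    by (rule openin_continuous_map_preimage[OF continuous_map_from_subtopology[OF coord]]) auto
  have s': "continuous_map (?D n) Y s" using s by (simp add: singular_simplex_def)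
  have "continuous_map (subtopology (?D (Suc n)) ?O) (?D n) ?\<rho>"
    unfolding continuous_map_in_subtopology
  proof
    show "continuous_map (subtopology (?D (Suc n)) ?O) (powertop_real UNIV) ?\<rho>"
      unfolding continuous_map_componentwise_UNIV
      by (intro allI continuous_map_real_divide continuous_map_diff continuous_map_from_subtopology coord) auto
    show "?\<rho> \<in> topspace (subtopology (?D (Suc n)) ?O) \<rightarrow> standard_simplex n"
      by (auto simp: cone_projection_in_standard_simplex)
  qed
  then have "continuous_map (subtopology (?D (Suc n)) ?O) Y (s \<circ> ?\<rho>)"
    by (rule continuous_map_compose[OF _ s'])
  then have f: "continuous_map (subtopology (?D (Suc n)) ?O) Y ?f"
    by (rule continuous_map_eq) auto
  have "continuous_map (?D (Suc n)) Y ?f"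
    unfolding continuous_map_def
  proof (intro conjI allI impI)
    show *: "?f \<in> topspace (?D (Suc n)) \<rightarrow> topspace Y"
      using m continuous_map_funspace[OF f] by (auto simp: focal_point_def Pi_iff)
    fix W assume W: "openin Y W"
    show "openin (?D (Suc n)) {t \<in> topspace (?D (Suc n)). ?f t \<in> W}"
    proof (cases "m \<in> W")
      case True
      then have "W = topspace Y" using m W by (simp add: focal_point_def)
      then have "{t \<in> topspace (?D (Suc n)). ?f t \<in> W} = topspace (?D (Suc n))" using * by blast
      then show ?thesis by (simp only: openin_topspace)
    next
      case False
      have "openin (subtopology (?D (Suc n)) ?O) {t \<in> topspace (subtopology (?D (Suc n)) ?O). ?f t \<in> W}"
        using f W by (rule openin_continuous_map_preimage)
      moreover have "{t \<in> topspace (subtopology (?D (Suc n)) ?O). ?f t \<in> W} =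
          {t \<in> topspace (?D (Suc n)). ?f t \<in> W}"
        using False by auto
      ultimately show ?thesis using openin_trans_full[OF _ O] by simp
    qed
  qed
  then have "continuous_map (?D (Suc n)) Y (singular_cone m n s)"
    by (rule continuous_map_eq) (simp add: singular_cone_def)
  then show ?thesis by (simp add: singular_simplex_def singular_cone_def)
qed

lemma singular_simplex_singular_point:
  assumes "m \<in> topspace Y"
  shows "singular_simplex 0 Y (singular_point m)"
proof -
  have "continuous_map (subtopology (powertop_real UNIV) (standard_simplex 0)) Y (singular_point m)"
    by (rule continuous_map_eq[of _ _ "\<lambda>_. m"]) (use assms in \<open>auto simp: singular_point_def\<close>)
  then show ?thesis by (simp add: singular_simplex_def singular_point_def)
qed

lemma singular_face_singular_cone_0:
  assumes "s \<in> extensional (standard_simplex n)"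
  shows "singular_face (Suc n) 0 (singular_cone m n s) = s"
proof
  fix t
  show "singular_face (Suc n) 0 (singular_cone m n s) t = s t"
  proof (cases "t \<in> standard_simplex n")
    case True
    then have "simplical_face 0 t \<in> standard_simplex (Suc n)"
      using simplical_face_in_standard_simplex[of "Suc n" 0 t] by simp
    with True show ?thesis by (simp add: singular_face_def singular_cone_def simplical_face_def)
  qed (use assms in \<open>simp add: singular_face_def extensional_def\<close>)
qed

lemma singular_face_singular_cone_Suc:
  assumes "j \<le> Suc n"
  shows "singular_face (Suc (Suc n)) (Suc j) (singular_cone m (Suc n) s) =
         singular_cone m n (singular_face (Suc n) j s)"
proof
  fix t
  show "singular_face (Suc (Suc n)) (Suc j) (singular_cone m (Suc n) s) t =
      singular_cone m n (singular_face (Suc n) j s) t"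
  proof (cases "t \<in> standard_simplex (Suc n)")
    case True
    then have "simplical_face (Suc j) t \<in> standard_simplex (Suc (Suc n))"
      using simplical_face_in_standard_simplex[of "Suc (Suc n)" "Suc j" t] assms by simp
    moreover have "(\<lambda>i. simplical_face (Suc j) t (Suc i) / (1 - t 0)) =
        simplical_face j (\<lambda>i. t (Suc i) / (1 - t 0))"
      by (auto simp: simplical_face_def fun_eq_iff)
    moreover have "simplical_face (Suc j) t 0 = t 0" by (simp add: simplical_face_def)
    ultimately show ?thesis
      using True cone_projection_in_standard_simplex[OF True]
      by (simp add: singular_face_def singular_cone_def)
  qed (simp add: singular_face_def singular_cone_def)
qed

lemma singular_face_1_singular_cone:
  "singular_face (Suc 0) (Suc 0) (singular_cone m 0 s) = singular_point m"
proof
  fix t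
  show "singular_face (Suc 0) (Suc 0) (singular_cone m 0 s) t = singular_point m t"
  proof (cases "t \<in> standard_simplex 0")
    case True
    then have "simplical_face (Suc 0) t \<in> standard_simplex (Suc 0)"
      using simplical_face_in_standard_simplex[of "Suc 0" "Suc 0" t] by simp
    then show ?thesis
      using True by (simp add: singular_face_def singular_cone_def singular_point_def
          simplical_face_def standard_simplex_def)
  qed (simp add: singular_face_def singular_point_def)
qed

lemma simplex_map_singular_cone:
  "simplex_map (Suc n) f (singular_cone m n s) = singular_cone (f m) n (simplex_map n f s)"
  using cone_projection_in_standard_simplex[of _ n]
  by (auto simp: simplex_map_def singular_cone_def fun_eq_iff)

lemma simplex_map_singular_point:
  "simplex_map 0 f (singular_point m) = singular_point (f m)"
  by (auto simp: simplex_map_def singular_point_def fun_eq_iff)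

definition cone_chain :: "'a \<Rightarrow> nat \<Rightarrow> (((nat \<Rightarrow> real) \<Rightarrow> 'a) \<Rightarrow>\<^sub>0 'k::field) \<Rightarrow>
    (((nat \<Rightarrow> real) \<Rightarrow> 'a) \<Rightarrow>\<^sub>0 'k)" where
  "cone_chain m n = linear_extend (\<lambda>s. Poly_Mapping.single (singular_cone m n s) 1)"

lemma linear_cone_chain: "chain_linear (cone_chain m n)"
  unfolding cone_chain_def by (rule linear_linear_extend)

lemma cone_chain_single [simp]:
  "cone_chain m n (Poly_Mapping.single s a) = Poly_Mapping.single (singular_cone m n s) a"
  unfolding cone_chain_def linear_extend_single
  by (rule poly_mapping_eqI) (simp add: lookup_single "when_def")

abbreviation singular_chains :: "'a topology \<Rightarrow> nat \<Rightarrow> (((nat \<Rightarrow> real) \<Rightarrow> 'a) \<Rightarrow>\<^sub>0 'k::field) set" where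
  "singular_chains X \<equiv> chain_space (\<lambda>n. singular_simplex_set n X)"

lemma cone_chain_in_singular_chains:
  assumes "focal_point Y m" "c \<in> singular_chains Y n"
  shows "cone_chain m n c \<in> singular_chains Y (Suc n)"
  unfolding cone_chain_def using assms(2)
  by (rule linear_extend_in_chain_space) (simp add: singular_simplex_singular_cone[OF assms(1)])

lemma boundary_cone_chain_0:
  assumes "c \<in> singular_chains Y 0"
  shows "boundary singular_face (Suc 0) (cone_chain m 0 c) =
           c - linear_extend (\<lambda>_. Poly_Mapping.single (singular_point m) 1) (augmentation c)"
proof (rule chain_linear_eq[where F = "\<lambda>c. boundary singular_face (Suc 0) (cone_chain m 0 c)"
      and G = "\<lambda>c. c - linear_extend (\<lambda>_. Poly_Mapping.single (singular_point m) 1) (augmentation c)"])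
  show "chain_linear (\<lambda>c. boundary singular_face (Suc 0) (cone_chain m 0 c))"
    using Vector_Spaces.linear_compose[OF linear_cone_chain linear_boundary] by (simp add: o_def)
  show "chain_linear (\<lambda>c. c - linear_extend (\<lambda>_. Poly_Mapping.single (singular_point m) 1) (augmentation c))"
    by (rule chain_linearI)
       (simp_all add: chain_linear_add[OF linear_augmentation] chain_linear_scale[OF linear_augmentation]
         chain_linear_add[OF linear_linear_extend] chain_linear_scale[OF linear_linear_extend]
         chain.scale_right_diff_distrib)
  fix s assume "s \<in> Poly_Mapping.keys c"
  then have "s \<in> extensional (standard_simplex 0)"
    using assms by (auto simp: chain_space_def singular_simplex_def)
  then show "boundary singular_face (Suc 0) (cone_chain m 0 (Poly_Mapping.single s 1)) =
      Poly_Mapping.single s 1 -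
      linear_extend (\<lambda>_. Poly_Mapping.single (singular_point m) 1) (augmentation (Poly_Mapping.single s 1))"
    by (simp add: boundary_single singular_face_singular_cone_0 singular_face_1_singular_cone
        single_uminus)
qed

lemma boundary_cone_chain_Suc:
  fixes c :: "((nat \<Rightarrow> real) \<Rightarrow> 'a) \<Rightarrow>\<^sub>0 'k::field"
  assumes "c \<in> singular_chains Y (Suc n)"
  shows "boundary singular_face (Suc (Suc n)) (cone_chain m (Suc n) c) =
           c - cone_chain m n (boundary singular_face (Suc n) c)"
proof (rule chain_linear_eq[where F = "\<lambda>c. boundary singular_face (Suc (Suc n)) (cone_chain m (Suc n) c)"
      and G = "\<lambda>c. c - cone_chain m n (boundary singular_face (Suc n) c)"])
  show "chain_linear (\<lambda>c. boundary singular_face (Suc (Suc n)) (cone_chain m (Suc n) c))"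
    using Vector_Spaces.linear_compose[OF linear_cone_chain linear_boundary] by (simp add: o_def)
  show "chain_linear (\<lambda>c. c - cone_chain m n (boundary singular_face (Suc n) c))"
    by (rule chain_linearI)
       (simp_all add: chain_linear_add[OF linear_cone_chain] chain_linear_scale[OF linear_cone_chain]
         boundary_linear_simps chain_linear_scale[OF linear_boundary] chain.scale_right_diff_distrib)
  fix s assume "s \<in> Poly_Mapping.keys c"
  then have s: "s \<in> extensional (standard_simplex (Suc n))"
    using assms by (auto simp: chain_space_def singular_simplex_def)
  have "(\<Sum>j\<le>Suc (Suc n). Poly_Mapping.single (singular_face (Suc (Suc n)) j (singular_cone m (Suc n) s)) ((- 1 :: 'k) ^ j)) =
      Poly_Mapping.single s 1 -
      (\<Sum>j\<le>Suc n. Poly_Mapping.single (singular_cone m n (singular_face (Suc n) j s)) ((- 1) ^ j))"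
    by (subst sum.atMost_Suc_shift)
       (simp add: singular_face_singular_cone_0[OF s] singular_face_singular_cone_Suc single_uminus
         sum_negf del: sum.atMost_Suc)
  moreover have "boundary singular_face (Suc (Suc n)) (cone_chain m (Suc n) (Poly_Mapping.single s (1::'k))) =
      (\<Sum>j\<le>Suc (Suc n). Poly_Mapping.single (singular_face (Suc (Suc n)) j (singular_cone m (Suc n) s)) ((- 1) ^ j))"
    by (simp add: boundary_single del: sum.atMost_Suc)
  moreover have "cone_chain m n (boundary singular_face (Suc n) (Poly_Mapping.single s (1::'k))) =
      (\<Sum>j\<le>Suc n. Poly_Mapping.single (singular_cone m n (singular_face (Suc n) j s)) ((- 1) ^ j))"
    by (simp add: boundary_single chain_linear_sum[OF linear_cone_chain] del: sum.atMost_Suc)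
  ultimately show "boundary singular_face (Suc (Suc n)) (cone_chain m (Suc n) (Poly_Mapping.single s (1::'k))) =
      Poly_Mapping.single s 1 - cone_chain m n (boundary singular_face (Suc n) (Poly_Mapping.single s 1))"
    by (simp only:)
qed

text \<open>
  Coning contracts the augmented singular complex of a space onto a point; in degree \<open>0\<close> the cycles of
  the augmented complex are the chains of augmentation \<open>0\<close>.
\<close>
lemma boundary_cone_chain_cycle:
  assumes c: "c \<in> singular_chains Y n"
    and cycle: "if n = 0 then augmentation c = 0 else boundary singular_face n c = 0"
  shows "boundary singular_face (Suc n) (cone_chain m n c) = c"
proof (cases n)
  case 0
  then show ?thesis
    using boundary_cone_chain_0[of c Y m] c cycle by (simp add: chain_linear_zero[OF linear_linear_extend])
next
  case (Suc k)
  then show ?thesis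
    using boundary_cone_chain_Suc[of c Y k m] c cycle by (simp add: chain_linear_zero[OF linear_cone_chain])
qed

section \<open>Cones in a simplicial complex\<close>

lemma card_less_nth_sorted_list_of_set:
  assumes "finite \<sigma>" "j < card \<sigma>"
  shows "card {u \<in> \<sigma>. u < sorted_list_of_set \<sigma> ! j} = j"
proof -
  let ?l = "sorted_list_of_set \<sigma>"
  have sorted: "i < k \<Longrightarrow> k < card \<sigma> \<Longrightarrow> ?l ! i < ?l ! k" for i k
    using strict_sorted_list_of_set[of \<sigma>] by (simp add: sorted_wrt_iff_nth_less)
  have iff: "?l ! i < ?l ! j \<longleftrightarrow> i < j" if "i < card \<sigma>" for i
    using sorted[of i j] sorted[of j i] that assms(2) by (metis less_asym less_irrefl linorder_neqE_nat)
  have \<sigma>: "\<sigma> = (!) ?l ` {..<card \<sigma>}"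
    using assms(1) set_sorted_list_of_set[of \<sigma>] by (auto simp: set_conv_nth simp del: set_sorted_list_of_set)
  have "{u \<in> \<sigma>. u < ?l ! j} = (!) ?l ` {..<j}"
    using iff assms(2) by (subst \<sigma>) auto
  moreover have "inj_on ((!) ?l) {..<j}"
    using assms by (intro inj_on_nth) auto
  ultimately show ?thesis by (simp add: card_image)
qed

text \<open>
  The position of \<open>w\<close> in the increasing enumeration of \<open>\<sigma>\<close> is the number of elements below it. In this
  form the signs can be compared between different simplices.
\<close>
lemma boundary_simplex:
  assumes \<sigma>: "finite \<sigma>" "card \<sigma> = Suc (Suc n)"
  shows "boundary simplex_face (Suc n) (Poly_Mapping.single \<sigma> (1::'k::field)) =
           (\<Sum>w\<in>\<sigma>. Poly_Mapping.single (\<sigma> - {w}) ((-1) ^ card {u \<in> \<sigma>. u < w}))"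
proof -
  let ?l = "sorted_list_of_set \<sigma>"
  have bij: "bij_betw ((!) ?l) {..Suc n} \<sigma>"
    using \<sigma> by (intro bij_betw_nth) (auto simp: lessThan_Suc_atMost)
  have "boundary simplex_face (Suc n) (Poly_Mapping.single \<sigma> (1::'k)) =
      (\<Sum>j\<le>Suc n. Poly_Mapping.single (\<sigma> - {?l ! j}) ((-1) ^ j))"
    by (simp add: boundary_single simplex_face_def del: sum.atMost_Suc)
  also have "\<dots> = (\<Sum>j\<le>Suc n. Poly_Mapping.single (\<sigma> - {?l ! j}) ((-1) ^ card {u \<in> \<sigma>. u < ?l ! j}))"
    using \<sigma> by (intro sum.cong) (auto simp: card_less_nth_sorted_list_of_set)
  also have "\<dots> = (\<Sum>w\<in>\<sigma>. Poly_Mapping.single (\<sigma> - {w}) ((-1) ^ card {u \<in> \<sigma>. u < w}))"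
    by (rule sum.reindex_bij_betw[OF bij])
  finally show ?thesis .
qed

text \<open>
  The sign moves \<open>v\<close> from the front of the simplex to its place in the order. The cone over a simplex
  that contains \<open>v\<close> would be degenerate.
\<close>
definition vertex_cone :: "'v::linorder \<Rightarrow> 'v set \<Rightarrow> ('v set \<Rightarrow>\<^sub>0 'k::field)" where
  "vertex_cone v \<sigma> =
     (if v \<in> \<sigma> then 0 else Poly_Mapping.single (insert v \<sigma>) ((-1) ^ card {u \<in> \<sigma>. u < v}))"

text \<open>
  For \<open>w \<in> \<sigma>\<close>, exactly one of \<open>v\<close> and \<open>w\<close> is below the other. So either inserting \<open>v\<close> shifts the
  position of \<open>w\<close>, or removing \<open>w\<close> shifts the position of \<open>v\<close>, but not both; this produces the minus
  sign.
\<close>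
lemma boundary_vertex_cone:
  assumes \<sigma>: "finite \<sigma>" "card \<sigma> = Suc n" and v: "v \<notin> \<sigma>"
  shows "boundary simplex_face (Suc n) (vertex_cone v \<sigma>) = Poly_Mapping.single \<sigma> (1::'k::field) -
    (\<Sum>w\<in>\<sigma>. Poly_Mapping.single (insert v (\<sigma> - {w}))
       ((-1) ^ (card {u \<in> \<sigma>. u < w} + card {u \<in> \<sigma> - {w}. u < v})))"
proof -
  let ?p = "card {u \<in> \<sigma>. u < v}"
  let ?q = "\<lambda>w. card {u \<in> \<sigma>. u < w} + card {u \<in> \<sigma> - {w}. u < v}"
  have cone: "vertex_cone v \<sigma> = chain_smult ((-1) ^ ?p) (Poly_Mapping.single (insert v \<sigma>) (1::'k))"
    using v by (simp add: vertex_cone_def chain_smult_single)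
  have sign: "?p + card {u \<in> insert v \<sigma>. u < w} = Suc (?q w)" if w: "w \<in> \<sigma>" for w
  proof (cases "w < v")
    case True
    then have "{u \<in> insert v \<sigma>. u < w} = {u \<in> \<sigma>. u < w}"
      "{u \<in> \<sigma>. u < v} = insert w {u \<in> \<sigma> - {w}. u < v}"
      using w by auto
    then show ?thesis using \<sigma>(1) by simp
  next
    case False
    then have "{u \<in> insert v \<sigma>. u < w} = insert v {u \<in> \<sigma>. u < w}" "{u \<in> \<sigma>. u < v} = {u \<in> \<sigma> - {w}. u < v}"
      using w v by (auto simp: not_less le_less)
    then show ?thesis using \<sigma>(1) v by simp
  qed
  have "boundary simplex_face (Suc n) (vertex_cone v \<sigma>) =
      (\<Sum>w\<in>insert v \<sigma>. Poly_Mapping.single (insert v \<sigma> - {w}) ((-1::'k) ^ (?p + card {u \<in> insert v \<sigma>. u < w})))"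
    using \<sigma> v unfolding cone
    by (simp only: chain_linear_scale[OF linear_boundary])
       (simp add: boundary_simplex chain.scale_sum_right chain_smult_single power_add
         del: sum.insert)
  also have "\<dots> = Poly_Mapping.single (insert v \<sigma> - {v}) ((-1::'k) ^ (?p + card {u \<in> insert v \<sigma>. u < v})) +
      (\<Sum>w\<in>\<sigma>. Poly_Mapping.single (insert v \<sigma> - {w}) ((-1) ^ (?p + card {u \<in> insert v \<sigma>. u < w})))"
    using \<sigma>(1) v by (rule sum.insert)
  also have "{u \<in> insert v \<sigma>. u < v} = {u \<in> \<sigma>. u < v}" by auto
  also have "Poly_Mapping.single (insert v \<sigma> - {v}) ((-1::'k) ^ (?p + ?p)) = Poly_Mapping.single \<sigma> 1"
    using v by (simp flip: mult_2)
  also have "(\<Sum>w\<in>\<sigma>. Poly_Mapping.single (insert v \<sigma> - {w}) ((-1::'k) ^ (?p + card {u \<in> insert v \<sigma>. u < w}))) =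
      - (\<Sum>w\<in>\<sigma>. Poly_Mapping.single (insert v (\<sigma> - {w})) ((-1) ^ ?q w))"
    unfolding sum_negf[symmetric]
  proof (rule sum.cong)
    fix w assume w: "w \<in> \<sigma>"
    then have "insert v \<sigma> - {w} = insert v (\<sigma> - {w})" using v by auto
    then show "Poly_Mapping.single (insert v \<sigma> - {w}) ((-1::'k) ^ (?p + card {u \<in> insert v \<sigma>. u < w})) =
        - Poly_Mapping.single (insert v (\<sigma> - {w})) ((-1) ^ ?q w)"
      by (simp only: sign[OF w] power_Suc mult_minus1 single_uminus)
  qed simp
  finally show ?thesis by (simp only: add_uminus_conv_diff)
qed

lemma vertex_cone_contraction:
  assumes \<sigma>: "finite \<sigma>" "card \<sigma> = Suc (Suc n)"
  shows "boundary simplex_face (Suc (Suc n)) (vertex_cone v \<sigma>) +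
      linear_extend (vertex_cone v) (boundary simplex_face (Suc n) (Poly_Mapping.single \<sigma> 1)) =
    Poly_Mapping.single \<sigma> (1::'k::field)"
proof -
  let ?s = "\<lambda>w. (-1::'k) ^ card {u \<in> \<sigma>. u < w}"
  have faces: "linear_extend (vertex_cone v) (boundary simplex_face (Suc n) (Poly_Mapping.single \<sigma> 1)) =
      (\<Sum>w\<in>\<sigma>. chain_smult (?s w) (vertex_cone v (\<sigma> - {w})))"
    using \<sigma> by (simp add: boundary_simplex chain_linear_sum[OF linear_linear_extend])
  show ?thesis
  proof (cases "v \<in> \<sigma>")
    case False
    have "(\<Sum>w\<in>\<sigma>. chain_smult (?s w) (vertex_cone v (\<sigma> - {w}))) =
        (\<Sum>w\<in>\<sigma>. Poly_Mapping.single (insert v (\<sigma> - {w}))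
           ((-1) ^ (card {u \<in> \<sigma>. u < w} + card {u \<in> \<sigma> - {w}. u < v})))"
      using False by (intro sum.cong) (auto simp: vertex_cone_def chain_smult_single power_add)
    then show ?thesis
      using boundary_vertex_cone[OF \<sigma> False, where 'k='k] by (simp add: faces)
  next
    case True
    have eq: "{u \<in> \<sigma>. u \<noteq> v \<and> u < v} = {u \<in> \<sigma>. u < v}" by auto
    have "(\<Sum>w\<in>\<sigma>. chain_smult (?s w) (vertex_cone v (\<sigma> - {w}))) =
        (\<Sum>w\<in>\<sigma>. if w = v then chain_smult (?s w) (vertex_cone v (\<sigma> - {w})) else 0)"
      using True by (intro sum.cong) (auto simp: vertex_cone_def)
    also have "\<dots> = chain_smult (?s v) (vertex_cone v (\<sigma> - {v}))"
      using True \<sigma>(1) by simp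
    also have "\<dots> = Poly_Mapping.single \<sigma> 1"
      using True by (simp add: vertex_cone_def chain_smult_single insert_absorb eq
          flip: power_add mult_2)
    finally show ?thesis
      using True by (simp add: faces vertex_cone_def boundary_linear_simps)
  qed
qed

lemma cone_complex_cycle_is_boundary:
  fixes c :: "'v::linorder set \<Rightarrow>\<^sub>0 'k::field"
  assumes L: "abstract_simplicial_complex L" "{v} \<in> L" "\<And>\<sigma>. \<sigma> \<in> L \<Longrightarrow> insert v \<sigma> \<in> L"
    and c: "c \<in> chain_space (n_simplices L) n"
    and cycle: "if n = 0 then augmentation c = 0 else boundary simplex_face n c = 0"
  obtains c' where "c' \<in> chain_space (n_simplices L) (Suc n)" "boundary simplex_face (Suc n) c' = c"
proof
  let ?C = "linear_extend (vertex_cone v)"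
  have simplex: "finite \<sigma>" "card \<sigma> = Suc n" if "\<sigma> \<in> Poly_Mapping.keys c" for \<sigma>
    using that c L(1) by (auto simp: chain_space_def n_simplices_def dest: abstract_simplicial_complexD)
  show "?C c \<in> chain_space (n_simplices L) (Suc n)"
    using c
  proof (rule linear_extend_in_chain_space)
    fix \<sigma> assume "\<sigma> \<in> n_simplices L n"
    then have "v \<notin> \<sigma> \<Longrightarrow> insert v \<sigma> \<in> n_simplices L (Suc n)"
      using abstract_simplicial_complexD(1)[OF L(1), of \<sigma>] by (auto simp: n_simplices_def L(3))
    then show "(vertex_cone v \<sigma> :: _ \<Rightarrow>\<^sub>0 'k) \<in> chain_space (n_simplices L) (Suc n)"
      by (auto simp: vertex_cone_def chain_space_def)
  qed
  have lin: "chain_linear (\<lambda>c::'v set \<Rightarrow>\<^sub>0 'k. boundary simplex_face (Suc n) (?C c))"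
    using Vector_Spaces.linear_compose[OF linear_linear_extend linear_boundary] by (simp add: o_def)
  show "boundary simplex_face (Suc n) (?C c) = c"
  proof (cases n)
    case 0
    let ?G = "\<lambda>c::'v set \<Rightarrow>\<^sub>0 'k. c - linear_extend (\<lambda>_. Poly_Mapping.single {v} 1) (augmentation c)"
    have "boundary simplex_face (Suc n) (?C c) = ?G c"
    proof (rule chain_linear_eq[where F = "\<lambda>c. boundary simplex_face (Suc n) (?C c)" and G = ?G])
      show "chain_linear ?G"
        by (rule chain_linearI)
           (simp_all add: chain_linear_add[OF linear_augmentation] chain_linear_scale[OF linear_augmentation]
             chain_linear_add[OF linear_linear_extend] chain_linear_scale[OF linear_linear_extend]
             chain.scale_right_diff_distrib)
      fix \<sigma> assume "\<sigma> \<in> Poly_Mapping.keys c"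
      then have \<sigma>: "finite \<sigma>" "card \<sigma> = Suc n" using simplex by auto
      then obtain w where w: "\<sigma> = {w}" using 0 by (auto simp: card_Suc_eq)
      show "boundary simplex_face (Suc n) (?C (Poly_Mapping.single \<sigma> 1)) = ?G (Poly_Mapping.single \<sigma> (1::'k))"
      proof (cases "w = v")
        case True
        then show ?thesis by (simp add: w vertex_cone_def boundary_linear_simps)
      next
        case False
        have "{u. u = w \<and> u < w} = {}" by auto
        then have no_less: "card {u. u = w \<and> u < w} = 0" by (simp only: card.empty)
        show ?thesis
          using False boundary_vertex_cone[OF \<sigma>, of v, where 'k='k] by (simp add: w no_less)
      qed
    qed (rule lin)
    then show ?thesis
      using cycle 0 by (simp add: chain_linear_zero[OF linear_linear_extend])
  next
    case (Suc m)
    have "boundary simplex_face (Suc n) (?C c) + ?C (boundary simplex_face n c) = c"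
    proof (rule chain_linear_eq[where F = "\<lambda>c. boundary simplex_face (Suc n) (?C c) + ?C (boundary simplex_face n c)"
          and G = "\<lambda>c. c"])
      show "chain_linear (\<lambda>c. boundary simplex_face (Suc n) (?C c) + ?C (boundary simplex_face n c))"
        by (rule chain_linearI)
           (simp_all add: chain_linear_add[OF linear_linear_extend] chain_linear_scale[OF linear_linear_extend]
             boundary_linear_simps chain_linear_scale[OF linear_boundary] chain.scale_right_distrib add_ac)
      show "chain_linear (\<lambda>c::'v set \<Rightarrow>\<^sub>0 'k. c)" by (rule chain_linearI) auto
      fix \<sigma> assume "\<sigma> \<in> Poly_Mapping.keys c"
      then show "boundary simplex_face (Suc n) (?C (Poly_Mapping.single \<sigma> 1)) +
          ?C (boundary simplex_face n (Poly_Mapping.single \<sigma> 1)) = Poly_Mapping.single \<sigma> (1::'k)"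
        using vertex_cone_contraction[of \<sigma> m v, where 'k='k] simplex[of \<sigma>] by (simp add: Suc)
    qed
    then show ?thesis
      using cycle Suc by (simp add: chain_linear_zero[OF linear_linear_extend])
  qed
qed

section \<open>Minimal open sets of a finite space\<close>

text \<open>
  The specialization preorder, directed such that the open sets are downward closed: \<open>x\<close> is below \<open>y\<close>
  when \<open>y\<close> lies in the closure of \<open>x\<close>.
\<close>
definition specializes :: "'a topology \<Rightarrow> 'a \<Rightarrow> 'a \<Rightarrow> bool" where
  "specializes X x y \<longleftrightarrow>
     x \<in> topspace X \<and> y \<in> topspace X \<and> (\<forall>W. openin X W \<longrightarrow> y \<in> W \<longrightarrow> x \<in> W)"

lemma specializes_refl: "x \<in> topspace X \<Longrightarrow> specializes X x x"
  by (simp add: specializes_def)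

lemma specializes_trans: "specializes X x y \<Longrightarrow> specializes X y z \<Longrightarrow> specializes X x z"
  by (auto simp: specializes_def)

lemma specializes_open: "specializes X x y \<Longrightarrow> openin X W \<Longrightarrow> y \<in> W \<Longrightarrow> x \<in> W"
  by (simp add: specializes_def)

lemma specializes_continuous_map:
  assumes f: "continuous_map X Y f" and xy: "specializes X x y"
  shows "specializes Y (f x) (f y)"
  unfolding specializes_def
proof (intro conjI allI impI)
  show "f x \<in> topspace Y" "f y \<in> topspace Y"
    using continuous_map_funspace[OF f] xy by (auto simp: specializes_def)
  fix W assume "openin Y W" "f y \<in> W"
  then have "openin X {z \<in> topspace X. f z \<in> W}" "y \<in> {z \<in> topspace X. f z \<in> W}"
    using f xy by (auto simp: openin_continuous_map_preimage specializes_def)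
  then show "f x \<in> W" using specializes_open[OF xy] by blast
qed

definition minimal_open :: "'a topology \<Rightarrow> 'a \<Rightarrow> 'a set" where
  "minimal_open X m = {x. specializes X x m}"

lemma minimal_open_subset_topspace: "minimal_open X m \<subseteq> topspace X"
  by (auto simp: minimal_open_def specializes_def)

lemma minimal_open_subset: "openin X W \<Longrightarrow> m \<in> W \<Longrightarrow> minimal_open X m \<subseteq> W"
  by (auto simp: minimal_open_def specializes_def)

lemma mem_minimal_open_self: "m \<in> topspace X \<Longrightarrow> m \<in> minimal_open X m"
  by (simp add: minimal_open_def specializes_refl)

lemma minimal_open_mono: "specializes X x y \<Longrightarrow> minimal_open X x \<subseteq> minimal_open X y"
  by (auto simp: minimal_open_def intro: specializes_trans)

text \<open>
  A finite space has only finitely many open sets, so the intersection of all neighbourhoods of a point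
  is open.
\<close>
lemma openin_minimal_open:
  assumes "finite (topspace X)" "m \<in> topspace X"
  shows "openin X (minimal_open X m)"
proof -
  have "minimal_open X m = \<Inter>{W. openin X W \<and> m \<in> W}"
    using assms(2) by (auto simp: minimal_open_def specializes_def)
  moreover have "finite {W. openin X W}"
    by (rule finite_subset[of _ "Pow (topspace X)"]) (use assms(1) openin_subset in auto)
  then have "finite {W. openin X W \<and> m \<in> W}"
    by (rule rev_finite_subset) auto
  then have "openin X (\<Inter>{W. openin X W \<and> m \<in> W})"
    using assms(2) by (intro openin_Inter) auto
  ultimately show ?thesis by simp
qed

lemma focal_point_minimal_open:
  assumes "m \<in> topspace X"
  shows "focal_point (subtopology X (minimal_open X m)) m"
  unfolding focal_point_def
proof (intro conjI allI impI)
  show "m \<in> topspace (subtopology X (minimal_open X m))"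
    using assms mem_minimal_open_self by auto
  fix W assume "openin (subtopology X (minimal_open X m)) W" "m \<in> W"
  then obtain T where "openin X T" "W = T \<inter> minimal_open X m" "m \<in> T"
    by (auto simp: openin_subtopology)
  then show "W = topspace (subtopology X (minimal_open X m))"
    using minimal_open_subset[of X T m] minimal_open_subset_topspace[of X m] by auto
qed

lemma singular_simplex_set_subtopology_mono:
  "U \<subseteq> W \<Longrightarrow> singular_simplex_set n (subtopology X U) \<subseteq> singular_simplex_set n (subtopology X W)"
  by (simp add: singular_simplex_subtopology Collect_mono order_trans[of _ U W])

lemma singular_chains_subtopology_mono:
  assumes "c \<in> singular_chains (subtopology X U) n" "U \<subseteq> W"
  shows "c \<in> singular_chains (subtopology X W) n"
  using assms(1) singular_simplex_set_subtopology_mono[OF assms(2), of n X] unfolding chain_space_def by blast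

section \<open>Simplicial chains realized as singular chains\<close>

lemma boundary_in_singular_chains:
  "s \<in> singular_chains Y (Suc n) \<Longrightarrow> boundary singular_face (Suc n) s \<in> singular_chains Y n"
  by (erule boundary_in_chain_space[rotated]) (simp add: singular_simplex_singular_face[of "Suc n", simplified])

lemma boundary_in_simplicial_chains:
  assumes "abstract_simplicial_complex K" "c \<in> chain_space (n_simplices K) (Suc n)"
  shows "boundary simplex_face (Suc n) c \<in> chain_space (n_simplices K) n"
  using assms(2) by (rule boundary_in_chain_space[rotated]) (rule simplex_face_in_n_simplices[OF assms(1)])

lemma boundary_boundary_singular:
  "s \<in> singular_chains Y (Suc n) \<Longrightarrow> boundary singular_face n (boundary singular_face (Suc n) s) = 0"
  by (erule boundary_boundary) (rule singular_face_face)

lemma boundary_boundary_simplicial: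
  fixes c :: "'v::linorder set \<Rightarrow>\<^sub>0 'k::field"
  assumes "abstract_simplicial_complex K" "c \<in> chain_space (n_simplices K) (Suc n)"
  shows "boundary simplex_face n (boundary simplex_face (Suc n) c) = 0"
  using assms(2)
proof (rule boundary_boundary)
  fix i j \<rho> assume \<rho>: "\<rho> \<in> n_simplices K (Suc n)" "i \<le> j" "j \<le> n" "n \<noteq> 0"
  then show "simplex_face n i (simplex_face (Suc n) (Suc j) \<rho>) =
      simplex_face n j (simplex_face (Suc n) i \<rho>)"
    using abstract_simplicial_complexD(1)[OF assms(1), of \<rho>]
    by (intro simplex_face_face) (auto simp: n_simplices_def)
qed

text \<open>
  The chain map that sends a simplex \<open>\<sigma>\<close> to a singular chain in the minimal open set of \<open>p \<sigma>\<close>, the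
  highest point of \<open>\<sigma>\<close>: the singular cone with apex \<open>p \<sigma>\<close> over the realization of the boundary of \<open>\<sigma>\<close>.
\<close>
primrec realize :: "('v::linorder set \<Rightarrow> 'a) \<Rightarrow> nat \<Rightarrow> 'v set \<Rightarrow> (((nat \<Rightarrow> real) \<Rightarrow> 'a) \<Rightarrow>\<^sub>0 'k::field)" where
  "realize p 0 \<sigma> = Poly_Mapping.single (singular_point (p \<sigma>)) 1"
| "realize p (Suc n) \<sigma> = cone_chain (p \<sigma>) n
     (linear_extend (realize p n) (boundary simplex_face (Suc n) (Poly_Mapping.single \<sigma> 1)))"

abbreviation realize_chain :: "('v::linorder set \<Rightarrow> 'a) \<Rightarrow> nat \<Rightarrow> ('v set \<Rightarrow>\<^sub>0 'k::field) \<Rightarrow>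
    (((nat \<Rightarrow> real) \<Rightarrow> 'a) \<Rightarrow>\<^sub>0 'k)" where
  "realize_chain p n \<equiv> linear_extend (realize p n)"

lemma augmentation_realize_chain_0:
  fixes c :: "'v::linorder set \<Rightarrow>\<^sub>0 'k::field"
  shows "augmentation (realize_chain p 0 c) = augmentation c"
proof (rule chain_linear_eq[where F = "\<lambda>c. augmentation (realize_chain p 0 c)"])
  show "chain_linear (\<lambda>c::'v set \<Rightarrow>\<^sub>0 'k. augmentation (realize_chain p 0 c))"
    using Vector_Spaces.linear_compose[OF linear_linear_extend linear_augmentation] by (simp add: o_def)
qed (simp_all add: linear_augmentation)

text \<open>
  Singular cones are natural, so the recursion for \<open>realize\<close> commutes with \<open>f\<close> on the nose.
\<close>
lemma realize_chain_natural:
  assumes K: "abstract_simplicial_complex K" and p: "\<And>\<sigma>. \<sigma> \<in> K \<Longrightarrow> q \<sigma> = f (p \<sigma>)"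
    and c: "c \<in> chain_space (n_simplices K) n"
  shows "linear_extend (\<lambda>s. Poly_Mapping.single (simplex_map n f s) 1) (realize_chain p n c) =
           (realize_chain q n c :: _ \<Rightarrow>\<^sub>0 'k::field)"
  using c
proof (induction n arbitrary: c)
  let ?f = "\<lambda>n. linear_extend (\<lambda>s. Poly_Mapping.single (simplex_map n f s) (1::'k))"
  have lin: "chain_linear (\<lambda>c. ?f n (realize_chain p n c))" for n
    using Vector_Spaces.linear_compose[OF linear_linear_extend linear_linear_extend] by (simp add: o_def)
  {
    case 0
    show ?case
      by (rule chain_linear_eq[where F = "\<lambda>c. ?f 0 (realize_chain p 0 c)"])
         (use lin 0 p in \<open>auto simp: linear_linear_extend simplex_map_singular_point chain_space_def n_simplices_def\<close>)
  next
    case (Suc n)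
    show ?case
    proof (rule chain_linear_eq[where F = "\<lambda>c. ?f (Suc n) (realize_chain p (Suc n) c)"])
      fix \<sigma> assume "\<sigma> \<in> Poly_Mapping.keys c"
      then have \<sigma>: "\<sigma> \<in> n_simplices K (Suc n)" using Suc.prems by (auto simp: chain_space_def)
      let ?b = "boundary simplex_face (Suc n) (Poly_Mapping.single \<sigma> (1::'k))"
      have "Poly_Mapping.single \<sigma> (1::'k) \<in> chain_space (n_simplices K) (Suc n)" using \<sigma> by simp
      then have b: "?b \<in> chain_space (n_simplices K) n"
        by (rule boundary_in_chain_space[rotated]) (rule simplex_face_in_n_simplices[OF K])
      have cone: "?f (Suc n) (cone_chain m n x) = cone_chain (f m) n (?f n x)" for m x
      proof (rule chain_linear_eq[where F = "\<lambda>x. ?f (Suc n) (cone_chain m n x)"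
            and G = "\<lambda>x. cone_chain (f m) n (?f n x)"])
        show "chain_linear (\<lambda>x. ?f (Suc n) (cone_chain m n x))"
          using Vector_Spaces.linear_compose[OF linear_cone_chain linear_linear_extend] by (simp add: o_def)
        show "chain_linear (\<lambda>x. cone_chain (f m) n (?f n x))"
          using Vector_Spaces.linear_compose[OF linear_linear_extend linear_cone_chain] by (simp add: o_def)
      qed (simp add: simplex_map_singular_cone)
      show "?f (Suc n) (realize_chain p (Suc n) (Poly_Mapping.single \<sigma> 1)) =
          realize_chain q (Suc n) (Poly_Mapping.single \<sigma> 1)"
        using \<sigma> by (simp add: cone Suc.IH[OF b] p n_simplices_def)
    qed (use lin linear_linear_extend in auto)
  }
qed

text \<open>
  A simplicial complex \<open>K\<close> over a finite space \<open>X\<close>, with \<open>r\<close> the projection of the vertices to \<open>X\<close>. Every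
  simplex has a highest point, and the simplices over a minimal open set form a cone whose apex lies
  over its highest point. The order complex of a finite \<open>T\<^sub>0\<close> space, with \<open>r\<close> the identity, is the
  standard example.
\<close>
locale finite_space_cover =
  fixes X :: "'a topology" and K :: "'v::linorder set set" and r :: "'v \<Rightarrow> 'a" and p :: "'v set \<Rightarrow> 'a"
  assumes finite_topspace: "finite (topspace X)"
    and complex: "abstract_simplicial_complex K"
    and vertex_in_topspace: "\<sigma> \<in> K \<Longrightarrow> v \<in> \<sigma> \<Longrightarrow> r v \<in> topspace X"
    and top_in_image: "\<sigma> \<in> K \<Longrightarrow> p \<sigma> \<in> r ` \<sigma>"
    and specializes_top: "\<sigma> \<in> K \<Longrightarrow> v \<in> \<sigma> \<Longrightarrow> specializes X (r v) (p \<sigma>)"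
    and cone_vertex: "m \<in> topspace X \<Longrightarrow>
      \<exists>v. r v = m \<and> {v} \<in> K \<and> (\<forall>\<sigma>\<in>K. (\<forall>w\<in>\<sigma>. specializes X (r w) m) \<longrightarrow> insert v \<sigma> \<in> K)"
begin

definition over :: "'a set \<Rightarrow> 'v set set" where
  "over W = {\<sigma> \<in> K. r ` \<sigma> \<subseteq> W}"

lemma complex_over: "abstract_simplicial_complex (over W)"
  unfolding abstract_simplicial_complex_def over_def
  using abstract_simplicial_complexD[OF complex] by blast

lemma top_in_topspace: "\<sigma> \<in> K \<Longrightarrow> p \<sigma> \<in> topspace X"
  using top_in_image[of \<sigma>] vertex_in_topspace[of \<sigma>] by auto

text \<open>
  The highest point of a face lies below that of the simplex. So by induction the realization of the
  boundary of \<open>\<sigma>\<close> lies in the minimal open set of \<open>p \<sigma>\<close>, where it can be coned off.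
\<close>
lemma realize_in_minimal_open:
  "\<sigma> \<in> n_simplices K n \<Longrightarrow>
     (realize p n \<sigma> :: _ \<Rightarrow>\<^sub>0 'k::field) \<in> singular_chains (subtopology X (minimal_open X (p \<sigma>))) n"
proof (induction n arbitrary: \<sigma>)
  case 0
  then have "p \<sigma> \<in> topspace X" by (simp add: n_simplices_def top_in_topspace)
  then show ?case
    using mem_minimal_open_self[of "p \<sigma>" X] by (simp add: singular_simplex_singular_point)
next
  case (Suc n)
  then have \<sigma>: "\<sigma> \<in> K" by (simp add: n_simplices_def)
  let ?S = "\<lambda>k. n_simplices {\<rho> \<in> K. \<rho> \<subseteq> \<sigma>} k"
  have K': "abstract_simplicial_complex {\<rho> \<in> K. \<rho> \<subseteq> \<sigma>}"
    unfolding abstract_simplicial_complex_def using abstract_simplicial_complexD[OF complex] by blast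
  have "Poly_Mapping.single \<sigma> (1::'k) \<in> chain_space ?S (Suc n)"
    using Suc.prems by (simp add: n_simplices_def)
  then have "boundary simplex_face (Suc n) (Poly_Mapping.single \<sigma> (1::'k)) \<in> chain_space ?S n"
    by (rule boundary_in_chain_space[rotated]) (rule simplex_face_in_n_simplices[OF K'])
  then have "realize_chain p n (boundary simplex_face (Suc n) (Poly_Mapping.single \<sigma> (1::'k)))
      \<in> singular_chains (subtopology X (minimal_open X (p \<sigma>))) n"
  proof (rule linear_extend_in_chain_space)
    fix \<rho> assume "\<rho> \<in> ?S n"
    then have \<rho>: "\<rho> \<in> n_simplices K n" "\<rho> \<in> K" "\<rho> \<subseteq> \<sigma>" by (auto simp: n_simplices_def)
    then have le: "specializes X (p \<rho>) (p \<sigma>)"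
      using top_in_image[OF \<rho>(2)] specializes_top[OF \<sigma>] by auto
    show "(realize p n \<rho> :: _ \<Rightarrow>\<^sub>0 'k) \<in> singular_chains (subtopology X (minimal_open X (p \<sigma>))) n"
      by (rule singular_chains_subtopology_mono[OF Suc.IH[OF \<rho>(1)] minimal_open_mono[OF le]])
  qed
  then show ?case
    by (simp add: cone_chain_in_singular_chains focal_point_minimal_open top_in_topspace \<sigma>)
qed

lemma realize_chain_in_singular_chains:
  assumes "openin X W" and c: "c \<in> chain_space (n_simplices (over W)) n"
  shows "(realize_chain p n c :: _ \<Rightarrow>\<^sub>0 'k::field) \<in> singular_chains (subtopology X W) n"
  using c
proof (rule linear_extend_in_chain_space)
  fix \<sigma> assume "\<sigma> \<in> n_simplices (over W) n"
  then have \<sigma>: "\<sigma> \<in> n_simplices K n" "\<sigma> \<in> K" "r ` \<sigma> \<subseteq> W" by (auto simp: n_simplices_def over_def)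
  then have "minimal_open X (p \<sigma>) \<subseteq> W"
    using minimal_open_subset[OF assms(1)] top_in_image[OF \<sigma>(2)] by auto
  then show "(realize p n \<sigma> :: _ \<Rightarrow>\<^sub>0 'k) \<in> singular_chains (subtopology X W) n"
    by (intro singular_chains_subtopology_mono[OF realize_in_minimal_open[OF \<sigma>(1)]])
qed

lemma over_topspace: "over (topspace X) = K"
  using vertex_in_topspace by (auto simp: over_def)

text \<open>
  The boundary of a cone over a cycle is the cycle. That the realized boundary of a simplex is a cycle
  follows from the claim one dimension lower, and from the augmentation in dimension \<open>0\<close>.
\<close>
lemma boundary_realize_chain:
  fixes c :: "'v set \<Rightarrow>\<^sub>0 'k::field"
  assumes "c \<in> chain_space (n_simplices K) (Suc n)"
  shows "boundary singular_face (Suc n) (realize_chain p (Suc n) c) =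
           realize_chain p n (boundary simplex_face (Suc n) c)"
  using assms
proof (induction n arbitrary: c)
  have lin: "chain_linear (\<lambda>c::'v set \<Rightarrow>\<^sub>0 'k. boundary singular_face (Suc n) (realize_chain p (Suc n) c))"
    "chain_linear (\<lambda>c::'v set \<Rightarrow>\<^sub>0 'k. realize_chain p n (boundary simplex_face (Suc n) c))" for n
    using Vector_Spaces.linear_compose[OF linear_linear_extend linear_boundary]
      Vector_Spaces.linear_compose[OF linear_boundary linear_linear_extend] by (simp_all add: o_def)
  have step: "boundary singular_face (Suc n) (realize_chain p (Suc n) c) =
           realize_chain p n (boundary simplex_face (Suc n) c)"
    if c: "c \<in> chain_space (n_simplices K) (Suc n)"
      and cycle: "\<And>\<sigma>. \<sigma> \<in> n_simplices K (Suc n) \<Longrightarrow>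
        (let b = realize_chain p n (boundary simplex_face (Suc n) (Poly_Mapping.single \<sigma> (1::'k)))
         in if n = 0 then augmentation b = 0 else boundary singular_face n b = 0)"
    for n and c :: "'v set \<Rightarrow>\<^sub>0 'k"
  proof (rule chain_linear_eq[OF lin])
    fix \<sigma> assume "\<sigma> \<in> Poly_Mapping.keys c"
    then have \<sigma>: "\<sigma> \<in> n_simplices K (Suc n)" using c by (auto simp: chain_space_def)
    let ?b = "boundary simplex_face (Suc n) (Poly_Mapping.single \<sigma> (1::'k))"
    have "Poly_Mapping.single \<sigma> (1::'k) \<in> chain_space (n_simplices (over (topspace X))) (Suc n)"
      using \<sigma> by (simp add: over_topspace)
    then have "?b \<in> chain_space (n_simplices (over (topspace X))) n"
      by (rule boundary_in_chain_space[rotated]) (rule simplex_face_in_n_simplices[OF complex_over])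
    then have "realize_chain p n ?b \<in> singular_chains (subtopology X (topspace X)) n"
      by (rule realize_chain_in_singular_chains[OF openin_topspace])
    from boundary_cone_chain_cycle[OF this] cycle[OF \<sigma>]
    show "boundary singular_face (Suc n) (realize_chain p (Suc n) (Poly_Mapping.single \<sigma> 1)) =
        realize_chain p n ?b"
      by (simp add: Let_def)
  qed
  {
    case 0
    then show ?case by (rule step) (simp add: augmentation_realize_chain_0 augmentation_boundary)
  next
    case (Suc n)
    show ?case
    proof (rule step[OF Suc.prems])
      fix \<sigma> assume \<sigma>: "\<sigma> \<in> n_simplices K (Suc (Suc n))"
      let ?s = "Poly_Mapping.single \<sigma> (1::'k)"
      have s: "?s \<in> chain_space (n_simplices K) (Suc (Suc n))" using \<sigma> by simp
      then have "boundary simplex_face (Suc (Suc n)) ?s \<in> chain_space (n_simplices K) (Suc n)"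
        by (rule boundary_in_chain_space[rotated]) (rule simplex_face_in_n_simplices[OF complex])
      then have "boundary singular_face (Suc n) (realize_chain p (Suc n) (boundary simplex_face (Suc (Suc n)) ?s)) =
          realize_chain p n (boundary simplex_face (Suc n) (boundary simplex_face (Suc (Suc n)) ?s))"
        by (rule Suc.IH)
      also have "boundary simplex_face (Suc n) (boundary simplex_face (Suc (Suc n)) ?s) = 0"
        using s
      proof (rule boundary_boundary)
        fix i j \<rho> assume \<rho>: "\<rho> \<in> n_simplices K (Suc (Suc n))" "i \<le> j" "j \<le> Suc n"
        then show "simplex_face (Suc n) i (simplex_face (Suc (Suc n)) (Suc j) \<rho>) =
            simplex_face (Suc n) j (simplex_face (Suc (Suc n)) i \<rho>)"
          using abstract_simplicial_complexD(1)[OF complex, of \<rho>]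
          by (intro simplex_face_face) (auto simp: n_simplices_def)
      qed
      finally show "let b = realize_chain p (Suc n) (boundary simplex_face (Suc (Suc n)) ?s)
         in if Suc n = 0 then augmentation b = 0 else boundary singular_face (Suc n) b = 0"
        by (simp add: Let_def chain_linear_zero[OF linear_linear_extend] del: realize.simps)
    qed
  }
qed

section \<open>The realization is a homology isomorphism\<close>

abbreviation realization_cone :: "'a set \<Rightarrow> nat \<Rightarrow>
    ((((nat \<Rightarrow> real) \<Rightarrow> 'a) \<Rightarrow>\<^sub>0 'k::field) \<times> ('v set \<Rightarrow>\<^sub>0 'k)) set" where
  "realization_cone W \<equiv> mapping_cone (\<lambda>n. singular_simplex_set n (subtopology X W)) (n_simplices (over W))"

abbreviation realization_cone_boundary :: "nat \<Rightarrow>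
    (((nat \<Rightarrow> real) \<Rightarrow> 'a) \<Rightarrow>\<^sub>0 'k::field) \<times> ('v set \<Rightarrow>\<^sub>0 'k) \<Rightarrow>
    (((nat \<Rightarrow> real) \<Rightarrow> 'a) \<Rightarrow>\<^sub>0 'k) \<times> ('v set \<Rightarrow>\<^sub>0 'k)" where
  "realization_cone_boundary \<equiv> cone_boundary singular_face simplex_face (realize_chain p)"

lemma over_subset: "over W \<subseteq> K"
  by (auto simp: over_def)

lemma chain_space_over_subset: "c \<in> chain_space (n_simplices (over W)) n \<Longrightarrow> c \<in> chain_space (n_simplices K) n"
  using over_subset by (fastforce simp: chain_space_def n_simplices_def)

lemma realization_cone_boundary_closed:
  assumes "openin X W" "x \<in> realization_cone W (Suc n)"
  shows "realization_cone_boundary n (realization_cone_boundary (Suc n) x) = (0 :: _ \<times> ('v set \<Rightarrow>\<^sub>0 'k::field))"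
    and "realization_cone_boundary (Suc n) x \<in> (realization_cone W n :: (_ \<times> ('v set \<Rightarrow>\<^sub>0 'k)) set)"
proof -
  obtain s c where x: "x = (s, c)" "s \<in> singular_chains (subtopology X W) (Suc n)"
    "c \<in> chain_space (n_simplices (over W)) n"
    using assms(2) by (auto simp: mapping_cone_def)
  have bc: "case n of 0 \<Rightarrow> boundary simplex_face n c = 0
      | Suc k \<Rightarrow> boundary simplex_face n c \<in> chain_space (n_simplices (over W)) k"
  proof (cases n)
    case (Suc k)
    then show ?thesis
      using x(3) boundary_in_simplicial_chains[OF complex_over] by simp
  qed (simp add: boundary_def)
  show "realization_cone_boundary (Suc n) x \<in> (realization_cone W n :: (_ \<times> ('v set \<Rightarrow>\<^sub>0 'k)) set)"
    using bc chain_space_add[OF boundary_in_singular_chains[OF x(2)]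
        realize_chain_in_singular_chains[OF assms(1) x(3)]]
    by (auto simp: cone_boundary_def mapping_cone_def x(1) chain_space_minus split: nat.splits)
  show "realization_cone_boundary n (realization_cone_boundary (Suc n) x) = (0 :: _ \<times> ('v set \<Rightarrow>\<^sub>0 'k))"
  proof (cases n)
    case (Suc k)
    have c: "c \<in> chain_space (n_simplices K) (Suc k)"
      using chain_space_over_subset[OF x(3)] Suc by simp
    show ?thesis
      using x(2) boundary_boundary_simplicial[OF complex c] boundary_realize_chain[OF c]
      by (simp add: Suc cone_boundary_def x(1) boundary_linear_simps boundary_boundary_singular
          chain_linear_minus[OF linear_linear_extend] zero_prod_def del: realize.simps)
  qed (simp add: cone_boundary_def)
qed

lemma complex_over_minimal_open:
  assumes "m \<in> topspace X"
  obtains v where "{v} \<in> over (minimal_open X m)"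
    "\<And>\<sigma>. \<sigma> \<in> over (minimal_open X m) \<Longrightarrow> insert v \<sigma> \<in> over (minimal_open X m)"
proof -
  obtain v where "r v = m \<and> {v} \<in> K \<and>
      (\<forall>\<sigma>\<in>K. (\<forall>w\<in>\<sigma>. specializes X (r w) m) \<longrightarrow> insert v \<sigma> \<in> K)"
    using cone_vertex[OF assms] by (rule exE)
  then have v: "r v = m" "{v} \<in> K"
    "\<And>\<sigma>. \<sigma> \<in> K \<Longrightarrow> \<forall>w\<in>\<sigma>. specializes X (r w) m \<Longrightarrow> insert v \<sigma> \<in> K"
    by simp_all
  show thesis
  proof (rule that[of v])
    show "{v} \<in> over (minimal_open X m)"
      using v assms by (simp add: over_def mem_minimal_open_self)
    fix \<sigma> assume "\<sigma> \<in> over (minimal_open X m)"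
    then have "\<sigma> \<in> K" "r ` \<sigma> \<subseteq> minimal_open X m" by (simp_all add: over_def)
    then show "insert v \<sigma> \<in> over (minimal_open X m)"
      using v(1) v(3)[of \<sigma>] mem_minimal_open_self[OF assms]
      by (simp add: over_def minimal_open_def image_subset_iff)
  qed
qed

text \<open>
  Over a minimal open set both the simplicial and the singular complex are cones, hence acyclic up to
  augmentation, and the realization preserves the augmentation. A cycle \<open>(s, c)\<close> of the mapping cone is
  filled by first filling \<open>c\<close> by \<open>c'\<close>, and then the cycle \<open>s\<close> plus the realization of \<open>c'\<close>.
\<close>
lemma acyclic_realization_cone_minimal_open:
  assumes m: "m \<in> topspace X"
  shows "acyclic_complex realization_cone_boundary
           (realization_cone (minimal_open X m) :: nat \<Rightarrow> (_ \<times> ('v set \<Rightarrow>\<^sub>0 'k::field)) set)"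
  unfolding acyclic_complex_def
proof (intro allI ballI impI)
  fix n and z :: "(((nat \<Rightarrow> real) \<Rightarrow> 'a) \<Rightarrow>\<^sub>0 'k) \<times> ('v set \<Rightarrow>\<^sub>0 'k)"
  let ?U = "minimal_open X m"
  let ?Y = "subtopology X ?U"
  assume z: "z \<in> realization_cone ?U n" "realization_cone_boundary n z = 0"
  obtain v where v: "{v} \<in> over ?U" "\<And>\<sigma>. \<sigma> \<in> over ?U \<Longrightarrow> insert v \<sigma> \<in> over ?U"
    using complex_over_minimal_open[OF m] by blast
  have U: "openin X ?U" using finite_topspace m by (rule openin_minimal_open)
  have fill: "\<exists>s'\<in>singular_chains ?Y (Suc k). boundary singular_face (Suc k) s' = (s :: _ \<Rightarrow>\<^sub>0 'k)"
    if "s \<in> singular_chains ?Y k" "if k = 0 then augmentation s = 0 else boundary singular_face k s = 0" for k s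
    using boundary_cone_chain_cycle[OF that] cone_chain_in_singular_chains[OF focal_point_minimal_open[OF m] that(1)]
    by blast
  have "\<exists>s'\<in>singular_chains ?Y (Suc n). \<exists>c'\<in>chain_space (n_simplices (over ?U)) n.
      z = (boundary singular_face (Suc n) s' + realize_chain p n c', - boundary simplex_face n c')"
  proof (cases n)
    case 0
    then obtain s where s: "s \<in> singular_chains ?Y 0" "z = (s, 0)"
      using z(1) by (auto simp: mapping_cone_def)
    \<comment> \<open>A multiple of the apex with the augmentation of \<open>s\<close>; its realization differs from \<open>s\<close> by a boundary.\<close>
    let ?c = "linear_extend (\<lambda>_. Poly_Mapping.single {v} 1) (augmentation s)"
    have c: "?c \<in> chain_space (n_simplices (over ?U)) 0"
      by (rule linear_extend_in_chain_space[where S = "\<lambda>_. UNIV"])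
         (use v in \<open>auto simp: chain_space_def n_simplices_def\<close>)
    have "augmentation ?c = augmentation s"
    proof (rule chain_linear_eq[where F = "\<lambda>x. augmentation (linear_extend (\<lambda>_. Poly_Mapping.single {v} 1) x)"
          and G = "\<lambda>x. x"])
      show "chain_linear (\<lambda>x :: unit \<Rightarrow>\<^sub>0 'k. augmentation (linear_extend (\<lambda>_. Poly_Mapping.single {v} 1) x))"
        using Vector_Spaces.linear_compose[OF linear_linear_extend linear_augmentation] by (simp add: o_def)
    qed (auto intro: chain_linearI)
    then have "augmentation (s - realize_chain p 0 ?c) = 0"
      by (simp add: chain_linear_diff[OF linear_augmentation] augmentation_realize_chain_0)
    moreover have "s - realize_chain p 0 ?c \<in> singular_chains ?Y 0"
      by (intro chain_space_diff s realize_chain_in_singular_chains U c)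
    ultimately obtain s' where "s' \<in> singular_chains ?Y (Suc 0)"
      "boundary singular_face (Suc 0) s' = s - realize_chain p 0 ?c"
      using fill by fastforce
    then show ?thesis
      using c by (intro bexI[of _ s'] bexI[of _ ?c]) (simp_all add: 0 s boundary_def[of simplex_face])
  next
    case (Suc k)
    then obtain s c where x: "z = (s, c)" "s \<in> singular_chains ?Y (Suc k)"
      "c \<in> chain_space (n_simplices (over ?U)) k"
      using z(1) by (auto simp: mapping_cone_def)
    have cycle: "boundary singular_face (Suc k) s + realize_chain p k c = 0" "boundary simplex_face k c = 0"
      using z(2) by (simp_all add: Suc x cone_boundary_def zero_prod_def)
    have "augmentation c = 0" if "k = 0"
      using arg_cong[OF cycle(1), of augmentation] that
      by (simp add: chain_linear_add[OF linear_augmentation] augmentation_boundary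
          chain_linear_zero[OF linear_augmentation] augmentation_realize_chain_0 del: realize.simps)
    then obtain c' where c': "c' \<in> chain_space (n_simplices (over ?U)) (Suc k)" "boundary simplex_face (Suc k) c' = c"
      using cone_complex_cycle_is_boundary[OF complex_over v x(3)] cycle(2) by (metis (full_types))
    have "boundary singular_face (Suc k) (s + realize_chain p (Suc k) c') = 0"
      using cycle(1) c'(2) boundary_realize_chain[OF chain_space_over_subset[OF c'(1)]]
      by (simp add: boundary_linear_simps del: realize.simps)
    moreover have "s + realize_chain p (Suc k) c' \<in> singular_chains ?Y (Suc k)"
      by (intro chain_space_add x realize_chain_in_singular_chains U c')
    ultimately obtain s' where "s' \<in> singular_chains ?Y (Suc (Suc k))"
      "boundary singular_face (Suc (Suc k)) s' = s + realize_chain p (Suc k) c'"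
      using fill by (metis nat.distinct(1))
    then show ?thesis
      using c' by (intro bexI[of _ s'] bexI[of _ "- c'"])
        (simp_all add: Suc x chain_linear_minus[OF linear_linear_extend] boundary_linear_simps
          chain_space_minus del: realize.simps)
  qed
  then show "\<exists>w\<in>realization_cone ?U (Suc n). realization_cone_boundary (Suc n) w = z"
    by (auto simp: mapping_cone_def cone_boundary_def simp del: realize.simps intro!: bexI)
qed

text \<open>
  A point whose minimal open set has the greatest number of elements is maximal.
\<close>
lemma exists_maximal_point:
  assumes "W \<subseteq> topspace X" "W \<noteq> {}"
  obtains m where "m \<in> W" "\<And>y. y \<in> W \<Longrightarrow> specializes X m y \<Longrightarrow> specializes X y m"
proof -
  let ?f = "\<lambda>m. card (minimal_open X m)"
  have fin: "finite (minimal_open X y)" for y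
    using finite_topspace minimal_open_subset_topspace by (rule rev_finite_subset)
  have "finite W" using finite_topspace assms(1) by (rule rev_finite_subset)
  then have "Max (?f ` W) \<in> ?f ` W" using assms(2) by (intro Max_in) auto
  then obtain m where m: "m \<in> W" "Max (?f ` W) = ?f m" by blast
  have "specializes X y m" if y: "y \<in> W" "specializes X m y" for y
  proof -
    have "?f y \<le> ?f m" using Max_ge[of "?f ` W" "?f y"] \<open>finite W\<close> y(1) m(2) by simp
    then have "minimal_open X m = minimal_open X y"
      using card_seteq[OF fin minimal_open_mono[OF y(2)]] by simp
    then show ?thesis
      using mem_minimal_open_self[of y X] y(1) assms(1) by (auto simp: minimal_open_def)
  qed
  with m(1) show thesis by (rule that)
qed

lemma small_simplices_subtopology:
  assumes "V \<subseteq> W" "U \<subseteq> W"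
  shows "small_simplices (subtopology X W) {V, U} n =
           singular_simplex_set n (subtopology X V) \<union> singular_simplex_set n (subtopology X U)"
proof -
  have "W \<inter> V = V" "W \<inter> U = U" using assms by auto
  then show ?thesis by (simp add: small_simplices_def subtopology_subtopology)
qed

text \<open>
  A simplex lies over every open set that contains its highest point.
\<close>
lemma over_Un:
  assumes "openin X V" "m \<in> topspace X"
  shows "over (V \<union> minimal_open X m) = over V \<union> over (minimal_open X m)"
proof
  show "over (V \<union> minimal_open X m) \<subseteq> over V \<union> over (minimal_open X m)"
  proof
    fix \<sigma> assume "\<sigma> \<in> over (V \<union> minimal_open X m)"
    then have \<sigma>: "\<sigma> \<in> K" "r ` \<sigma> \<subseteq> V \<union> minimal_open X m" by (auto simp: over_def)
    then have "p \<sigma> \<in> V \<or> p \<sigma> \<in> minimal_open X m" using top_in_image[OF \<sigma>(1)] by blast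
    moreover have "r ` \<sigma> \<subseteq> U" if "openin X U" "p \<sigma> \<in> U" for U
      using that by (intro image_subsetI) (rule specializes_open[OF specializes_top[OF \<sigma>(1)]])
    ultimately show "\<sigma> \<in> over V \<union> over (minimal_open X m)"
      using \<sigma>(1) assms openin_minimal_open[OF finite_topspace assms(2)] by (auto simp: over_def)
  qed
qed (auto simp: over_def)

text \<open>
  Mayer-Vietoris gives acyclicity for the sums of a pair over \<open>V\<close> and a pair over \<open>U\<close>. In a cycle
  \<open>(s, c)\<close> over the union, \<open>c\<close> is such a sum by \<open>over_Un\<close>; hence the boundary of \<open>s\<close>, which is minus the
  realization of \<open>c\<close>, is small, and subtracting the boundary of some \<open>(e, 0)\<close> makes \<open>s\<close> small.
\<close>
lemma acyclic_realization_cone_Un: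
  fixes V m
  defines "U \<equiv> minimal_open X m"
  assumes V: "openin X V" and m: "m \<in> topspace X"
    and acyclic: "acyclic_complex realization_cone_boundary (realization_cone V :: nat \<Rightarrow> (_ \<times> ('v set \<Rightarrow>\<^sub>0 'k::field)) set)"
      "acyclic_complex realization_cone_boundary (realization_cone (V \<inter> U) :: nat \<Rightarrow> (_ \<times> ('v set \<Rightarrow>\<^sub>0 'k)) set)"
  shows "acyclic_complex realization_cone_boundary (realization_cone (V \<union> U) :: nat \<Rightarrow> (_ \<times> ('v set \<Rightarrow>\<^sub>0 'k)) set)"
proof -
  let ?D = "realization_cone_boundary :: nat \<Rightarrow> (_ \<times> ('v set \<Rightarrow>\<^sub>0 'k)) \<Rightarrow> _"
  let ?C = "realization_cone :: 'a set \<Rightarrow> nat \<Rightarrow> (_ \<times> ('v set \<Rightarrow>\<^sub>0 'k)) set"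
  let ?W = "V \<union> U"
  have U: "openin X U" unfolding U_def using finite_topspace m by (rule openin_minimal_open)
  have W: "openin X ?W" using V U by (rule openin_Un)
  have add: "?D n (x + y) = ?D n x + ?D n y" for n x y
    by (rule cone_boundary_add) (rule linear_linear_extend)
  have diff: "?D n (x - y) = ?D n x - ?D n y" for n x y
    using add[of n "x - y" y] by (simp add: eq_diff_eq)
  have "?C (V \<inter> U) = (\<lambda>n. ?C V n \<inter> ?C U n)"
  proof
    fix n
    have "singular_chains (subtopology X (V \<inter> U)) n =
        (singular_chains (subtopology X V) n \<inter> singular_chains (subtopology X U) n :: (_ \<Rightarrow>\<^sub>0 'k) set)"
      unfolding chain_space_def singular_simplex_subtopology le_inf_iff by blast
    moreover have "chain_space (n_simplices (over (V \<inter> U))) k =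
        (chain_space (n_simplices (over V)) k \<inter> chain_space (n_simplices (over U)) k :: (_ \<Rightarrow>\<^sub>0 'k) set)" for k
      unfolding chain_space_def n_simplices_def over_def by blast
    ultimately show "?C (V \<inter> U) n = ?C V n \<inter> ?C U n"
      by (cases n) (auto simp: mapping_cone_def)
  qed
  then have sum: "acyclic_complex ?D (\<lambda>n. {a + b |a b. a \<in> ?C V n \<and> b \<in> ?C U n})"
    using acyclic acyclic_realization_cone_minimal_open[OF m]
    by (intro acyclic_complex_sum add mapping_cone_diff
          realization_cone_boundary_closed[OF V] realization_cone_boundary_closed(2)[OF U])
       (simp_all add: cone_boundary_def U_def)
  have sub: "{a + b |a b. a \<in> ?C V n \<and> b \<in> ?C U n} \<subseteq> ?C ?W n" for n
  proof -
    have "?C V' n \<subseteq> ?C ?W n" if "V' \<subseteq> ?W" for V'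
      using that by (intro mapping_cone_mono singular_simplex_set_subtopology_mono)
        (auto simp: n_simplices_def over_def)
    from this[of V] this[of U] show ?thesis using mapping_cone_add by blast
  qed
  show ?thesis
    unfolding acyclic_complex_def
  proof (intro allI ballI impI)
    fix n z assume z: "z \<in> ?C ?W n" "?D n z = 0"
    obtain s c where sc: "z = (s, c)" "s \<in> singular_chains (subtopology X ?W) n"
      using z(1) by (auto simp: mapping_cone_def)
    let ?T = "\<lambda>n. singular_simplex_set n (subtopology X V) \<union> singular_simplex_set n (subtopology X U)"
    have T: "small_simplices (subtopology X ?W) {V, U} = ?T"
      using small_simplices_subtopology[of V ?W U] by (simp add: fun_eq_iff)
    have c: "case n of 0 \<Rightarrow> c = 0 | Suc k \<Rightarrow> c \<in> chain_space (\<lambda>k. n_simplices (over V) k \<union> n_simplices (over U) k) k"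
      using z(1) over_Un[OF V m] by (auto simp: sc mapping_cone_def chain_space_def n_simplices_def U_def split: nat.splits)
    have "boundary singular_face n s \<in> chain_space ?T (n - 1)"
    proof (cases n)
      case 0
      then show ?thesis by (simp add: boundary_def chain_space_zero)
    next
      case (Suc k)
      have "(realize_chain p k c :: _ \<Rightarrow>\<^sub>0 'k) \<in> chain_space ?T k"
      proof (rule linear_extend_in_chain_space)
        show "c \<in> chain_space (\<lambda>k. n_simplices (over V) k \<union> n_simplices (over U) k) k"
          using c Suc by simp
        fix \<sigma> assume "\<sigma> \<in> n_simplices (over V) k \<union> n_simplices (over U) k"
        then have "realize_chain p k (Poly_Mapping.single \<sigma> (1::'k)) \<in> singular_chains (subtopology X V) k \<or>
            realize_chain p k (Poly_Mapping.single \<sigma> (1::'k)) \<in> singular_chains (subtopology X U) k"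
          by (metis Un_iff V U chain_space_single realize_chain_in_singular_chains)
        then show "(realize p k \<sigma> :: _ \<Rightarrow>\<^sub>0 'k) \<in> chain_space ?T k"
          by (auto simp: chain_space_def)
      qed
      moreover have "boundary singular_face n s = - realize_chain p k c"
        using z(2) by (simp add: Suc sc cone_boundary_def zero_prod_def eq_neg_iff_add_eq_0)
      ultimately show ?thesis by (simp add: Suc chain_space_minus)
    qed
    then have "boundary singular_face n s \<in> chain_space (small_simplices (subtopology X ?W) {V, U}) (n - 1)"
      by (simp only: T)
    moreover have "openin (subtopology X ?W) V'" if "V' \<in> {V, U}" for V'
      using that V U by (auto intro: openin_open_subtopology[THEN iffD2] simp: W openin_open_subtopology)
    moreover have "topspace (subtopology X ?W) \<subseteq> \<Union>{V, U}" by auto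
    ultimately obtain e where e: "e \<in> singular_chains (subtopology X ?W) (Suc n)"
      "s - boundary singular_face (Suc n) e \<in> chain_space (small_simplices (subtopology X ?W) {V, U}) n"
      using chain_homologous_to_small_chain[of "{V, U}" "subtopology X ?W" s n] sc(2) by blast
    have e': "(e, 0) \<in> ?C ?W (Suc n)" using e(1) by (simp add: mapping_cone_def chain_space_zero)
    have De: "?D (Suc n) (e, 0) = (boundary singular_face (Suc n) e, 0)"
      by (simp add: cone_boundary_def chain_linear_zero[OF linear_linear_extend] boundary_linear_simps)
    obtain a b where ab: "a \<in> singular_chains (subtopology X V) n" "b \<in> singular_chains (subtopology X U) n"
      "s - boundary singular_face (Suc n) e = a + b"
      using e(2) unfolding T by (rule chain_space_split)
    have "\<exists>c1 c2. (a, c1) \<in> ?C V n \<and> (b, c2) \<in> ?C U n \<and> c = c1 + c2"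
    proof (cases n)
      case 0
      then show ?thesis using c ab by (auto simp: mapping_cone_def)
    next
      case (Suc k)
      then obtain c1 c2 where "c1 \<in> chain_space (n_simplices (over V)) k"
        "c2 \<in> chain_space (n_simplices (over U)) k" "c = c1 + c2"
        using c chain_space_split[of c "n_simplices (over V)" "n_simplices (over U)" k] by auto
      then show ?thesis using Suc ab by (auto simp: mapping_cone_def)
    qed
    then obtain c1 c2 where "(a, c1) \<in> ?C V n" "(b, c2) \<in> ?C U n" "c = c1 + c2" by blast
    moreover from this(3) have "z - ?D (Suc n) (e, 0) = (a, c1) + (b, c2)"
      by (simp add: sc(1) De ab(3))
    ultimately have "z - ?D (Suc n) (e, 0) \<in> {a + b |a b. a \<in> ?C V n \<and> b \<in> ?C U n}" by blast
    moreover have "?D n (z - ?D (Suc n) (e, 0)) = 0"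
      using z(2) realization_cone_boundary_closed(1)[OF W e'] by (simp add: diff)
    ultimately obtain w where w: "w \<in> {a + b |a b. a \<in> ?C V (Suc n) \<and> b \<in> ?C U (Suc n)}"
      "?D (Suc n) w = z - ?D (Suc n) (e, 0)"
      using sum unfolding acyclic_complex_def by blast
    then have "w + (e, 0) \<in> ?C ?W (Suc n)" "?D (Suc n) (w + (e, 0)) = z"
      using sub e' mapping_cone_add by (blast, simp add: add)
    then show "\<exists>w\<in>?C ?W (Suc n). ?D (Suc n) w = z" by blast
  qed
qed

lemma acyclic_realization_cone:
  assumes "openin X W"
  shows "acyclic_complex realization_cone_boundary (realization_cone W :: nat \<Rightarrow> (_ \<times> ('v set \<Rightarrow>\<^sub>0 'k::field)) set)"
  using assms
proof (induction "card W" arbitrary: W rule: less_induct)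
  case less
  have sub: "W \<subseteq> topspace X" using openin_subset[OF less.prems] .
  then have fin: "finite W" using finite_topspace by (rule finite_subset)
  show ?case
  proof (cases "W = {}")
    case True
    have no_simplices: "n_simplices (over W) n = {}" for n
      using True abstract_simplicial_complexD(2)[OF complex] by (auto simp: n_simplices_def over_def)
    have no_singular_simplices: "singular_simplex_set n (subtopology X W) = {}" for n
      using True by (simp add: singular_simplex_empty)
    have "z = 0" if "z \<in> realization_cone W n" for n and z :: "_ \<times> ('v set \<Rightarrow>\<^sub>0 'k)"
      using that by (auto simp: mapping_cone_def chain_space_def zero_prod_def no_simplices
          no_singular_simplices split: nat.splits)
    moreover have "realization_cone_boundary (Suc n) 0 = (0 :: _ \<times> ('v set \<Rightarrow>\<^sub>0 'k))" for n
      by (simp add: cone_boundary_def zero_prod_def boundary_linear_simps chain_linear_zero[OF linear_linear_extend])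
    moreover have "0 \<in> realization_cone W (Suc n)" for n
      by (simp add: mapping_cone_def zero_prod_def chain_space_zero)
    ultimately show ?thesis unfolding acyclic_complex_def by metis
  next
    case False
    then obtain m where m: "m \<in> W" "\<And>y. y \<in> W \<Longrightarrow> specializes X m y \<Longrightarrow> specializes X y m"
      using exists_maximal_point[OF sub] by blast
    have mX: "m \<in> topspace X" using m(1) sub by auto
    \<comment> \<open>By maximality of \<open>m\<close>, the points removed here are those equivalent to \<open>m\<close>; there may be
      several of them, as \<open>X\<close> need not be \<open>T\<^sub>0\<close>.\<close>
    define V where "V = {y \<in> W. \<not> specializes X m y}"
    have "openin X (minimal_open X y) \<and> y \<in> minimal_open X y \<and> minimal_open X y \<subseteq> V" if "y \<in> V" for y
    proof -
      have y: "y \<in> W" "y \<in> topspace X" "\<not> specializes X m y" using that sub by (auto simp: V_def)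
      have "minimal_open X y \<subseteq> V"
        using minimal_open_subset[OF less.prems y(1)] y(3)
        by (auto simp: V_def minimal_open_def intro: specializes_trans)
      then show ?thesis using y by (simp add: openin_minimal_open finite_topspace mem_minimal_open_self)
    qed
    then have V: "openin X V" by (subst openin_subopen) blast
    have W: "W = V \<union> minimal_open X m"
      using m minimal_open_subset[OF less.prems m(1)] by (auto simp: V_def minimal_open_def)
    have "m \<notin> V" using mX by (simp add: V_def specializes_refl)
    then have "V \<subset> W" using m(1) by (auto simp: V_def)
    then have card: "card V < card W" "card (V \<inter> minimal_open X m) < card W"
      using fin by (auto intro!: psubset_card_mono)
    have "openin X (V \<inter> minimal_open X m)"
      using V openin_minimal_open[OF finite_topspace mX] by (rule openin_Int)
    then show ?thesis
      unfolding W by (intro acyclic_realization_cone_Un V mX less.hyps card)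
  qed
qed

text \<open>
  McCord's theorem, for complexes over a finite space.
\<close>
theorem realize_chain_homology_bij:
  "bij_betw (homology_map singular_face (\<lambda>n. singular_simplex_set n X) n
               (realize_chain p n :: _ \<Rightarrow> (((nat \<Rightarrow> real) \<Rightarrow> 'a) \<Rightarrow>\<^sub>0 'k::field)))
     (carrier (homology simplex_face (n_simplices K) n))
     (carrier (homology singular_face (\<lambda>n. singular_simplex_set n X) n))"
proof (rule homology_map_bij_if_mapping_cone_acyclic)
  show "realize_chain p n ` chain_space (n_simplices K) n \<subseteq> (singular_chains X n :: (_ \<Rightarrow>\<^sub>0 'k) set)" for n
    using realize_chain_in_singular_chains[OF openin_topspace, of _ n, where 'k='k] by (auto simp: over_topspace)
  show "acyclic_complex realization_cone_boundary
      (mapping_cone (\<lambda>n. singular_simplex_set n X) (n_simplices K) :: nat \<Rightarrow> (_ \<times> ('v set \<Rightarrow>\<^sub>0 'k)) set)"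
    using acyclic_realization_cone[OF openin_topspace, where 'k='k] by (simp add: over_topspace)
qed (simp_all add: linear_linear_extend boundary_realize_chain del: realize.simps)

end

section \<open>Isomorphisms of persistent vector spaces\<close>

lemma persistent_map_in_carrier:
  assumes "persistent_vector_space P V f" "a \<in> P" "b \<in> P" "a \<le> b" "x \<in> carrier (V a)"
  shows "f a b x \<in> carrier (V b)"
proof -
  have "f a b \<in> linear_maps (V a) (V b)" using assms(1-4) by (simp add: persistent_vector_space_def)
  then show ?thesis using assms(5) by (auto simp: linear_maps_def)
qed

lemma persistent_isomorphic_sym:
  fixes V :: "'p::order \<Rightarrow> ('k::field, 'm) module"
  assumes V: "persistent_vector_space P V f" and iso: "persistent_isomorphic P V f W g"
  shows "persistent_isomorphic P W g V f"
proof -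
  from iso obtain \<phi> where \<phi>0: "(\<forall>a\<in>P. \<phi> a \<in> linear_maps (V a) (W a) \<and>
      bij_betw (\<phi> a) (carrier (V a)) (carrier (W a))) \<and>
    (\<forall>a\<in>P. \<forall>b\<in>P. a \<le> b \<longrightarrow> (\<forall>x\<in>carrier (V a). \<phi> b (f a b x) = g a b (\<phi> a x)))"
    unfolding persistent_isomorphic_def by (rule exE)
  then have \<phi>: "\<And>a. a \<in> P \<Longrightarrow> \<phi> a \<in> linear_maps (V a) (W a)"
    "\<And>a. a \<in> P \<Longrightarrow> bij_betw (\<phi> a) (carrier (V a)) (carrier (W a))"
    "\<And>a b x. a \<in> P \<Longrightarrow> b \<in> P \<Longrightarrow> a \<le> b \<Longrightarrow> x \<in> carrier (V a) \<Longrightarrow> \<phi> b (f a b x) = g a b (\<phi> a x)"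
    by simp_all
  define \<psi> where "\<psi> a = inv_into (carrier (V a)) (\<phi> a)" for a
  have mem: "\<psi> a y \<in> carrier (V a)" and right: "\<phi> a (\<psi> a y) = y" if "a \<in> P" "y \<in> carrier (W a)" for a y
    using \<phi>(2)[OF that(1)] that(2) unfolding \<psi>_def bij_betw_def
    by (auto intro: inv_into_into f_inv_into_f)
  have left: "\<psi> a x = y" if "a \<in> P" "y \<in> carrier (V a)" "\<phi> a y = x" for a x y
    using \<phi>(2)[OF that(1)] that(2,3) unfolding \<psi>_def bij_betw_def by (auto intro: inv_into_f_f)
  show ?thesis
    unfolding persistent_isomorphic_def
  proof (intro exI[of _ \<psi>] conjI ballI impI)
    fix a assume a: "a \<in> P"
    interpret module "scalars :: 'k ring" "V a" using V a by (simp add: persistent_vector_space_def)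
    show "bij_betw (\<psi> a) (carrier (W a)) (carrier (V a))"
      unfolding \<psi>_def using \<phi>(2)[OF a] by (rule bij_betw_inv_into)
    show "\<psi> a \<in> linear_maps (W a) (V a)"
      unfolding linear_maps_def
    proof (intro CollectI conjI ballI allI)
      show "\<psi> a \<in> carrier (W a) \<rightarrow> carrier (V a)" using mem[OF a] by blast
      fix x y assume xy: "x \<in> carrier (W a)" "y \<in> carrier (W a)"
      show "\<psi> a (x \<oplus>\<^bsub>W a\<^esub> y) = \<psi> a x \<oplus>\<^bsub>V a\<^esub> \<psi> a y"
        using \<phi>(1)[OF a] mem[OF a] xy right[OF a] by (intro left[OF a]) (simp_all add: linear_maps_def)
    next
      fix k x assume x: "x \<in> carrier (W a)"
      have "k \<odot>\<^bsub>V a\<^esub> \<psi> a x \<in> carrier (V a)"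
        using mem[OF a x] by (intro smult_closed) (simp add: scalars_def)
      then show "\<psi> a (k \<odot>\<^bsub>W a\<^esub> x) = k \<odot>\<^bsub>V a\<^esub> \<psi> a x"
        using \<phi>(1)[OF a] mem[OF a x] right[OF a x] by (intro left[OF a]) (simp_all add: linear_maps_def)
    qed
  next
    fix a b y assume ab: "a \<in> P" "b \<in> P" "a \<le> b" and y: "y \<in> carrier (W a)"
    have "f a b (\<psi> a y) \<in> carrier (V b)"
      by (rule persistent_map_in_carrier[OF V ab mem[OF ab(1) y]])
    then show "\<psi> b (g a b y) = f a b (\<psi> a y)"
      using \<phi>(3)[OF ab mem[OF ab(1) y]] right[OF ab(1) y] by (intro left[OF ab(2)]) simp_all
  qed
qed

section \<open>The weighted graph of a persistent finite space\<close>

lemma finite_total_preorder_greatest: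
  assumes "finite A" "A \<noteq> {}"
    and refl: "\<And>x. x \<in> A \<Longrightarrow> R x x"
    and trans: "\<And>x y z. x \<in> A \<Longrightarrow> y \<in> A \<Longrightarrow> z \<in> A \<Longrightarrow> R x y \<Longrightarrow> R y z \<Longrightarrow> R x z"
    and total: "\<And>x y. x \<in> A \<Longrightarrow> y \<in> A \<Longrightarrow> R x y \<or> R y x"
  shows "\<exists>y\<in>A. \<forall>x\<in>A. R x y"
  using assms
proof (induction A rule: finite_ne_induct)
  case (singleton a)
  have "R a a" by (rule singleton.prems(1)) simp
  then show ?case by simp
next
  case (insert a A)
  have "\<exists>y\<in>A. \<forall>x\<in>A. R x y"
    by (rule insert.IH) (use insert.prems in \<open>blast+\<close>)
  then obtain y where y: "y \<in> A" "\<forall>x\<in>A. R x y" by blast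
  show ?case
  proof (cases "R a y")
    case True
    then show ?thesis using y by blast
  next
    case False
    then have "R y a" using insert.prems(3) y(1) by blast
    then have "R x a" if "x \<in> A" for x
      using insert.prems(2)[of x y a] y that by blast
    then show ?thesis using insert.prems(1) by blast
  qed
qed

text \<open>
  The vertices \<open>v\<close> stand for the pairs \<open>(\<alpha> v, \<xi> v)\<close> of an element of \<open>P\<close> and a point of the space there.
  Pairs may be repeated.
\<close>
locale persistent_space_vertices =
  fixes P :: "'p::order set" and X :: "'p \<Rightarrow> 'a topology" and \<tau> :: "'p \<Rightarrow> 'p \<Rightarrow> 'a \<Rightarrow> 'a"
    and V :: "'v::linorder set" and \<alpha> :: "'v \<Rightarrow> 'p" and \<xi> :: "'v \<Rightarrow> 'a"
  assumes space: "persistent_finite_space P X \<tau>"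
    and finite_V: "finite V"
    and \<alpha>: "v \<in> V \<Longrightarrow> \<alpha> v \<in> P"
    and \<xi>: "v \<in> V \<Longrightarrow> \<xi> v \<in> topspace (X (\<alpha> v))"
    and all_points: "a \<in> P \<Longrightarrow> x \<in> topspace (X a) \<Longrightarrow> \<exists>v\<in>V. \<alpha> v = a \<and> \<xi> v = x"
begin

text \<open>
  Where the point of \<open>v\<close> has moved to at stage \<open>c\<close>; meaningful only for \<open>\<alpha> v \<le> c\<close>.
\<close>
definition position :: "'p \<Rightarrow> 'v \<Rightarrow> 'a" where
  "position c v = \<tau> (\<alpha> v) c (\<xi> v)"

definition comparable :: "'p \<Rightarrow> 'v \<Rightarrow> 'v \<Rightarrow> bool" where
  "comparable c u v \<longleftrightarrow> specializes (X c) (position c u) (position c v) \<or>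
     specializes (X c) (position c v) (position c u)"

definition last_birth :: "'v set \<Rightarrow> 'p \<Rightarrow> bool" where
  "last_birth \<sigma> b \<longleftrightarrow> b \<in> \<alpha> ` \<sigma> \<and> (\<forall>w\<in>\<sigma>. \<alpha> w \<le> b)"

text \<open>
  The weight of the graph. An edge is born together with the later of its two vertices.
\<close>
definition birth :: "'v set \<Rightarrow> 'p" where
  "birth \<sigma> = (THE b. last_birth \<sigma> b)"

definition graph :: "'v set set" where
  "graph = {\<sigma>. \<sigma> \<subseteq> V \<and> \<sigma> \<noteq> {} \<and> card \<sigma> \<le> 2 \<and>
     (\<exists>b. last_birth \<sigma> b \<and> (\<forall>u\<in>\<sigma>. \<forall>w\<in>\<sigma>. comparable b u w))}"

text \<open>
  A vertex of \<open>\<sigma>\<close> with a highest position. The choice is made at the stage \<open>birth \<sigma>\<close>, so that it does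
  not depend on the stage at which the clique \<open>\<sigma>\<close> is considered; this makes the realizations at
  different stages compatible.
\<close>
definition top_vertex :: "'v set \<Rightarrow> 'v" where
  "top_vertex \<sigma> = (SOME v. v \<in> \<sigma> \<and>
     (\<forall>w\<in>\<sigma>. specializes (X (birth \<sigma>)) (position (birth \<sigma>) w) (position (birth \<sigma>) v)))"

abbreviation complex_at :: "'p \<Rightarrow> 'v set set" where
  "complex_at c \<equiv> clique_complex (sublevel_graph graph birth c)"

lemma birth_eq: "last_birth \<sigma> b \<Longrightarrow> birth \<sigma> = b"
  unfolding birth_def by (rule the_equality) (auto simp: last_birth_def intro: antisym)

lemma continuous_\<tau>: "a \<in> P \<Longrightarrow> b \<in> P \<Longrightarrow> a \<le> b \<Longrightarrow> continuous_map (X a) (X b) (\<tau> a b)"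
  using space by (simp add: persistent_finite_space_def)

lemma position_in_topspace:
  assumes "v \<in> V" "c \<in> P" "\<alpha> v \<le> c"
  shows "position c v \<in> topspace (X c)"
  using continuous_map_funspace[OF continuous_\<tau>[OF \<alpha>[OF assms(1)] assms(2,3)]] \<xi>[OF assms(1)]
  by (auto simp: position_def)

lemma position_push:
  assumes "v \<in> V" "b \<in> P" "c \<in> P" "\<alpha> v \<le> b" "b \<le> c"
  shows "\<tau> b c (position b v) = position c v"
  using space \<alpha>[OF assms(1)] \<xi>[OF assms(1)] assms(2-)
  unfolding persistent_finite_space_def position_def by blast

text \<open>
  Only this direction holds: positions can become comparable at a later stage.
\<close>
lemma specializes_push:
  assumes "u \<in> V" "w \<in> V" "b \<in> P" "c \<in> P" "\<alpha> u \<le> b" "\<alpha> w \<le> b" "b \<le> c"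
    and "specializes (X b) (position b u) (position b w)"
  shows "specializes (X c) (position c u) (position c w)"
  using specializes_continuous_map[OF continuous_\<tau>[OF assms(3,4,7)] assms(8)] assms(1-7)
  by (simp add: position_push)

lemma comparable_push:
  assumes "u \<in> V" "w \<in> V" "b \<in> P" "c \<in> P" "\<alpha> u \<le> b" "\<alpha> w \<le> b" "b \<le> c" "comparable b u w"
  shows "comparable c u w"
  using assms(8) specializes_push[OF assms(1-7)] specializes_push[OF assms(2,1,3,4,6,5,7)]
  by (auto simp: comparable_def)

lemma comparable_refl: "v \<in> V \<Longrightarrow> c \<in> P \<Longrightarrow> \<alpha> v \<le> c \<Longrightarrow> comparable c v v"
  by (simp add: comparable_def specializes_refl position_in_topspace)

lemma weighted_graph: "weighted_graph P graph birth"
  unfolding weighted_graph_def finite_graph_def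
proof (intro conjI ballI impI)
  show "finite graph" using finite_V by (auto simp: graph_def intro: finite_subset[of _ "Pow V"])
  show "abstract_simplicial_complex graph"
    unfolding abstract_simplicial_complex_def
  proof (intro ballI conjI allI impI)
    fix \<sigma> assume \<sigma>: "\<sigma> \<in> graph"
    then show "finite \<sigma>" "\<sigma> \<noteq> {}" using finite_V by (auto simp: graph_def intro: finite_subset)
    fix \<rho> assume \<rho>: "\<rho> \<subseteq> \<sigma> \<and> \<rho> \<noteq> {}"
    show "\<rho> \<in> graph"
    proof (cases "\<rho> = \<sigma>")
      case False
      then have "card \<rho> < card \<sigma>" using \<rho> \<open>finite \<sigma>\<close> by (intro psubset_card_mono) auto
      moreover have "card \<rho> > 0" using \<rho> \<open>finite \<sigma>\<close> by (auto simp: card_gt_0_iff intro: finite_subset)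
      moreover have "card \<sigma> \<le> 2" using \<sigma> by (simp add: graph_def)
      ultimately have "card \<rho> = 1" by linarith
      then obtain w where w: "\<rho> = {w}" by (auto simp: card_1_singleton_iff)
      then have "w \<in> V" using \<rho> \<sigma> by (auto simp: graph_def)
      then show ?thesis
        by (simp add: w graph_def last_birth_def comparable_refl \<alpha>)
    qed (use \<sigma> in simp)
  qed
  show "card \<sigma> \<le> 2" if "\<sigma> \<in> graph" for \<sigma> using that by (simp add: graph_def)
  have birth: "last_birth \<sigma> (birth \<sigma>)" if "\<sigma> \<in> graph" for \<sigma>
    using that birth_eq by (auto simp: graph_def)
  show "birth \<in> graph \<rightarrow> P"
  proof
    fix \<sigma> assume \<sigma>: "\<sigma> \<in> graph"
    obtain w where w: "w \<in> \<sigma>" "birth \<sigma> = \<alpha> w" using birth[OF \<sigma>] by (auto simp: last_birth_def)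
    have "w \<in> V" using \<sigma> w(1) by (auto simp: graph_def)
    then show "birth \<sigma> \<in> P" using \<alpha> w(2) by simp
  qed
  show "birth x \<le> birth y" if "x \<in> graph" "y \<in> graph" "x \<subseteq> y" for x y
    using birth[OF that(1)] birth[OF that(2)] that(3) by (auto simp: last_birth_def)
qed

lemma pair_in_sublevel_graph:
  assumes "{u, w} \<in> sublevel_graph graph birth c"
  obtains b where "u \<in> V" "w \<in> V" "b \<in> P" "last_birth {u, w} b" "b \<le> c" "comparable b u w"
proof -
  have uw: "{u, w} \<in> graph" "birth {u, w} \<le> c" using assms by (auto simp: sublevel_graph_def)
  then obtain b where b: "last_birth {u, w} b" "comparable b u w" "u \<in> V" "w \<in> V"
    by (auto simp: graph_def)
  moreover have "b \<in> P" using b \<alpha> by (auto simp: last_birth_def)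
  ultimately show thesis using that uw(2) birth_eq by blast
qed

lemma pair_in_sublevel_graphI:
  assumes "u \<in> V" "w \<in> V" "last_birth {u, w} c" "comparable c u w"
  shows "{u, w} \<in> sublevel_graph graph birth c"
proof -
  have "comparable c v v" if "v \<in> {u, w}" for v
    using assms that \<alpha> by (intro comparable_refl) (auto simp: last_birth_def)
  moreover have "comparable c w u" using assms(4) by (auto simp: comparable_def)
  ultimately show ?thesis
    using assms by (auto simp: sublevel_graph_def graph_def birth_eq card_insert_if)
qed

lemma simplex_complex_at:
  assumes "\<sigma> \<in> complex_at c" "v \<in> \<sigma>"
  shows "v \<in> V" "\<alpha> v \<le> c"
proof -
  have "{v, v} \<in> sublevel_graph graph birth c" using assms unfolding clique_complex_def by blast
  then show "v \<in> V" "\<alpha> v \<le> c"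
    by (rule pair_in_sublevel_graph, simp add: last_birth_def)+
qed

text \<open>
  The births of the vertices of a clique are pairwise comparable, so one of them, \<open>b\<close>, is the last. At
  stage \<open>b\<close> the positions are pairwise comparable as well, and a vertex that is highest there remains
  highest at the stage \<open>c\<close>.
\<close>
lemma top_vertex:
  assumes \<sigma>: "\<sigma> \<in> complex_at c" and c: "c \<in> P"
  shows "top_vertex \<sigma> \<in> \<sigma>"
    and "w \<in> \<sigma> \<Longrightarrow> specializes (X c) (position c w) (position c (top_vertex \<sigma>))"
proof -
  note V = simplex_complex_at(1)[OF \<sigma>]
  have fin: "finite \<sigma>" "\<sigma> \<noteq> {}" using \<sigma> by (auto simp: clique_complex_def)
  have pair: "{u, w} \<in> sublevel_graph graph birth c" if "u \<in> \<sigma>" "w \<in> \<sigma>" for u w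
    using \<sigma> that by (simp add: clique_complex_def)
  have births: "\<alpha> u \<le> \<alpha> w \<or> \<alpha> w \<le> \<alpha> u" if "u \<in> \<sigma>" "w \<in> \<sigma>" for u w
    by (rule pair_in_sublevel_graph[OF pair[OF that]]) (auto simp: last_birth_def)
  have "\<exists>y\<in>\<sigma>. \<forall>w\<in>\<sigma>. \<alpha> w \<le> \<alpha> y"
    by (rule finite_total_preorder_greatest[OF fin]) (erule (1) births order_trans | rule order_refl)+
  then obtain y where y: "y \<in> \<sigma>" "\<forall>w\<in>\<sigma>. \<alpha> w \<le> \<alpha> y" by blast
  define b where "b = \<alpha> y"
  have b: "b \<in> P" "b \<le> c" "birth \<sigma> = b" "\<And>w. w \<in> \<sigma> \<Longrightarrow> \<alpha> w \<le> b"
    using y \<alpha> V simplex_complex_at(2)[OF \<sigma>] by (auto simp: b_def last_birth_def intro!: birth_eq)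
  have "comparable b u w" if uw: "u \<in> \<sigma>" "w \<in> \<sigma>" for u w
  proof (rule pair_in_sublevel_graph[OF pair[OF uw]])
    fix b' assume b': "b' \<in> P" "last_birth {u, w} b'" "comparable b' u w"
    then have "\<alpha> u \<le> b'" "\<alpha> w \<le> b'" "b' \<le> b" using b(4) uw by (auto simp: last_birth_def)
    then show ?thesis using b' b(1) uw V by (intro comparable_push[of u w b' b])
  qed
  moreover have "specializes (X b) (position b w) (position b w)" if "w \<in> \<sigma>" for w
    using that V b by (intro specializes_refl position_in_topspace)
  ultimately have "\<exists>v\<in>\<sigma>. \<forall>w\<in>\<sigma>. specializes (X b) (position b w) (position b v)"
    using fin by (intro finite_total_preorder_greatest) (auto simp: comparable_def intro: specializes_trans)
  then have "\<exists>v. v \<in> \<sigma> \<and> (\<forall>w\<in>\<sigma>. specializes (X (birth \<sigma>)) (position (birth \<sigma>) w) (position (birth \<sigma>) v))"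
    unfolding b(3) by blast
  from someI_ex[OF this, folded top_vertex_def]
  have top: "top_vertex \<sigma> \<in> \<sigma>" "\<And>w. w \<in> \<sigma> \<Longrightarrow> specializes (X b) (position b w) (position b (top_vertex \<sigma>))"
    unfolding b(3) by auto
  show "top_vertex \<sigma> \<in> \<sigma>" by (rule top)
  show "specializes (X c) (position c w) (position c (top_vertex \<sigma>))" if "w \<in> \<sigma>"
    using that top V b c by (intro specializes_push[of w "top_vertex \<sigma>" b c]) auto
qed

text \<open>
  The apex over \<open>m\<close> is a vertex born at \<open>c\<close> with the point \<open>m\<close>. It is joined to all vertices with a
  position below \<open>m\<close>, since these are born at \<open>c\<close> or earlier.
\<close>
lemma finite_space_cover_complex_at:
  assumes c: "c \<in> P"
  shows "finite_space_cover (X c) (complex_at c) (position c) (\<lambda>\<sigma>. position c (top_vertex \<sigma>))"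
proof
  show "finite (topspace (X c))" using space c by (simp add: persistent_finite_space_def)
  show "abstract_simplicial_complex (complex_at c)" by (rule abstract_simplicial_complex_clique_complex)
  fix \<sigma> assume \<sigma>: "\<sigma> \<in> complex_at c"
  show "position c v \<in> topspace (X c)" if "v \<in> \<sigma>" for v
    using simplex_complex_at[OF \<sigma> that] c by (intro position_in_topspace)
  show "position c (top_vertex \<sigma>) \<in> position c ` \<sigma>" using top_vertex(1)[OF \<sigma> c] by (rule imageI)
  show "specializes (X c) (position c v) (position c (top_vertex \<sigma>))" if "v \<in> \<sigma>" for v
    using top_vertex(2)[OF \<sigma> c that] .
next
  fix m assume m: "m \<in> topspace (X c)"
  then obtain v where v: "v \<in> V" "\<alpha> v = c" "\<xi> v = m" using all_points[OF c] by blast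
  have pos: "position c v = m" using space c m v by (simp add: position_def persistent_finite_space_def)
  have vv: "{v, v} \<in> sublevel_graph graph birth c"
    using v c by (intro pair_in_sublevel_graphI comparable_refl) (auto simp: last_birth_def)
  show "\<exists>v. position c v = m \<and> {v} \<in> complex_at c \<and>
      (\<forall>\<sigma>\<in>complex_at c. (\<forall>w\<in>\<sigma>. specializes (X c) (position c w) m) \<longrightarrow> insert v \<sigma> \<in> complex_at c)"
  proof (intro exI[of _ v] conjI ballI impI)
    show "position c v = m" by (rule pos)
    show "{v} \<in> complex_at c" using vv by (simp add: clique_complex_def)
    fix \<sigma> assume \<sigma>: "\<sigma> \<in> complex_at c" "\<forall>w\<in>\<sigma>. specializes (X c) (position c w) m"
    have "{v, w} \<in> sublevel_graph graph birth c" if "w \<in> \<sigma>" for w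
      using simplex_complex_at[OF \<sigma>(1) that] \<sigma>(2) that v pos
      by (intro pair_in_sublevel_graphI) (auto simp: last_birth_def comparable_def)
    then show "insert v \<sigma> \<in> complex_at c"
      using \<sigma>(1) vv by (auto simp: clique_complex_def insert_commute)
  qed
qed

lemma position_top_vertex_push:
  assumes "c \<in> P" "d \<in> P" "c \<le> d" "\<sigma> \<in> complex_at c"
  shows "position d (top_vertex \<sigma>) = \<tau> c d (position c (top_vertex \<sigma>))"
  using assms top_vertex(1)[OF assms(4,1)] simplex_complex_at[OF assms(4)] by (simp add: position_push)

lemma persistent_isomorphic_graph_homology:
  "persistent_isomorphic P
     (graph_homology i graph birth :: _ \<Rightarrow> ('k::field, ('v set \<Rightarrow>\<^sub>0 'k) set) module)
     (graph_homology_map i graph birth)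
     (\<lambda>a. singular_homology i (X a) :: ('k, (((nat \<Rightarrow> real) \<Rightarrow> 'a) \<Rightarrow>\<^sub>0 'k) set) module)
     (\<lambda>a b. singular_homology_map i (X b) (\<tau> a b))"
proof -
  let ?p = "\<lambda>c \<sigma>. position c (top_vertex \<sigma>)"
  let ?K = "\<lambda>c. n_simplices (complex_at c)"
  let ?S = "\<lambda>c n. singular_simplex_set n (X c)"
  let ?F = "\<lambda>c. realize_chain (?p c) :: nat \<Rightarrow> ('v set \<Rightarrow>\<^sub>0 'k) \<Rightarrow> (((nat \<Rightarrow> real) \<Rightarrow> 'a) \<Rightarrow>\<^sub>0 'k)"
  define \<phi> where "\<phi> c = homology_map singular_face (?S c) i (?F c i)" for c
  have sub: "?F c i ` cycles simplex_face (?K c) i \<subseteq> cycles singular_face (?S c) i"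
    "?F c i ` boundaries simplex_face (?K c) i \<subseteq> boundaries singular_face (?S c) i"
    and bij: "bij_betw (\<phi> c) (carrier (graph_homology i graph birth c :: ('k, ('v set \<Rightarrow>\<^sub>0 'k) set) module))
        (carrier (singular_homology i (X c)))" if c: "c \<in> P" for c
  proof -
    interpret finite_space_cover "X c" "complex_at c" "position c" "?p c"
      using c by (rule finite_space_cover_complex_at)
    have "?F c n ` chain_space (?K c) n \<subseteq> chain_space (?S c) n" for n
      using realize_chain_in_singular_chains[OF openin_topspace, of _ n, where 'k='k] by (auto simp: over_topspace)
    note sub = chain_map_cycles_boundaries[of "?F c" "?K c" "?S c" singular_face simplex_face i,
        OF linear_linear_extend this boundary_realize_chain]
    then show "?F c i ` cycles simplex_face (?K c) i \<subseteq> cycles singular_face (?S c) i"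
      "?F c i ` boundaries simplex_face (?K c) i \<subseteq> boundaries singular_face (?S c) i" by blast+
    show "bij_betw (\<phi> c) (carrier (graph_homology i graph birth c :: ('k, ('v set \<Rightarrow>\<^sub>0 'k) set) module))
        (carrier (singular_homology i (X c)))"
      using realize_chain_homology_bij[of i, where 'k='k]
      by (simp add: \<phi>_def graph_homology_def simplicial_homology_def singular_homology_def)
  qed
  have lin: "\<phi> c \<in> linear_maps (graph_homology i graph birth c) (singular_homology i (X c))" if "c \<in> P" for c
    unfolding \<phi>_def graph_homology_def simplicial_homology_def singular_homology_def
    by (rule homology_map_linear[OF linear_linear_extend sub(2)[OF that] sub(1)[OF that]])
  have \<phi>: "\<phi> c ((+) z ` boundaries simplex_face (?K c) i) = (+) (?F c i z) ` boundaries singular_face (?S c) i"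
    if "c \<in> P" for c z
    unfolding \<phi>_def by (rule homology_map_coset[OF linear_linear_extend sub(2)[OF that]])
  have natural: "\<phi> b (graph_homology_map i graph birth a b x) = singular_homology_map i (X b) (\<tau> a b) (\<phi> a x)"
    if ab: "a \<in> P" "b \<in> P" "a \<le> b"
      and x: "x \<in> carrier (graph_homology i graph birth a :: ('k, ('v set \<Rightarrow>\<^sub>0 'k) set) module)" for a b x
  proof -
    obtain z where z: "z \<in> cycles simplex_face (?K a) i" "x = (+) z ` boundaries simplex_face (?K a) i"
      using x by (auto simp: graph_homology_def simplicial_homology_def homology_def)
    have "graph_homology_map i graph birth a b x \<in> carrier (graph_homology i graph birth b)"
      by (rule persistent_map_in_carrier[OF persistent_vector_space_graph_homology ab x])
    then have incl: "graph_homology_map i graph birth a b x = (+) z ` boundaries simplex_face (?K b) i"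
      unfolding graph_homology_map_def simplicial_homology_inclusion_def z(2)
        graph_homology_def simplicial_homology_def by (rule homology_map_coset_eq)
    let ?T = "linear_extend (\<lambda>s. Poly_Mapping.single (simplex_map i (\<tau> a b) s) (1::'k))"
    have \<phi>x: "\<phi> a x \<in> carrier (singular_homology i (X a))" using bij[OF ab(1)] x by (auto simp: bij_betw_def)
    have "singular_homology_map i (X b) (\<tau> a b) (\<phi> a x) \<in> carrier (singular_homology i (X b))"
      using persistent_map_in_carrier[OF persistent_vector_space_singular_homology[OF space] ab \<phi>x] .
    then have "singular_homology_map i (X b) (\<tau> a b) (\<phi> a x) =
        (+) (?T (?F a i z)) ` boundaries singular_face (?S b) i"
      unfolding singular_homology_map_def singular_homology_def z(2) \<phi>[OF ab(1)] by (rule homology_map_coset_eq)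
    also have "?T (?F a i z) = ?F b i z"
      using z(1) position_top_vertex_push[OF ab]
      by (intro realize_chain_natural[OF abstract_simplicial_complex_clique_complex])
         (auto simp: cycles_def)
    finally show ?thesis unfolding incl \<phi>[OF ab(2)] by (rule sym)
  qed
  show ?thesis
    unfolding persistent_isomorphic_def using lin bij natural by blast
qed

end

theorem theorem3p13:
  fixes P :: "'p::order set"
    and X :: "'p \<Rightarrow> 'a topology"
    and \<tau> :: "'p \<Rightarrow> 'p \<Rightarrow> 'a \<Rightarrow> 'a"
  assumes "finite P"
    and "persistent_finite_space P X \<tau>"
    and "\<And>a b. a \<in> P \<Longrightarrow> b \<in> P \<Longrightarrow> a \<le> b \<Longrightarrow> inj_on (\<tau> a b) (topspace (X a))"
  shows "\<exists>(G :: nat set set) \<omega>. weighted_graph P G \<omega> \<and>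
    (\<forall>i. persistent_isomorphic P
       (\<lambda>a. singular_homology i (X a) ::
              ('k::field, (((nat \<Rightarrow> real) \<Rightarrow> 'a) \<Rightarrow>\<^sub>0 'k) set) module)
       (\<lambda>a b. singular_homology_map i (X b) (\<tau> a b))
       (graph_homology i G \<omega>)
       (graph_homology_map i G \<omega>))"
proof -
  \<comment> \<open>The pairs are numbered, as the vertices of the graph have to be natural numbers.\<close>
  let ?A = "SIGMA a:P. topspace (X a)"
  have "finite ?A" using assms(1,2) by (auto simp: persistent_finite_space_def)
  then obtain n :: nat and h where h: "h ` {i. i < n} = ?A"
    using finite_imp_nat_seg_image_inj_on by metis
  have hn: "h v \<in> ?A" if "v < n" for v using h that by blast
  interpret persistent_space_vertices P X \<tau> "{..<n}" "fst \<circ> h" "snd \<circ> h"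
  proof
    fix v assume "v \<in> {..<n}"
    then show "(fst \<circ> h) v \<in> P" "(snd \<circ> h) v \<in> topspace (X ((fst \<circ> h) v))"
      using hn[of v] by (auto simp: mem_Sigma_iff split: prod.splits)
  next
    fix a x assume "a \<in> P" "x \<in> topspace (X a)"
    then have "(a, x) \<in> h ` {i. i < n}" using h by simp
    then obtain v where "v < n" "h v = (a, x)" by (auto simp: image_iff)
    then show "\<exists>v\<in>{..<n}. (fst \<circ> h) v = a \<and> (snd \<circ> h) v = x" by (intro bexI[of _ v]) simp_all
  qed (use assms(2) in simp_all)
  show ?thesis
    using weighted_graph persistent_isomorphic_sym[OF persistent_vector_space_graph_homology
        persistent_isomorphic_graph_homology] by blast
qed

end
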